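(* Define an action $\triangleright$ of the generators of $U_{r,s}(\mathfrak g)$ on $U_{r,s}^+$ by setting, for $\mu\in Q$, $i\in I$, $\beta\in Q^+$ and $x\in (U_{r,s}^+)_\beta$, $$\omega_\mu\triangleright x=r^{\langle\beta,\mu\rangle}s^{-\langle\mu,\beta\rangle}x,\qquad \omega'_\mu\triangleright x=r^{-\langle\mu,\beta\rangle}s^{\langle\beta,\mu\rangle}x,$$ $$e_i\triangleright x=\frac{e_ix-r^{\langle\beta,\alpha_i\rangle}s^{-\langle\alpha_i,\beta\rangle}xe_i}{r_i-s_i},\qquad f_i\triangleright x=\overline{\partial_i}(x),$$ where $\overline{\partial_i}(x)=r^{-\langle\alpha_i,\beta-\alpha_i\rangle}s^{\langle\beta-\alpha_i,\alpha_i\rangle}\,{}_i\hat\partial(x)$. Then this makes $U_{r,s}^+$ a $U_{r,s}(\mathfrak g)$-module algebra.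
   Context: Setting. $\mathfrak g$ is a finite-dimensional simple Lie algebra with Cartan matrix $(a_{ij})_{i,j\in I}$, $I=\{1,\dots,n\}$; $d_i$ are relatively prime positive integers with $d_ia_{ij}=d_ja_{ji}$; $\alpha_i$ are the simple roots, $Q=\bigoplus_i\mathbb Z\alpha_i$, $Q^+=\bigoplus_i\mathbb Z_{\ge0}\alpha_i$, and $\Lambda$ is the weight lattice. $\mathbb K\supseteq\mathbb Q(r,s)$ is a field ($r,s$ indeterminates over $\mathbb Q$) containing $(rs^{-1})^{1/m}$, where $m$ is the smallest positive integer with $m\Lambda\subseteq Q$; $rs^{-1}$ is not a root of unity. $r_i=r^{d_i}$, $s_i=s^{d_i}$. The Euler form is the bilinear form on $Q$ with $\langle\alpha_i,\alpha_j\rangle=\langle i,j\rangle=d_ia_{ij}$ if $i<j$, $d_i$ if $i=j$, $0$ if $i>j$. Put $(k)_v=\frac{v^k-1}{v-1}$, $(k)_v!=(1)_v\cdots(k)_v$, $(0)_v!=1$, $\binom{k}{l}_v=\frac{(k)_v!}{(l)_v!(k-l)_v!}$. $U_{r,s}=U_{r,s}(\mathfrak g)$ is the unital associative $\mathbb K$-algebra generated by $e_i,f_i,\omega_i^{\pm1},\omega_i'^{\pm1}$ ($i\in I$) with relations: $\omega_i^{\pm1}\omega_i^{\mp1}=\omega_i'^{\pm1}\omega_i'^{\mp1}=1$; all $\omega_i,\omega_j'$ commute with each other; $\omega_ie_j=r^{\langle j,i\rangle}s^{-\langle i,j\rangle}e_j\omega_i$, $\omega_i'e_j=r^{-\langle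 i,j\rangle}s^{\langle j,i\rangle}e_j\omega_i'$, $\omega_if_j=r^{-\langle j,i\rangle}s^{\langle i,j\rangle}f_j\omega_i$, $\omega_i'f_j=r^{\langle i,j\rangle}s^{-\langle j,i\rangle}f_j\omega_i'$; $e_if_j-f_je_i=\delta_{i,j}\frac{\omega_i-\omega_i'}{r_i-s_i}$; and for $i\ne j$, with $c_{ij}^{(k)}=(r_is_i^{-1})^{k(k-1)/2}r^{k\langle j,i\rangle}s^{-k\langle i,j\rangle}$, $\sum_{k=0}^{1-a_{ij}}(-1)^k\binom{1-a_{ij}}{k}_{r_is_i^{-1}}c_{ij}^{(k)}e_i^{1-a_{ij}-k}e_je_i^k=0$, $\ \sum_{k=0}^{1-a_{ij}}(-1)^k\binom{1-a_{ij}}{k}_{r_is_i^{-1}}c_{ij}^{(k)}f_i^kf_jf_i^{1-a_{ij}-k}=0$. It is a Hopf algebra with $\omega_i,\omega_i'$ group-like, $\Delta(e_i)=e_i\otimes1+\omega_i\otimes e_i$, $\Delta(f_i)=1\otimes f_i+f_i\otimes\omega_i'$, $\varepsilon(e_i)=\varepsilon(f_i)=0$, $S(e_i)=-\omega_i^{-1}e_i$, $S(f_i)=-f_i\omega_i'^{-1}$. For $\mu=\sum\mu_i\alpha_i\in Q$: $\omega_\mu=\prod\omega_i^{\mu_i}$, $\omega'_\mu=\prod\omega_i'^{\mu_i}$. $U_{r,s}^+$ is the subalgebra generated by the $e_i$, $Q^+$-graded by $\deg e_i=\alpha_i$, with components $(U_{r,s}^+)_\beta$. For $x\in(U_{r,s}^+)_\beta$,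 the linear map ${}_i\hat\partial:(U_{r,s}^+)_\beta\to(U_{r,s}^+)_{\beta-\alpha_i}$ is defined by $\Delta(x)=\omega_\beta\otimes x+\sum_{i\in I}e_i\omega_{\beta-\alpha_i}\otimes{}_i\hat\partial(x)+(\text{terms with products of more than one } e_j \text{ in the first factor})$ (it is zero if $\beta-\alpha_i\notin Q^+$). An algebra $A$ is an $H$-module algebra, for a Hopf algebra $H$, if $A$ is a left $H$-module with $h1_A=\varepsilon(h)1_A$ and $h(ab)=\sum(h_{(1)}a)(h_{(2)}b)$ for $h\in H$, $a,b\in A$. *)

theory Defs
  imports
    "HOL-Algebra.Algebra"
    "HOL-Algebra.Algebraic_Closure_Type"
    "HOL-Library.Poly_Mapping"
begin

text \<open>
  A \<^typ>\<open>'k\<close>-algebra is represented by a record of type \<^typ>\<open>('k, 'a) module\<close>: a not necessarily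
  commutative ring with a scalar multiplication by the elements of the field \<^typ>\<open>'k\<close>.
  (The locale \<open>algebra\<close> of HOL-Algebra requires a commutative multiplication.)
\<close>

locale k_algebra =
  module "ring_of_type_algebra :: 'k::field ring" A + ring A
  for A :: "('k::field, 'a, 'm) module_scheme" (structure) +
  assumes smult_mult_left: "\<lbrakk>x \<in> carrier A; y \<in> carrier A\<rbrakk> \<Longrightarrow> (c \<odot> x) \<otimes> y = c \<odot> (x \<otimes> y)"
    and smult_mult_right: "\<lbrakk>x \<in> carrier A; y \<in> carrier A\<rbrakk> \<Longrightarrow> x \<otimes> (c \<odot> y) = c \<odot> (x \<otimes> y)"

definition ground_algebra :: "('k::field, 'k) module" where
  "ground_algebra =
     \<lparr>carrier = UNIV, monoid.mult = (*), one = 1, ring.zero = 0, add = (+), module.smult = (*)\<rparr>"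

definition algebra_hom ::
  "('k, 'a, 'm) module_scheme \<Rightarrow> ('k, 'b, 'n) module_scheme \<Rightarrow> ('a \<Rightarrow> 'b) set" where
  "algebra_hom A B =
     {h \<in> ring_hom A B. \<forall>c. \<forall>x\<in>carrier A. h (c \<odot>\<^bsub>A\<^esub> x) = c \<odot>\<^bsub>B\<^esub> h x}"

inductive_set linear_span :: "('k, 'a, 'm) module_scheme \<Rightarrow> 'a set \<Rightarrow> 'a set"
  for A :: "('k, 'a, 'm) module_scheme" (structure) and S :: "'a set" where
  zero: "\<zero> \<in> linear_span A S"
| step: "\<lbrakk>x \<in> S; v \<in> linear_span A S\<rbrakk> \<Longrightarrow> (c \<odot> x) \<oplus> v \<in> linear_span A S"

inductive_set subalgebra_generated :: "('k, 'a, 'm) module_scheme \<Rightarrow> 'a set \<Rightarrow> 'a set"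
  for A :: "('k, 'a, 'm) module_scheme" (structure) and S :: "'a set" where
  incl: "x \<in> S \<Longrightarrow> x \<in> subalgebra_generated A S"
| one: "\<one> \<in> subalgebra_generated A S"
| add: "\<lbrakk>x \<in> subalgebra_generated A S; y \<in> subalgebra_generated A S\<rbrakk>
    \<Longrightarrow> x \<oplus> y \<in> subalgebra_generated A S"
| smult: "x \<in> subalgebra_generated A S \<Longrightarrow> c \<odot> x \<in> subalgebra_generated A S"
| mult: "\<lbrakk>x \<in> subalgebra_generated A S; y \<in> subalgebra_generated A S\<rbrakk>
    \<Longrightarrow> x \<otimes> y \<in> subalgebra_generated A S"

definition quotient_algebra ::
  "('k, 'a, 'm) module_scheme \<Rightarrow> 'a set \<Rightarrow> ('k, 'a set) module" where
  "quotient_algebra A J =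
     ring.extend (A Quot J) (module.fields (\<lambda>c C. \<Union>x\<in>C. J +>\<^bsub>A\<^esub> (c \<odot>\<^bsub>A\<^esub> x)))"

text \<open>
  The free monoid on \<^typ>\<open>'g\<close>. It is written additively only because the convolution product of
  \<^typ>\<open>'a \<Rightarrow>\<^sub>0 'b\<close> uses the operation of the class \<^class>\<open>monoid_add\<close> on \<^typ>\<open>'a\<close>; with this
  instance, \<open>'g free_monoid \<Rightarrow>\<^sub>0 'k\<close> is the free associative unital algebra on \<^typ>\<open>'g\<close>.
\<close>

datatype 'g free_monoid = Word (letters: "'g list")

instantiation free_monoid :: (type) monoid_add
begin

definition zero_free_monoid :: "'g free_monoid" where
  "zero_free_monoid = Word []"

definition plus_free_monoid :: "'g free_monoid \<Rightarrow> 'g free_monoid \<Rightarrow> 'g free_monoid" where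
  "plus_free_monoid u v = Word (letters u @ letters v)"

instance
  by standard (simp_all add: zero_free_monoid_def plus_free_monoid_def)

end

type_synonym ('g, 'k) free_alg = "'g free_monoid \<Rightarrow>\<^sub>0 'k"

definition free_gen :: "'g \<Rightarrow> ('g, 'k::field) free_alg" where
  "free_gen g = Poly_Mapping.single (Word [g]) 1"

definition free_scalar :: "'k::field \<Rightarrow> ('g, 'k) free_alg" where
  "free_scalar c = Poly_Mapping.single 0 c"

definition free_algebra :: "('k::field, ('g, 'k) free_alg) module" where
  "free_algebra =
     \<lparr>carrier = UNIV, monoid.mult = (*), one = 1, ring.zero = 0, add = (+),
      module.smult = (\<lambda>c x. free_scalar c * x)\<rparr>"

text \<open>The algebra generated by \<^typ>\<open>'g\<close> subject to \<open>x = 0\<close> for all \<open>x \<in> R\<close>.\<close>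

definition presented_algebra ::
  "('g, 'k::field) free_alg set \<Rightarrow> ('k, ('g, 'k) free_alg set) module" where
  "presented_algebra R = quotient_algebra free_algebra (Idl\<^bsub>free_algebra\<^esub> R)"

text \<open>
  \<open>pair_algebra A B\<close> is the free vector space on the set \<open>carrier A \<times> carrier B\<close>, with the
  componentwise multiplication of basis elements. The tensor product is its quotient by the
  bilinearity relations. The ideal generated by these relations coincides with the subspace spanned
  by them.
\<close>

definition pair_algebra ::
  "('k::field, 'a, 'm) module_scheme \<Rightarrow> ('k, 'b, 'n) module_scheme
    \<Rightarrow> ('k, 'a \<times> 'b \<Rightarrow>\<^sub>0 'k) module" where
  "pair_algebra A B =
     \<lparr>carrier = {p. Poly_Mapping.keys p \<subseteq> carrier A \<times> carrier B},
      monoid.mult = (\<lambda>p q. \<Sum>u\<in>Poly_Mapping.keys p. \<Sum>v\<in>Poly_Mapping.keys q.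
        Poly_Mapping.single (fst u \<otimes>\<^bsub>A\<^esub> fst v, snd u \<otimes>\<^bsub>B\<^esub> snd v)
          (Poly_Mapping.lookup p u * Poly_Mapping.lookup q v)),
      one = Poly_Mapping.single (\<one>\<^bsub>A\<^esub>, \<one>\<^bsub>B\<^esub>) 1,
      ring.zero = 0,
      add = (+),
      module.smult = (\<lambda>c p. Poly_Mapping.map ((*) c) p)\<rparr>"

inductive_set bilinearity_relations ::
  "('k::field, 'a, 'm) module_scheme \<Rightarrow> ('k, 'b, 'n) module_scheme \<Rightarrow> ('a \<times> 'b \<Rightarrow>\<^sub>0 'k) set"
  for A :: "('k, 'a, 'm) module_scheme" and B :: "('k, 'b, 'n) module_scheme" where
  add_left: "\<lbrakk>x \<in> carrier A; x' \<in> carrier A; y \<in> carrier B\<rbrakk> \<Longrightarrow>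
    Poly_Mapping.single (x \<oplus>\<^bsub>A\<^esub> x', y) 1
      - Poly_Mapping.single (x, y) 1 - Poly_Mapping.single (x', y) 1
    \<in> bilinearity_relations A B"
| add_right: "\<lbrakk>x \<in> carrier A; y \<in> carrier B; y' \<in> carrier B\<rbrakk> \<Longrightarrow>
    Poly_Mapping.single (x, y \<oplus>\<^bsub>B\<^esub> y') 1
      - Poly_Mapping.single (x, y) 1 - Poly_Mapping.single (x, y') 1
    \<in> bilinearity_relations A B"
| smult_left: "\<lbrakk>x \<in> carrier A; y \<in> carrier B\<rbrakk> \<Longrightarrow>
    Poly_Mapping.single (c \<odot>\<^bsub>A\<^esub> x, y) 1 - Poly_Mapping.single (x, y) c
    \<in> bilinearity_relations A B"
| smult_right: "\<lbrakk>x \<in> carrier A; y \<in> carrier B\<rbrakk> \<Longrightarrow>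
    Poly_Mapping.single (x, c \<odot>\<^bsub>B\<^esub> y) 1 - Poly_Mapping.single (x, y) c
    \<in> bilinearity_relations A B"

definition tensor_ideal ::
  "('k::field, 'a, 'm) module_scheme \<Rightarrow> ('k, 'b, 'n) module_scheme \<Rightarrow> ('a \<times> 'b \<Rightarrow>\<^sub>0 'k) set" where
  "tensor_ideal A B = Idl\<^bsub>pair_algebra A B\<^esub> (bilinearity_relations A B)"

definition tensor_algebra ::
  "('k::field, 'a, 'm) module_scheme \<Rightarrow> ('k, 'b, 'n) module_scheme
    \<Rightarrow> ('k, ('a \<times> 'b \<Rightarrow>\<^sub>0 'k) set) module" where
  "tensor_algebra A B = quotient_algebra (pair_algebra A B) (tensor_ideal A B)"

definition pure_tensor ::
  "('k::field, 'a, 'm) module_scheme \<Rightarrow> ('k, 'b, 'n) module_scheme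
    \<Rightarrow> 'a \<Rightarrow> 'b \<Rightarrow> ('a \<times> 'b \<Rightarrow>\<^sub>0 'k) set" where
  "pure_tensor A B x y = tensor_ideal A B +>\<^bsub>pair_algebra A B\<^esub> Poly_Mapping.single (x, y) 1"

text \<open>
  Only the comultiplication \<open>\<Delta>\<close> and the counit \<open>\<epsilon>\<close> of the Hopf algebra \<open>H\<close> enter. An element
  \<open>p \<in> \<Delta> h\<close> is a formal sum of pairs representing the tensor \<open>\<Delta> h\<close>, that is, one way of writing
  \<open>\<Delta> h\<close> as a sum of pure tensors \<open>h\<^sub>1 \<otimes> h\<^sub>2\<close>; the product rule is required for every such way.
\<close>

locale module_algebra =
  H: k_algebra H + A: k_algebra A
  for H :: "('k::field, 'h, 'm) module_scheme"
    and \<Delta> :: "'h \<Rightarrow> ('h \<times> 'h \<Rightarrow>\<^sub>0 'k) set"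
    and \<epsilon> :: "'h \<Rightarrow> 'k"
    and A :: "('k, 'a, 'n) module_scheme"
    and act :: "'h \<Rightarrow> 'a \<Rightarrow> 'a" +
  assumes comult_hom: "\<Delta> \<in> algebra_hom H (tensor_algebra H H)"
    and counit_hom: "\<epsilon> \<in> algebra_hom H ground_algebra"
    and act_closed: "\<lbrakk>h \<in> carrier H; x \<in> carrier A\<rbrakk> \<Longrightarrow> act h x \<in> carrier A"
    and act_add: "\<lbrakk>h \<in> carrier H; x \<in> carrier A; y \<in> carrier A\<rbrakk>
      \<Longrightarrow> act h (x \<oplus>\<^bsub>A\<^esub> y) = act h x \<oplus>\<^bsub>A\<^esub> act h y"
    and act_smult: "\<lbrakk>h \<in> carrier H; x \<in> carrier A\<rbrakk>
      \<Longrightarrow> act h (c \<odot>\<^bsub>A\<^esub> x) = c \<odot>\<^bsub>A\<^esub> act h x"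
    and add_act: "\<lbrakk>h \<in> carrier H; h' \<in> carrier H; x \<in> carrier A\<rbrakk>
      \<Longrightarrow> act (h \<oplus>\<^bsub>H\<^esub> h') x = act h x \<oplus>\<^bsub>A\<^esub> act h' x"
    and smult_act: "\<lbrakk>h \<in> carrier H; x \<in> carrier A\<rbrakk>
      \<Longrightarrow> act (c \<odot>\<^bsub>H\<^esub> h) x = c \<odot>\<^bsub>A\<^esub> act h x"
    and mult_act: "\<lbrakk>h \<in> carrier H; h' \<in> carrier H; x \<in> carrier A\<rbrakk>
      \<Longrightarrow> act (h \<otimes>\<^bsub>H\<^esub> h') x = act h (act h' x)"
    and one_act: "x \<in> carrier A \<Longrightarrow> act \<one>\<^bsub>H\<^esub> x = x"
    and act_one: "h \<in> carrier H \<Longrightarrow> act h \<one>\<^bsub>A\<^esub> = \<epsilon> h \<odot>\<^bsub>A\<^esub> \<one>\<^bsub>A\<^esub>"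
    and act_mult: "\<lbrakk>h \<in> carrier H; p \<in> \<Delta> h; x \<in> carrier A; y \<in> carrier A\<rbrakk>
      \<Longrightarrow> act h (x \<otimes>\<^bsub>A\<^esub> y) =
        (\<Oplus>\<^bsub>A\<^esub>u\<in>Poly_Mapping.keys p.
          Poly_Mapping.lookup p u \<odot>\<^bsub>A\<^esub> (act (fst u) x \<otimes>\<^bsub>A\<^esub> act (snd u) y))"

text \<open>
  The index set \<open>I = {1, \<dots>, n}\<close> is a type of class \<^class>\<open>finite\<close> and \<^class>\<open>linorder\<close>.
  A finite-dimensional simple Lie algebra is given through its Cartan matrix; the matrices arising
  in this way are the indecomposable ones of finite type.
\<close>

definition simple_cartan_matrix :: "('i::finite \<Rightarrow> 'i \<Rightarrow> int) \<Rightarrow> bool" where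
  "simple_cartan_matrix a \<longleftrightarrow>
     (\<forall>i. a i i = 2) \<and>
     (\<forall>i j. i \<noteq> j \<longrightarrow> a i j \<le> 0) \<and>
     (\<forall>i j. a i j = 0 \<longleftrightarrow> a j i = 0) \<and>
     (\<exists>D :: 'i \<Rightarrow> real. (\<forall>i. D i > 0) \<and>
        (\<forall>i j. D i * of_int (a i j) = D j * of_int (a j i)) \<and>
        (\<forall>x :: 'i \<Rightarrow> real. (\<exists>i. x i \<noteq> 0) \<longrightarrow>
           (\<Sum>i\<in>UNIV. \<Sum>j\<in>UNIV. D i * of_int (a i j) * x i * x j) > 0)) \<and>
     (\<forall>J. J \<noteq> {} \<and> J \<noteq> UNIV \<longrightarrow> (\<exists>i\<in>J. \<exists>j\<in>-J. a i j \<noteq> 0))"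

text \<open>
  Rational combinations \<open>\<Sum>\<^sub>j \<xi>\<^sub>j \<alpha>\<^sub>j\<close> of the simple roots whose pairing with every simple coroot is
  integral, with the convention that \<open>a i j\<close> is the pairing of \<open>\<alpha>\<^sub>j\<close> with the coroot of \<open>\<alpha>\<^sub>i\<close>.
\<close>

definition weight_lattice :: "('i::finite \<Rightarrow> 'i \<Rightarrow> int) \<Rightarrow> ('i \<Rightarrow> rat) set" where
  "weight_lattice a = {\<xi>. \<forall>i. (\<Sum>j\<in>UNIV. of_int (a i j) * \<xi> j) \<in> \<int>}"

definition weight_exponent :: "('i::finite \<Rightarrow> 'i \<Rightarrow> int) \<Rightarrow> nat" where
  "weight_exponent a =
     (LEAST m. 0 < m \<and> (\<forall>\<xi>\<in>weight_lattice a. \<forall>i. of_nat m * \<xi> i \<in> \<int>))"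

definition alg_independent_pair :: "'k::field_char_0 \<Rightarrow> 'k \<Rightarrow> bool" where
  "alg_independent_pair r s \<longleftrightarrow>
     (\<forall>p :: nat \<times> nat \<Rightarrow>\<^sub>0 rat.
        (\<Sum>(k, l)\<in>Poly_Mapping.keys p. of_rat (Poly_Mapping.lookup p (k, l)) * r ^ k * s ^ l) = 0
        \<longrightarrow> p = 0)"

type_synonym 'i root_lattice = "'i \<Rightarrow>\<^sub>0 int"

definition simple_root :: "'i \<Rightarrow> 'i root_lattice" where
  "simple_root i = Poly_Mapping.single i 1"

definition positive_cone :: "'i root_lattice set" where
  "positive_cone = {\<beta>. \<forall>i. 0 \<le> Poly_Mapping.lookup \<beta> i}"

definition qint :: "'k::field \<Rightarrow> nat \<Rightarrow> 'k" where
  "qint v k = (v ^ k - 1) / (v - 1)"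

definition qfact :: "'k::field \<Rightarrow> nat \<Rightarrow> 'k" where
  "qfact v k = (\<Prod>j=1..k. qint v j)"

definition qbinomial :: "'k::field \<Rightarrow> nat \<Rightarrow> nat \<Rightarrow> 'k" where
  "qbinomial v k l = qfact v k / (qfact v l * qfact v (k - l))"

datatype 'i generator =
  Gen_e 'i | Gen_f 'i | Gen_om 'i | Gen_om_inv 'i | Gen_om' 'i | Gen_om_inv' 'i

context
  fixes a :: "'i::{finite,linorder} \<Rightarrow> 'i \<Rightarrow> int" and d :: "'i \<Rightarrow> nat"
    and r s :: "'k::field_char_0"
begin

definition euler :: "'i \<Rightarrow> 'i \<Rightarrow> int" where
  "euler i j = (if i < j then int (d i) * a i j else if i = j then int (d i) else 0)"

definition euler_form :: "'i root_lattice \<Rightarrow> 'i root_lattice \<Rightarrow> int" where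
  "euler_form \<mu> \<nu> =
     (\<Sum>i\<in>UNIV. \<Sum>j\<in>UNIV. Poly_Mapping.lookup \<mu> i * Poly_Mapping.lookup \<nu> j * euler i j)"

text \<open>The factor \<open>c\<^sub>i\<^sub>j\<^sup>(\<^sup>k\<^sup>)\<close> of the Serre relations is in parentheses.\<close>

definition serre_coeff :: "'i \<Rightarrow> 'i \<Rightarrow> nat \<Rightarrow> 'k" where
  "serre_coeff i j k =
     (- 1) ^ k * qbinomial (r ^ d i / s ^ d i) (nat (1 - a i j)) k *
     ((r ^ d i / s ^ d i) ^ (k * (k - 1) div 2) *
      r powi (int k * euler j i) * s powi (- (int k * euler i j)))"

text \<open>A relation \<open>u = v\<close> is recorded as the element \<open>u - v\<close> of the free algebra.\<close>

inductive_set uq_relations :: "('i generator, 'k) free_alg set" where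
  Om_OmInv: "free_gen (Gen_om i) * free_gen (Gen_om_inv i) - 1 \<in> uq_relations"
| OmInv_Om: "free_gen (Gen_om_inv i) * free_gen (Gen_om i) - 1 \<in> uq_relations"
| Om'_OmInv': "free_gen (Gen_om' i) * free_gen (Gen_om_inv' i) - 1 \<in> uq_relations"
| OmInv'_Om': "free_gen (Gen_om_inv' i) * free_gen (Gen_om' i) - 1 \<in> uq_relations"
| Om_Om: "free_gen (Gen_om i) * free_gen (Gen_om j) - free_gen (Gen_om j) * free_gen (Gen_om i) \<in> uq_relations"
| Om_Om': "free_gen (Gen_om i) * free_gen (Gen_om' j) - free_gen (Gen_om' j) * free_gen (Gen_om i) \<in> uq_relations"
| Om'_Om': "free_gen (Gen_om' i) * free_gen (Gen_om' j) - free_gen (Gen_om' j) * free_gen (Gen_om' i) \<in> uq_relations"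
| Om_E: "free_gen (Gen_om i) * free_gen (Gen_e j)
    - free_scalar (r powi euler j i * s powi (- euler i j)) * (free_gen (Gen_e j) * free_gen (Gen_om i)) \<in> uq_relations"
| Om'_E: "free_gen (Gen_om' i) * free_gen (Gen_e j)
    - free_scalar (r powi (- euler i j) * s powi euler j i) * (free_gen (Gen_e j) * free_gen (Gen_om' i)) \<in> uq_relations"
| Om_F: "free_gen (Gen_om i) * free_gen (Gen_f j)
    - free_scalar (r powi (- euler j i) * s powi euler i j) * (free_gen (Gen_f j) * free_gen (Gen_om i)) \<in> uq_relations"
| Om'_F: "free_gen (Gen_om' i) * free_gen (Gen_f j)
    - free_scalar (r powi euler i j * s powi (- euler j i)) * (free_gen (Gen_f j) * free_gen (Gen_om' i)) \<in> uq_relations"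
| E_F: "free_gen (Gen_e i) * free_gen (Gen_f j) - free_gen (Gen_f j) * free_gen (Gen_e i)
    - (if i = j then free_scalar (1 / (r ^ d i - s ^ d i)) * (free_gen (Gen_om i) - free_gen (Gen_om' i)) else 0)
    \<in> uq_relations"
| serre_E: "i \<noteq> j \<Longrightarrow>
    (\<Sum>k=0..nat (1 - a i j). free_scalar (serre_coeff i j k) *
       (free_gen (Gen_e i) ^ (nat (1 - a i j) - k) * free_gen (Gen_e j) * free_gen (Gen_e i) ^ k)) \<in> uq_relations"
| serre_F: "i \<noteq> j \<Longrightarrow>
    (\<Sum>k=0..nat (1 - a i j). free_scalar (serre_coeff i j k) *
       (free_gen (Gen_f i) ^ k * free_gen (Gen_f j) * free_gen (Gen_f i) ^ (nat (1 - a i j) - k))) \<in> uq_relations"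

definition uq :: "('k, ('i generator, 'k) free_alg set) module" where
  "uq = presented_algebra uq_relations"

definition uq_class :: "('i generator, 'k) free_alg \<Rightarrow> ('i generator, 'k) free_alg set" where
  "uq_class x = Idl\<^bsub>free_algebra\<^esub> uq_relations +>\<^bsub>free_algebra\<^esub> x"

definition uq_e :: "'i \<Rightarrow> ('i generator, 'k) free_alg set" where
  "uq_e i = uq_class (free_gen (Gen_e i))"

definition uq_f :: "'i \<Rightarrow> ('i generator, 'k) free_alg set" where
  "uq_f i = uq_class (free_gen (Gen_f i))"

text \<open>The factors commute in the quotient, so the order chosen for the products is irrelevant.\<close>

definition uq_om :: "'i root_lattice \<Rightarrow> ('i generator, 'k) free_alg set" where
  "uq_om \<mu> = uq_class (\<Prod>i\<leftarrow>sorted_list_of_set UNIV.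
     free_gen (Gen_om i) ^ nat (Poly_Mapping.lookup \<mu> i) * free_gen (Gen_om_inv i) ^ nat (- Poly_Mapping.lookup \<mu> i))"

definition uq_om' :: "'i root_lattice \<Rightarrow> ('i generator, 'k) free_alg set" where
  "uq_om' \<mu> = uq_class (\<Prod>i\<leftarrow>sorted_list_of_set UNIV.
     free_gen (Gen_om' i) ^ nat (Poly_Mapping.lookup \<mu> i) * free_gen (Gen_om_inv' i) ^ nat (- Poly_Mapping.lookup \<mu> i))"

abbreviation uq_tensor ::
  "('k, (('i generator, 'k) free_alg set \<times> ('i generator, 'k) free_alg set \<Rightarrow>\<^sub>0 'k) set) module"
  where "uq_tensor \<equiv> tensor_algebra uq uq"

abbreviation uq_pure ::
  "('i generator, 'k) free_alg set \<Rightarrow> ('i generator, 'k) free_alg set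
    \<Rightarrow> (('i generator, 'k) free_alg set \<times> ('i generator, 'k) free_alg set \<Rightarrow>\<^sub>0 'k) set"
  where "uq_pure \<equiv> pure_tensor uq uq"

definition uq_comult ::
  "('i generator, 'k) free_alg set
    \<Rightarrow> (('i generator, 'k) free_alg set \<times> ('i generator, 'k) free_alg set \<Rightarrow>\<^sub>0 'k) set" where
  "uq_comult = (THE \<Delta>. \<Delta> \<in> algebra_hom uq uq_tensor \<and> \<Delta> \<in> extensional (carrier uq) \<and>
     (\<forall>i. \<Delta> (uq_om (simple_root i)) = uq_pure (uq_om (simple_root i)) (uq_om (simple_root i)) \<and>
          \<Delta> (uq_om' (simple_root i)) = uq_pure (uq_om' (simple_root i)) (uq_om' (simple_root i)) \<and>
          \<Delta> (uq_e i) = uq_pure (uq_e i) \<one>\<^bsub>uq\<^esub> \<oplus>\<^bsub>uq_tensor\<^esub> uq_pure (uq_om (simple_root i)) (uq_e i) \<and>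
          \<Delta> (uq_f i) = uq_pure \<one>\<^bsub>uq\<^esub> (uq_f i) \<oplus>\<^bsub>uq_tensor\<^esub> uq_pure (uq_f i) (uq_om' (simple_root i))))"

definition uq_counit :: "('i generator, 'k) free_alg set \<Rightarrow> 'k" where
  "uq_counit = (THE \<epsilon>. \<epsilon> \<in> algebra_hom uq ground_algebra \<and> \<epsilon> \<in> extensional (carrier uq) \<and>
     (\<forall>i. \<epsilon> (uq_om (simple_root i)) = 1 \<and> \<epsilon> (uq_om' (simple_root i)) = 1 \<and> \<epsilon> (uq_e i) = 0 \<and> \<epsilon> (uq_f i) = 0))"

definition uq_plus :: "('k, ('i generator, 'k) free_alg set) module" where
  "uq_plus = uq\<lparr>carrier := subalgebra_generated uq (range uq_e)\<rparr>"

definition e_monomial :: "'i list \<Rightarrow> ('i generator, 'k) free_alg set" where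
  "e_monomial js = uq_class (\<Prod>j\<leftarrow>js. free_gen (Gen_e j))"

text \<open>For \<open>\<beta> \<notin> positive_cone\<close> there are no monomials of weight \<open>\<beta>\<close>, and the component is zero.\<close>

definition uq_plus_component :: "'i root_lattice \<Rightarrow> ('i generator, 'k) free_alg set set" where
  "uq_plus_component \<beta> = linear_span uq {e_monomial js | js. sum_list (map simple_root js) = \<beta>}"

text \<open>
  For \<open>x\<close> of weight \<open>\<beta>\<close>, the family \<open>y\<close> of all skew derivatives of \<open>x\<close> is the one occurring in
  the expansion of the comultiplication of \<open>x\<close>. The condition on \<open>y i\<close> gives \<open>y i = 0\<close> if
  \<open>\<beta> - simple_root i\<close> is not in the positive cone.
\<close>

definition skew_derivatives ::
  "'i root_lattice \<Rightarrow> ('i generator, 'k) free_alg set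
    \<Rightarrow> ('i \<Rightarrow> ('i generator, 'k) free_alg set) \<Rightarrow> bool" where
  "skew_derivatives \<beta> x y \<longleftrightarrow>
     (\<forall>i. y i \<in> uq_plus_component (\<beta> - simple_root i)) \<and>
     (\<exists>t \<in> linear_span uq_tensor
             {uq_pure (e_monomial js \<otimes>\<^bsub>uq\<^esub> uq_om \<mu>) z | js \<mu> z. length js \<ge> 2 \<and> z \<in> carrier uq_plus}.
        uq_comult x =
          uq_pure (uq_om \<beta>) x \<oplus>\<^bsub>uq_tensor\<^esub>
          (\<Oplus>\<^bsub>uq_tensor\<^esub>i\<in>UNIV. uq_pure (uq_e i \<otimes>\<^bsub>uq\<^esub> uq_om (\<beta> - simple_root i)) (y i))
          \<oplus>\<^bsub>uq_tensor\<^esub> t)"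

definition skew_derivative ::
  "'i \<Rightarrow> 'i root_lattice \<Rightarrow> ('i generator, 'k) free_alg set \<Rightarrow> ('i generator, 'k) free_alg set" where
  "skew_derivative i \<beta> x = (THE y. skew_derivatives \<beta> x y) i"

definition twisted_derivative ::
  "'i \<Rightarrow> 'i root_lattice \<Rightarrow> ('i generator, 'k) free_alg set \<Rightarrow> ('i generator, 'k) free_alg set" where
  "twisted_derivative i \<beta> x =
     (r powi (- euler_form (simple_root i) (\<beta> - simple_root i)) *
      s powi euler_form (\<beta> - simple_root i) (simple_root i)) \<odot>\<^bsub>uq\<^esub> skew_derivative i \<beta> x"

end

end

theory Submission
  imports Defs
begin

text \<open>
  Only the quotient map from the free algebra \<open>T\<close> on letters \<open>e\<^sub>i\<close> onto \<open>U\<^sup>+\<close> is at hand; its kernel \<open>K\<close>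
  is not described by relations. The action is therefore constructed on \<open>T\<close> and pushed down. On \<open>T\<close>
  the \<open>\<omega>\<^sub>i\<close>, \<open>\<omega>\<^sub>i'\<close> act by scalars on words, \<open>f\<^sub>i\<close> by the skew derivation \<open>F i\<close> with
  \<open>F i (e\<^sub>k t) = e\<^sub>k F i t + \<delta>\<^sub>i\<^sub>k \<omega>\<^sub>i' t\<close>, and \<open>e\<^sub>i\<close> by the skew commutator \<open>E i\<close>. Two things have to be
  shown: the defining relations of \<open>U\<close> map \<open>T\<close> into \<open>K\<close>, and the operators preserve \<open>K\<close>.

  The relations other than the Serre relations hold on \<open>T\<close> by short computations. A Serre
  relation is handled as an iterated skew commutator \<open>qserre\<close>, because of two facts. If an element
  has a commutator with \<open>x\<close> or with \<open>y\<close> that skew commutes with \<open>x\<close> and \<open>y\<close> with the right scalars,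
  it commutes with the Serre element of \<open>x\<close> and \<open>y\<close> (\<open>qserre_commutes_first\<close>,
  \<open>qserre_commutes_second\<close>). And the Serre element is additive on skew commuting summands
  (\<open>qserre_add\<close>). By the first fact the Serre operator in the \<open>F i\<close> commutes with left
  multiplications, and it kills \<open>1\<close>, so it is zero (\<open>rho_serre_f_zero\<close>). By the second, applied to
  \<open>E i\<close> as a left plus a twisted right multiplication, the Serre operator in the \<open>E i\<close> is a combination
  of a left and a right multiplication by the Serre element of \<open>T\<close>, which lies in \<open>K\<close>
  (\<open>rho_serre_e_eq\<close>). The second fact also gives the comultiplication: \<open>\<Delta> e\<^sub>i\<close> and \<open>\<Delta> f\<^sub>i\<close> are sums of
  skew commuting elements (\<open>comult_exists\<close>).

  That \<open>F i\<close> preserves \<open>K\<close> comes from the comultiplication. Up to terms of higher order in the first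
  factor, \<open>\<Delta> x = \<omega>\<^sub>\<beta> \<otimes> x + \<Sum>\<^sub>i e\<^sub>i \<omega>\<^sub>\<beta>\<^sub>-\<^sub>\<alpha>\<^sub>i \<otimes> y\<^sub>i\<close> where \<open>y\<^sub>i\<close> is the image of an untwisted form of \<open>F i\<close>
  (\<open>comult_eta\<close>); a linear functional on \<open>U\<close> that, among the products
  of letters \<open>e\<^sub>j\<close> with an \<open>\<omega>\<^sub>\<mu>\<close>, only sees the \<open>e\<^sub>i \<omega>\<^sub>\<mu>\<close> recovers \<open>y\<^sub>i\<close> from \<open>\<Delta> x\<close> up to a nonzero scalar. The same functional shows that the family \<open>y\<close> is unique, hence equal to the family of
  skew derivatives (\<open>skew_derivative_eta\<close>). The functional is a matrix coefficient of a representation of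
  \<open>U\<close>, namely of \<open>T\<close> modulo the largest subspace that is stable under the \<open>F i\<close> and has no constant
  terms. The Serre operators in the \<open>E i\<close> map \<open>T\<close> into this subspace, because by the first fact they commute
  with all \<open>F l\<close> (\<open>rho_serre_e_F\<close>, \<open>vanish_relation\<close>).

  Finally, the product rule \<open>h (x y) = \<Sum> (h\<^sub>1 x) (h\<^sub>2 y)\<close> holds for generators \<open>h\<close> by the skew Leibniz rules
  of \<open>E i\<close> and \<open>F i\<close> and propagates along products (\<open>act_product\<close>); the action is unique since its
  values on the generators of \<open>U\<close> are prescribed on the weight spaces, which span \<open>U\<^sup>+\<close>.
\<close>

section \<open>Algebras over a field\<close>

lemma k_algebraI:
  fixes A :: "('k::field, 'a, 'm) module_scheme" (structure)
  assumes "ring A"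
    and "\<And>c x. x \<in> carrier A \<Longrightarrow> c \<odot> x \<in> carrier A"
    and "\<And>c c' x. x \<in> carrier A \<Longrightarrow> (c + c') \<odot> x = c \<odot> x \<oplus> c' \<odot> x"
    and "\<And>c x y. \<lbrakk>x \<in> carrier A; y \<in> carrier A\<rbrakk> \<Longrightarrow> c \<odot> (x \<oplus> y) = c \<odot> x \<oplus> c \<odot> y"
    and "\<And>c c' x. x \<in> carrier A \<Longrightarrow> (c * c') \<odot> x = c \<odot> (c' \<odot> x)"
    and "\<And>x. x \<in> carrier A \<Longrightarrow> 1 \<odot> x = x"
    and "\<And>c x y. \<lbrakk>x \<in> carrier A; y \<in> carrier A\<rbrakk> \<Longrightarrow> (c \<odot> x) \<otimes> y = c \<odot> (x \<otimes> y)"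
    and "\<And>c x y. \<lbrakk>x \<in> carrier A; y \<in> carrier A\<rbrakk> \<Longrightarrow> x \<otimes> (c \<odot> y) = c \<odot> (x \<otimes> y)"
  shows "k_algebra A"
proof -
  interpret ring A by fact
  have "module (ring_of_type_algebra :: 'k ring) A"
  proof (rule moduleI)
    show "cring (ring_of_type_algebra :: 'k ring)" by (rule cring_from_type_algebra)
  qed (use assms in \<open>simp_all add: ring_of_type_algebra_def is_abelian_group\<close>)
  then show ?thesis
    unfolding k_algebra_def k_algebra_axioms_def using assms by blast
qed

context k_algebra
begin

lemma sm_closed [simp, intro]: "x \<in> carrier A \<Longrightarrow> c \<odot> x \<in> carrier A"
  using smult_closed[of c x] by (simp add: ring_of_type_algebra_def)

lemma sm_add_left: "x \<in> carrier A \<Longrightarrow> (c + c') \<odot> x = c \<odot> x \<oplus> c' \<odot> x"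
  using smult_l_distr[of c c' x] by (simp add: ring_of_type_algebra_def)

lemma sm_add_right: "\<lbrakk>x \<in> carrier A; y \<in> carrier A\<rbrakk> \<Longrightarrow> c \<odot> (x \<oplus> y) = c \<odot> x \<oplus> c \<odot> y"
  using smult_r_distr[of c x y] by (simp add: ring_of_type_algebra_def)

lemma sm_sm [simp]: "x \<in> carrier A \<Longrightarrow> c \<odot> (c' \<odot> x) = (c * c') \<odot> x"
  using smult_assoc1[of c c' x] by (simp add: ring_of_type_algebra_def)

lemma sm_one [simp]: "x \<in> carrier A \<Longrightarrow> 1 \<odot> x = x"
  using smult_one[of x] by (simp add: ring_of_type_algebra_def)

lemma sm_zero_left [simp]: "x \<in> carrier A \<Longrightarrow> 0 \<odot> x = \<zero>"
  using smult_l_null[of x] by (simp add: ring_of_type_algebra_def)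

lemma sm_zero_right [simp]: "c \<odot> \<zero> = \<zero>"
  using smult_r_null[of c] by (simp add: ring_of_type_algebra_def)

lemma neg_eq_sm: "x \<in> carrier A \<Longrightarrow> \<ominus> x = (- 1) \<odot> x"
proof -
  assume x: "x \<in> carrier A"
  have "(- 1) \<odot> x \<oplus> x = \<zero>"
    using x sm_add_left[of x "- 1" 1] by simp
  then show ?thesis using x by (simp add: minus_equality)
qed

lemma minus_eq_sm: "\<lbrakk>x \<in> carrier A; y \<in> carrier A\<rbrakk> \<Longrightarrow> x \<ominus> y = x \<oplus> (- 1) \<odot> y"
  by (simp add: minus_eq neg_eq_sm)

lemma sm_minus: "\<lbrakk>x \<in> carrier A; y \<in> carrier A\<rbrakk> \<Longrightarrow> c \<odot> (x \<ominus> y) = c \<odot> x \<ominus> c \<odot> y"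
  by (simp add: minus_eq_sm sm_add_right)

lemmas sm_mult_left [simp] = smult_mult_left
lemmas sm_mult_right [simp] = smult_mult_right

lemma finsum_sm:
  "\<lbrakk>finite S; f \<in> S \<rightarrow> carrier A\<rbrakk> \<Longrightarrow> c \<odot> (\<Oplus>i\<in>S. f i) = (\<Oplus>i\<in>S. c \<odot> f i)"
  by (induct set: finite) (auto simp: Pi_def sm_add_right)

end

lemma poly_mapping_span_induct [consumes 1, case_names zero single add]:
  assumes "Poly_Mapping.keys p \<subseteq> S"
    and "P 0"
    and "\<And>u c. u \<in> S \<Longrightarrow> P (Poly_Mapping.single u c)"
    and "\<And>p q. \<lbrakk>Poly_Mapping.keys p \<subseteq> S; Poly_Mapping.keys q \<subseteq> S; P p; P q\<rbrakk> \<Longrightarrow> P (p + q)"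
  shows "P p"
  using assms(1)
proof (induct p rule: update_induct)
  case (update f a b)
  have eq: "Poly_Mapping.update a b f = Poly_Mapping.single a b + f"
    using update(1) by (intro poly_mapping_eqI)
      (auto simp: lookup_update lookup_add lookup_single in_keys_iff when_def)
  have "Poly_Mapping.keys (Poly_Mapping.update a b f) = insert a (Poly_Mapping.keys f)"
    using update(2) by (auto simp: keys_update)
  then show ?case
    using update assms(3)[of a b] assms(4)[of "Poly_Mapping.single a b" f]
    by (auto simp: eq)
qed (rule assms(2))

lemma k_algebra_free: "k_algebra (free_algebra :: ('k::field, ('g, 'k) free_alg) module)"
proof -
  have comm: "free_scalar c * x = x * free_scalar c" for c and x :: "('g, 'k) free_alg"
  proof -
    have "Poly_Mapping.keys x \<subseteq> UNIV" by simp
    then show ?thesis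
      by (induct rule: poly_mapping_span_induct)
        (simp_all add: free_scalar_def mult_single algebra_simps)
  qed
  have ring: "ring (free_algebra :: ('k, ('g, 'k) free_alg) module)"
  proof (rule ringI)
    show "abelian_group (free_algebra :: ('k, ('g, 'k) free_alg) module)"
    proof (rule abelian_groupI)
      fix x :: "('g, 'k) free_alg"
      show "\<exists>y\<in>carrier free_algebra. y \<oplus>\<^bsub>free_algebra\<^esub> x = \<zero>\<^bsub>free_algebra\<^esub>"
        by (rule bexI[of _ "- x"]) (simp_all add: free_algebra_def)
    qed (simp_all add: free_algebra_def algebra_simps)
    show "Group.monoid (free_algebra :: ('k, ('g, 'k) free_alg) module)"
      by (rule monoidI) (simp_all add: free_algebra_def algebra_simps)
  qed (simp_all add: free_algebra_def algebra_simps)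
  then show ?thesis
  proof (rule k_algebraI)
    fix c :: 'k and x y :: "('g, 'k) free_alg"
    show "x \<otimes>\<^bsub>free_algebra\<^esub> (c \<odot>\<^bsub>free_algebra\<^esub> y) = c \<odot>\<^bsub>free_algebra\<^esub> (x \<otimes>\<^bsub>free_algebra\<^esub> y)"
      using comm[of c x] by (simp add: free_algebra_def flip: mult.assoc)
  qed (simp_all add: free_algebra_def free_scalar_def algebra_simps single_add mult_single
      flip: mult.assoc)
qed

interpretation Free: k_algebra "free_algebra :: ('k::field, ('g, 'k) free_alg) module"
  rewrites "carrier free_algebra = UNIV" and "monoid.mult free_algebra = (*)"
    and "one free_algebra = 1" and "ring.zero free_algebra = 0" and "add free_algebra = (+)"
    and "module.smult free_algebra = (\<lambda>c x. free_scalar c * x)"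
  using k_algebra_free by (simp_all add: free_algebra_def)

text \<open>Scalars are themselves elements of the free algebra, so this rule would loop.\<close>

declare Free.sm_mult_right [simp del]

lemma free_scalar_left_commute: "x * (free_scalar c * y) = free_scalar c * (x * y)"
  using Free.smult_mult_right[of x y c] by simp

lemma free_scalar_simps [simp]:
  "free_scalar 0 = 0" "free_scalar 1 = 1" "free_scalar c * free_scalar c' = free_scalar (c * c')"
  "free_scalar c * (free_scalar c' * x) = free_scalar (c * c') * x"
  by (simp_all add: free_scalar_def mult_single flip: mult.assoc)

lemma free_scalar_add: "free_scalar (c + c') = free_scalar c + free_scalar c'"
  by (simp add: free_scalar_def single_add)

lemma free_scalar_minus: "free_scalar (- c) = - free_scalar c"
  by (simp add: free_scalar_def single_uminus)

lemma free_scalar_diff: "free_scalar (c - c') = free_scalar c - free_scalar c'"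
  by (simp add: free_scalar_def single_diff)

subsection \<open>Homomorphisms\<close>

lemma algebra_homI:
  assumes "\<And>x. x \<in> carrier A \<Longrightarrow> h x \<in> carrier B"
    and "\<And>x y. \<lbrakk>x \<in> carrier A; y \<in> carrier A\<rbrakk> \<Longrightarrow> h (x \<otimes>\<^bsub>A\<^esub> y) = h x \<otimes>\<^bsub>B\<^esub> h y"
    and "\<And>x y. \<lbrakk>x \<in> carrier A; y \<in> carrier A\<rbrakk> \<Longrightarrow> h (x \<oplus>\<^bsub>A\<^esub> y) = h x \<oplus>\<^bsub>B\<^esub> h y"
    and "h \<one>\<^bsub>A\<^esub> = \<one>\<^bsub>B\<^esub>"
    and "\<And>c x. x \<in> carrier A \<Longrightarrow> h (c \<odot>\<^bsub>A\<^esub> x) = c \<odot>\<^bsub>B\<^esub> h x"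
  shows "h \<in> algebra_hom A B"
  using assms by (auto simp: algebra_hom_def ring_hom_def)

lemma algebra_homD:
  assumes "h \<in> algebra_hom A B"
  shows "x \<in> carrier A \<Longrightarrow> h x \<in> carrier B"
    and "\<lbrakk>x \<in> carrier A; y \<in> carrier A\<rbrakk> \<Longrightarrow> h (x \<otimes>\<^bsub>A\<^esub> y) = h x \<otimes>\<^bsub>B\<^esub> h y"
    and "\<lbrakk>x \<in> carrier A; y \<in> carrier A\<rbrakk> \<Longrightarrow> h (x \<oplus>\<^bsub>A\<^esub> y) = h x \<oplus>\<^bsub>B\<^esub> h y"
    and "h \<one>\<^bsub>A\<^esub> = \<one>\<^bsub>B\<^esub>"
    and "x \<in> carrier A \<Longrightarrow> h (c \<odot>\<^bsub>A\<^esub> x) = c \<odot>\<^bsub>B\<^esub> h x"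
  using assms by (auto simp: algebra_hom_def ring_hom_def)

lemma algebra_hom_zero:
  assumes "k_algebra A" "k_algebra B" "h \<in> algebra_hom A B"
  shows "h \<zero>\<^bsub>A\<^esub> = \<zero>\<^bsub>B\<^esub>"
proof -
  interpret A: k_algebra A by fact
  interpret B: k_algebra B by fact
  have "h (0 \<odot>\<^bsub>A\<^esub> \<zero>\<^bsub>A\<^esub>) = 0 \<odot>\<^bsub>B\<^esub> h \<zero>\<^bsub>A\<^esub>"
    by (rule algebra_homD[OF assms(3)]) simp
  then show ?thesis by (simp add: algebra_homD[OF assms(3)])
qed

lemma algebra_hom_minus:
  assumes "k_algebra A" "k_algebra B" "h \<in> algebra_hom A B" "x \<in> carrier A" "y \<in> carrier A"
  shows "h (x \<ominus>\<^bsub>A\<^esub> y) = h x \<ominus>\<^bsub>B\<^esub> h y"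
proof -
  interpret A: k_algebra A by fact
  interpret B: k_algebra B by fact
  show ?thesis
    using assms(4,5) by (simp add: A.minus_eq_sm B.minus_eq_sm algebra_homD[OF assms(3)])
qed

subsection \<open>Linear extension\<close>

definition lin_ext :: "('k::field, 'c, 'm) module_scheme \<Rightarrow> ('x \<Rightarrow> 'c) \<Rightarrow> ('x \<Rightarrow>\<^sub>0 'k) \<Rightarrow> 'c" where
  "lin_ext C b p = (\<Oplus>\<^bsub>C\<^esub>u\<in>Poly_Mapping.keys p. Poly_Mapping.lookup p u \<odot>\<^bsub>C\<^esub> b u)"

context k_algebra
begin

lemma lin_ext_superset:
  assumes "finite S" "Poly_Mapping.keys p \<subseteq> S" "b \<in> S \<rightarrow> carrier A"
  shows "lin_ext A b p = (\<Oplus>u\<in>S. Poly_Mapping.lookup p u \<odot> b u)"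
  unfolding lin_ext_def
proof (rule add.finprod_mono_neutral_cong_left)
  show "Poly_Mapping.lookup p i \<odot> b i = \<zero>" if "i \<in> S - Poly_Mapping.keys p" for i
    using that assms(3) by (auto simp: in_keys_iff intro!: sm_zero_left)
qed (use assms in auto)

lemma lin_ext_closed: "b \<in> Poly_Mapping.keys p \<rightarrow> carrier A \<Longrightarrow> lin_ext A b p \<in> carrier A"
  unfolding lin_ext_def by (rule finsum_closed) auto

lemma lin_ext_add:
  assumes "b \<in> Poly_Mapping.keys p \<union> Poly_Mapping.keys q \<rightarrow> carrier A"
  shows "lin_ext A b (p + q) = lin_ext A b p \<oplus> lin_ext A b q"
proof -
  let ?S = "Poly_Mapping.keys p \<union> Poly_Mapping.keys q"
  have "lin_ext A b (p + q) = (\<Oplus>u\<in>?S. Poly_Mapping.lookup (p + q) u \<odot> b u)"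
    by (rule lin_ext_superset) (use assms keys_add[of p q] in auto)
  also have "\<dots> = (\<Oplus>u\<in>?S. Poly_Mapping.lookup p u \<odot> b u \<oplus> Poly_Mapping.lookup q u \<odot> b u)"
    by (rule finsum_cong') (use assms in \<open>auto simp: lookup_add sm_add_left Pi_def\<close>)
  also have "\<dots> = (\<Oplus>u\<in>?S. Poly_Mapping.lookup p u \<odot> b u) \<oplus> (\<Oplus>u\<in>?S. Poly_Mapping.lookup q u \<odot> b u)"
    by (rule finsum_addf) (use assms in auto)
  also have "\<dots> = lin_ext A b p \<oplus> lin_ext A b q"
    by (subst (1 2) lin_ext_superset[of ?S]) (use assms in auto)
  finally show ?thesis .
qed

lemma lin_ext_single: "b u \<in> carrier A \<Longrightarrow> lin_ext A b (Poly_Mapping.single u c) = c \<odot> b u"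
  by (subst lin_ext_superset[of "{u}"]) (auto split: if_splits)

lemma lin_ext_zero: "lin_ext A b 0 = \<zero>"
  by (simp add: lin_ext_def)

lemma lin_ext_smult:
  assumes "b \<in> Poly_Mapping.keys p \<rightarrow> carrier A"
  shows "lin_ext A b (Poly_Mapping.map ((*) c) p) = c \<odot> lin_ext A b p"
proof -
  have "lin_ext A b (Poly_Mapping.map ((*) c) p) =
      (\<Oplus>u\<in>Poly_Mapping.keys p. Poly_Mapping.lookup (Poly_Mapping.map ((*) c) p) u \<odot> b u)"
    by (rule lin_ext_superset) (use assms in \<open>auto simp: in_keys_iff Poly_Mapping.map.rep_eq\<close>)
  also have "\<dots> = (\<Oplus>u\<in>Poly_Mapping.keys p. c \<odot> (Poly_Mapping.lookup p u \<odot> b u))"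
    by (rule finsum_cong') (use assms in \<open>auto simp: Poly_Mapping.map.rep_eq in_keys_iff when_def Pi_def\<close>)
  also have "\<dots> = c \<odot> lin_ext A b p"
    unfolding lin_ext_def by (rule finsum_sm[symmetric]) (use assms in auto)
  finally show ?thesis .
qed

lemma lin_ext_minus:
  assumes "b \<in> Poly_Mapping.keys p \<union> Poly_Mapping.keys q \<rightarrow> carrier A"
  shows "lin_ext A b (p - q) = lin_ext A b p \<ominus> lin_ext A b q"
proof -
  have eq: "p - q = p + Poly_Mapping.map ((*) (- 1)) q"
    by (intro poly_mapping_eqI) (auto simp: lookup_add lookup_minus Poly_Mapping.map.rep_eq when_def)
  have "Poly_Mapping.keys (Poly_Mapping.map ((*) (- 1)) q) \<subseteq> Poly_Mapping.keys q"
    by (auto simp: in_keys_iff Poly_Mapping.map.rep_eq)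
  then show ?thesis
    unfolding eq using assms
    by (subst lin_ext_add) (auto simp: lin_ext_smult lin_ext_closed minus_eq_sm Pi_def)
qed

definition free_hom :: "('g \<Rightarrow> 'a) \<Rightarrow> ('g, 'k) free_alg \<Rightarrow> 'a" where
  "free_hom g = lin_ext A (\<lambda>w. foldr (\<lambda>l x. g l \<otimes> x) (letters w) \<one>)"

context
  fixes g :: "'g \<Rightarrow> 'a"
  assumes g: "\<And>l. g l \<in> carrier A"
begin

lemma foldr_gen_closed [simp]: "x \<in> carrier A \<Longrightarrow> foldr (\<lambda>l x. g l \<otimes> x) ls x \<in> carrier A"
  by (induct ls) (auto simp: g)

lemma foldr_gen_mult:
  "x \<in> carrier A \<Longrightarrow> foldr (\<lambda>l x. g l \<otimes> x) ls x = foldr (\<lambda>l x. g l \<otimes> x) ls \<one> \<otimes> x"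
  by (induct ls) (auto simp: g m_assoc)

lemma free_hom_add: "free_hom g (x + y) = free_hom g x \<oplus> free_hom g y"
  unfolding free_hom_def by (rule lin_ext_add) simp

lemma free_hom_closed [simp]: "free_hom g x \<in> carrier A"
  unfolding free_hom_def by (rule lin_ext_closed) simp

lemma free_hom_smult: "free_hom g (free_scalar c * x) = c \<odot> free_hom g x"
  unfolding free_hom_def by (simp add: free_scalar_def lin_ext_smult flip: mult_map_scale_conv_mult)

lemma free_hom_zero: "free_hom g 0 = \<zero>"
  by (simp add: free_hom_def lin_ext_zero)

lemma free_hom_word: "free_hom g (Poly_Mapping.single (Word ls) c) = c \<odot> foldr (\<lambda>l x. g l \<otimes> x) ls \<one>"
  by (simp add: free_hom_def lin_ext_single)

lemma free_hom_mult_word: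
  "free_hom g (Poly_Mapping.single u c * y) = free_hom g (Poly_Mapping.single u c) \<otimes> free_hom g y"
proof -
  have "Poly_Mapping.keys y \<subseteq> UNIV" by simp
  then show ?thesis
  proof (induct rule: poly_mapping_span_induct)
    case (single v c')
    obtain us vs where uv: "u = Word us" "v = Word vs" by (metis free_monoid.exhaust)
    show ?case
      by (simp add: uv mult_single plus_free_monoid_def free_hom_word sm_mult_left mult_ac
          foldr_gen_mult[of "foldr (\<lambda>l x. g l \<otimes> x) vs \<one>" us])
  qed (simp_all add: free_hom_zero free_hom_add distrib_left r_distr)
qed

lemma free_hom_mult: "free_hom g (x * y) = free_hom g x \<otimes> free_hom g y"
proof -
  have "Poly_Mapping.keys x \<subseteq> UNIV" by simp
  then show ?thesis
    by (induct rule: poly_mapping_span_induct)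
      (simp_all add: free_hom_zero free_hom_add distrib_right l_distr free_hom_mult_word)
qed

lemma free_hom_gen: "free_hom g (free_gen l) = g l"
  by (simp add: free_gen_def free_hom_word g)

lemma free_hom_one: "free_hom g 1 = \<one>"
  using free_hom_word[of "[]" 1] by (simp add: zero_free_monoid_def[symmetric])

lemma free_hom_hom: "free_hom g \<in> algebra_hom free_algebra A"
proof (rule algebra_homI)
  fix c x show "free_hom g (c \<odot>\<^bsub>free_algebra\<^esub> x) = c \<odot> free_hom g x"
    by (simp add: free_algebra_def free_hom_smult)
qed (simp_all add: free_algebra_def free_hom_mult free_hom_add free_hom_one)

end

end

lemma free_alg_induct [case_names one add smult gen]:
  fixes x :: "('g, 'k::field) free_alg"
  assumes "P 1" and "\<And>x y. \<lbrakk>P x; P y\<rbrakk> \<Longrightarrow> P (x + y)"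
    and "\<And>c x. P x \<Longrightarrow> P (free_scalar c * x)" and "\<And>l x. P x \<Longrightarrow> P (free_gen l * x)"
  shows "P x"
proof -
  have word: "P (Poly_Mapping.single (Word ls) 1)" for ls
  proof (induct ls)
    case (Cons l ls)
    have "Poly_Mapping.single (Word (l # ls)) 1 = free_gen l * Poly_Mapping.single (Word ls) (1::'k)"
      by (simp add: free_gen_def mult_single plus_free_monoid_def)
    then show ?case using assms(4)[OF Cons] by simp
  qed (use assms(1) in \<open>simp add: zero_free_monoid_def[symmetric]\<close>)
  have single: "P (Poly_Mapping.single u c)" for u c
  proof -
    have "Poly_Mapping.single u c = free_scalar c * Poly_Mapping.single u 1"
      by (simp add: free_scalar_def mult_single)
    then show ?thesis using assms(3)[OF word[of "letters u"]] by simp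
  qed
  have "P 0" using single[of 0 0] by simp
  have "Poly_Mapping.keys x \<subseteq> UNIV" by simp
  then show ?thesis
    by (induct rule: poly_mapping_span_induct) (use single \<open>P 0\<close> assms(2) in auto)
qed

subsection \<open>Quotients\<close>

text \<open>All axioms are equations, so they pass to any image under a surjective map that
  respects the operations.\<close>

lemma k_algebra_image:
  fixes A :: "('k::field, 'a, 'm) module_scheme" and Q :: "('k, 'q, 'n) module_scheme"
  assumes "k_algebra A"
    and surj: "carrier Q = h ` carrier A"
    and mult: "\<And>x y. \<lbrakk>x \<in> carrier A; y \<in> carrier A\<rbrakk> \<Longrightarrow> h x \<otimes>\<^bsub>Q\<^esub> h y = h (x \<otimes>\<^bsub>A\<^esub> y)"
    and add: "\<And>x y. \<lbrakk>x \<in> carrier A; y \<in> carrier A\<rbrakk> \<Longrightarrow> h x \<oplus>\<^bsub>Q\<^esub> h y = h (x \<oplus>\<^bsub>A\<^esub> y)"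
    and one: "\<one>\<^bsub>Q\<^esub> = h \<one>\<^bsub>A\<^esub>"
    and zero: "\<zero>\<^bsub>Q\<^esub> = h \<zero>\<^bsub>A\<^esub>"
    and smult: "\<And>c x. x \<in> carrier A \<Longrightarrow> c \<odot>\<^bsub>Q\<^esub> h x = h (c \<odot>\<^bsub>A\<^esub> x)"
  shows "k_algebra Q"
proof -
  interpret A: k_algebra A by fact
  have "ring Q"
  proof (rule ringI)
    show "abelian_group Q"
    proof (rule abelian_groupI)
      fix x assume "x \<in> carrier Q"
      then obtain x' where x': "x' \<in> carrier A" "x = h x'" by (auto simp: surj)
      show "\<exists>y\<in>carrier Q. y \<oplus>\<^bsub>Q\<^esub> x = \<zero>\<^bsub>Q\<^esub>"
        by (rule bexI[of _ "h (\<ominus>\<^bsub>A\<^esub> x')"]) (use x' in \<open>auto simp: surj zero add A.l_neg\<close>)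
    qed (auto simp: surj add zero A.a_ac)
    show "Group.monoid Q"
      by (rule monoidI) (auto simp: surj mult one A.m_assoc)
  qed (auto simp: surj mult add A.l_distr A.r_distr)
  then show ?thesis
    by (rule k_algebraI)
      (auto simp: surj mult add smult A.sm_add_left A.sm_add_right)
qed

context
  fixes A :: "('k::field, 'a, 'm) module_scheme" and J :: "'a set"
  assumes alg: "k_algebra A" and ideal: "ideal J A"
begin

interpretation A: k_algebra A by (fact alg)
interpretation J: ideal J A by (fact ideal)

lemma quotient_algebra_simps:
  shows "carrier (quotient_algebra A J) = (\<lambda>x. J +>\<^bsub>A\<^esub> x) ` carrier A"
    and "\<lbrakk>x \<in> carrier A; y \<in> carrier A\<rbrakk> \<Longrightarrow>
      (J +>\<^bsub>A\<^esub> x) \<otimes>\<^bsub>quotient_algebra A J\<^esub> (J +>\<^bsub>A\<^esub> y) = J +>\<^bsub>A\<^esub> (x \<otimes>\<^bsub>A\<^esub> y)"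
    and "\<lbrakk>x \<in> carrier A; y \<in> carrier A\<rbrakk> \<Longrightarrow>
      (J +>\<^bsub>A\<^esub> x) \<oplus>\<^bsub>quotient_algebra A J\<^esub> (J +>\<^bsub>A\<^esub> y) = J +>\<^bsub>A\<^esub> (x \<oplus>\<^bsub>A\<^esub> y)"
    and "\<one>\<^bsub>quotient_algebra A J\<^esub> = J +>\<^bsub>A\<^esub> \<one>\<^bsub>A\<^esub>"
    and "\<zero>\<^bsub>quotient_algebra A J\<^esub> = J +>\<^bsub>A\<^esub> \<zero>\<^bsub>A\<^esub>"
    and "x \<in> carrier A \<Longrightarrow> c \<odot>\<^bsub>quotient_algebra A J\<^esub> (J +>\<^bsub>A\<^esub> x) = J +>\<^bsub>A\<^esub> (c \<odot>\<^bsub>A\<^esub> x)"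
proof -
  note defs = quotient_algebra_def FactRing_def ring.defs module.defs
  show "carrier (quotient_algebra A J) = (\<lambda>x. J +>\<^bsub>A\<^esub> x) ` carrier A"
    by (auto simp: defs A_RCOSETS_def RCOSETS_def a_r_coset_def)
  show "(J +>\<^bsub>A\<^esub> x) \<otimes>\<^bsub>quotient_algebra A J\<^esub> (J +>\<^bsub>A\<^esub> y) = J +>\<^bsub>A\<^esub> (x \<otimes>\<^bsub>A\<^esub> y)"
    if "x \<in> carrier A" "y \<in> carrier A"
    using that by (simp add: defs J.rcoset_mult_add)
  show "(J +>\<^bsub>A\<^esub> x) \<oplus>\<^bsub>quotient_algebra A J\<^esub> (J +>\<^bsub>A\<^esub> y) = J +>\<^bsub>A\<^esub> (x \<oplus>\<^bsub>A\<^esub> y)"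
    if "x \<in> carrier A" "y \<in> carrier A"
    using that by (simp add: defs J.a_rcos_sum)
  show "\<one>\<^bsub>quotient_algebra A J\<^esub> = J +>\<^bsub>A\<^esub> \<one>\<^bsub>A\<^esub>" by (simp add: defs)
  show "\<zero>\<^bsub>quotient_algebra A J\<^esub> = J +>\<^bsub>A\<^esub> \<zero>\<^bsub>A\<^esub>"
    using A.a_rcos_zero[OF ideal, of "\<zero>\<^bsub>A\<^esub>"] by (simp add: defs)
  show "c \<odot>\<^bsub>quotient_algebra A J\<^esub> (J +>\<^bsub>A\<^esub> x) = J +>\<^bsub>A\<^esub> (c \<odot>\<^bsub>A\<^esub> x)" if x: "x \<in> carrier A"
  proof -
    have "J +>\<^bsub>A\<^esub> (c \<odot>\<^bsub>A\<^esub> y) = J +>\<^bsub>A\<^esub> (c \<odot>\<^bsub>A\<^esub> x)" if y: "y \<in> J +>\<^bsub>A\<^esub> x" for y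
    proof -
      obtain j where j: "j \<in> J" "y = j \<oplus>\<^bsub>A\<^esub> x" using y by (auto simp: a_r_coset_def')
      have jc: "j \<in> carrier A" using j J.Icarr by simp
      have "(c \<odot>\<^bsub>A\<^esub> \<one>\<^bsub>A\<^esub>) \<otimes>\<^bsub>A\<^esub> j \<in> J" using j(1) by (intro J.I_l_closed) auto
      then have "c \<odot>\<^bsub>A\<^esub> j \<in> J" using jc by simp
      then have "c \<odot>\<^bsub>A\<^esub> y \<in> J +>\<^bsub>A\<^esub> (c \<odot>\<^bsub>A\<^esub> x)"
        using j jc x by (auto simp: a_r_coset_def' A.sm_add_right)
      then show ?thesis
        using x by (intro J.a_repr_independence'[symmetric]) auto
    qed
    moreover have "x \<in> J +>\<^bsub>A\<^esub> x" using x J.a_rcos_self by simp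
    ultimately have "(\<Union>y\<in>J +>\<^bsub>A\<^esub> x. J +>\<^bsub>A\<^esub> (c \<odot>\<^bsub>A\<^esub> y)) = J +>\<^bsub>A\<^esub> (c \<odot>\<^bsub>A\<^esub> x)"
      by blast
    then show ?thesis by (simp only: defs module.simps)
  qed
qed

lemma k_algebra_quotient: "k_algebra (quotient_algebra A J)"
  by (rule k_algebra_image[OF alg, where h = "\<lambda>x. J +>\<^bsub>A\<^esub> x"]) (simp_all add: quotient_algebra_simps)

lemma quotient_algebra_hom: "(\<lambda>x. J +>\<^bsub>A\<^esub> x) \<in> algebra_hom A (quotient_algebra A J)"
  by (rule algebra_homI) (simp_all add: quotient_algebra_simps)

lemma coset_eq_iff:
  assumes "x \<in> carrier A" "y \<in> carrier A"
  shows "J +>\<^bsub>A\<^esub> x = J +>\<^bsub>A\<^esub> y \<longleftrightarrow> x \<ominus>\<^bsub>A\<^esub> y \<in> J"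
  using assms A.quotient_eq_iff_same_a_r_cos[OF ideal] by blast

end

section \<open>Tensor products\<close>

lemma Pi_Un: "f \<in> S \<union> S' \<rightarrow> T \<longleftrightarrow> f \<in> S \<rightarrow> T \<and> f \<in> S' \<rightarrow> T"
  by auto

lemma lookup_scale [simp]:
  "Poly_Mapping.lookup (Poly_Mapping.map ((*) c) p) u = c * (Poly_Mapping.lookup p u :: 'k::field)"
  by (simp add: Poly_Mapping.map.rep_eq when_def)

lemma scale_single [simp]:
  "Poly_Mapping.map ((*) c) (Poly_Mapping.single u d) = Poly_Mapping.single u (c * d :: 'k::field)"
  by (rule poly_mapping_eqI) (simp add: lookup_single when_def)

lemma scale_add:
  "Poly_Mapping.map ((*) c) (p + q) =
    Poly_Mapping.map ((*) c) p + Poly_Mapping.map ((*) c) (q :: 'x \<Rightarrow>\<^sub>0 'k::field)"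
  by (rule poly_mapping_eqI) (simp add: lookup_add algebra_simps)

lemma scale_zero [simp]: "Poly_Mapping.map ((*) c) (0 :: 'x \<Rightarrow>\<^sub>0 'k::field) = 0"
  by (rule poly_mapping_eqI) simp

lemma keys_scale: "Poly_Mapping.keys (Poly_Mapping.map ((*) c) (p :: 'x \<Rightarrow>\<^sub>0 'k::field)) \<subseteq> Poly_Mapping.keys p"
  by (auto simp: in_keys_iff)

definition bilinear_form ::
  "('k::field, 'a, 'm) module_scheme \<Rightarrow> ('k, 'b, 'n) module_scheme \<Rightarrow> ('k, 'c, 'l) module_scheme
    \<Rightarrow> ('a \<times> 'b \<Rightarrow> 'c) \<Rightarrow> bool" where
  "bilinear_form A B C b \<longleftrightarrow>
     (\<forall>x\<in>carrier A. \<forall>y\<in>carrier B. b (x, y) \<in> carrier C) \<and>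
     (\<forall>x\<in>carrier A. \<forall>x'\<in>carrier A. \<forall>y\<in>carrier B. b (x \<oplus>\<^bsub>A\<^esub> x', y) = b (x, y) \<oplus>\<^bsub>C\<^esub> b (x', y)) \<and>
     (\<forall>x\<in>carrier A. \<forall>y\<in>carrier B. \<forall>y'\<in>carrier B. b (x, y \<oplus>\<^bsub>B\<^esub> y') = b (x, y) \<oplus>\<^bsub>C\<^esub> b (x, y')) \<and>
     (\<forall>c. \<forall>x\<in>carrier A. \<forall>y\<in>carrier B. b (c \<odot>\<^bsub>A\<^esub> x, y) = c \<odot>\<^bsub>C\<^esub> b (x, y)) \<and>
     (\<forall>c. \<forall>x\<in>carrier A. \<forall>y\<in>carrier B. b (x, c \<odot>\<^bsub>B\<^esub> y) = c \<odot>\<^bsub>C\<^esub> b (x, y))"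

lemma bilinear_formD:
  assumes "bilinear_form A B C b"
  shows "\<lbrakk>x \<in> carrier A; y \<in> carrier B\<rbrakk> \<Longrightarrow> b (x, y) \<in> carrier C"
    and "\<lbrakk>x \<in> carrier A; x' \<in> carrier A; y \<in> carrier B\<rbrakk> \<Longrightarrow> b (x \<oplus>\<^bsub>A\<^esub> x', y) = b (x, y) \<oplus>\<^bsub>C\<^esub> b (x', y)"
    and "\<lbrakk>x \<in> carrier A; y \<in> carrier B; y' \<in> carrier B\<rbrakk> \<Longrightarrow> b (x, y \<oplus>\<^bsub>B\<^esub> y') = b (x, y) \<oplus>\<^bsub>C\<^esub> b (x, y')"
    and "\<lbrakk>x \<in> carrier A; y \<in> carrier B\<rbrakk> \<Longrightarrow> b (c \<odot>\<^bsub>A\<^esub> x, y) = c \<odot>\<^bsub>C\<^esub> b (x, y)"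
    and "\<lbrakk>x \<in> carrier A; y \<in> carrier B\<rbrakk> \<Longrightarrow> b (x, c \<odot>\<^bsub>B\<^esub> y) = c \<odot>\<^bsub>C\<^esub> b (x, y)"
  using assms unfolding bilinear_form_def by blast+

definition tensor_lift ::
  "('k::field, 'c, 'l) module_scheme \<Rightarrow> ('a \<times> 'b \<Rightarrow> 'c) \<Rightarrow> ('a \<times> 'b \<Rightarrow>\<^sub>0 'k) set \<Rightarrow> 'c" where
  "tensor_lift C b P = lin_ext C b (SOME p. p \<in> P)"

locale two_algebras = A: k_algebra A + B: k_algebra B
  for A :: "('k::field, 'a, 'm) module_scheme" and B :: "('k, 'b, 'n) module_scheme"
begin

abbreviation "PA \<equiv> pair_algebra A B"
abbreviation "TA \<equiv> tensor_algebra A B"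
abbreviation "pmul \<equiv> monoid.mult PA"

lemma pmul_superset:
  assumes "finite S" "Poly_Mapping.keys p \<subseteq> S" "finite S'" "Poly_Mapping.keys q \<subseteq> S'"
  shows "pmul p q = (\<Sum>u\<in>S. \<Sum>v\<in>S'.
        Poly_Mapping.single (fst u \<otimes>\<^bsub>A\<^esub> fst v, snd u \<otimes>\<^bsub>B\<^esub> snd v)
          (Poly_Mapping.lookup p u * Poly_Mapping.lookup q v))"
proof -
  have "pmul p q = (\<Sum>u\<in>Poly_Mapping.keys p. \<Sum>v\<in>S'.
        Poly_Mapping.single (fst u \<otimes>\<^bsub>A\<^esub> fst v, snd u \<otimes>\<^bsub>B\<^esub> snd v)
          (Poly_Mapping.lookup p u * Poly_Mapping.lookup q v))"
    unfolding pair_algebra_def monoid.simps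
    by (intro sum.cong refl sum.mono_neutral_left) (use assms in \<open>auto simp: in_keys_iff\<close>)
  also have "\<dots> = (\<Sum>u\<in>S. \<Sum>v\<in>S'.
        Poly_Mapping.single (fst u \<otimes>\<^bsub>A\<^esub> fst v, snd u \<otimes>\<^bsub>B\<^esub> snd v)
          (Poly_Mapping.lookup p u * Poly_Mapping.lookup q v))"
    by (rule sum.mono_neutral_left) (use assms in \<open>auto simp: in_keys_iff\<close>)
  finally show ?thesis .
qed

lemma pmul_add_left: "pmul (p + p') q = pmul p q + pmul p' q"
proof -
  let ?S = "Poly_Mapping.keys p \<union> Poly_Mapping.keys p'" and ?S' = "Poly_Mapping.keys q"
  show ?thesis
    using keys_add[of p p']
    by (simp add: pmul_superset[of ?S _ ?S'] lookup_add distrib_right single_add sum.distrib)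
qed

lemma pmul_add_right: "pmul p (q + q') = pmul p q + pmul p q'"
proof -
  let ?S = "Poly_Mapping.keys p" and ?S' = "Poly_Mapping.keys q \<union> Poly_Mapping.keys q'"
  show ?thesis
    using keys_add[of q q']
    by (simp add: pmul_superset[of ?S _ ?S'] lookup_add distrib_left single_add sum.distrib)
qed

lemma pmul_single: "pmul (Poly_Mapping.single u c) (Poly_Mapping.single v d) =
    Poly_Mapping.single (fst u \<otimes>\<^bsub>A\<^esub> fst v, snd u \<otimes>\<^bsub>B\<^esub> snd v) (c * d)"
  by (simp add: pmul_superset[of "{u}" _ "{v}"])

lemma pmul_zero: "pmul 0 q = 0" "pmul p 0 = 0"
  by (simp_all add: pair_algebra_def)

lemma pair_simps:
  "carrier PA = {p. Poly_Mapping.keys p \<subseteq> carrier A \<times> carrier B}" "add PA = (+)" "ring.zero PA = 0"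
  "one PA = Poly_Mapping.single (\<one>\<^bsub>A\<^esub>, \<one>\<^bsub>B\<^esub>) 1" "module.smult PA = (\<lambda>c p. Poly_Mapping.map ((*) c) p)"
  by (simp_all add: pair_algebra_def)

lemma pair_induct [consumes 1, case_names zero single add]:
  assumes "p \<in> carrier PA" and "P 0"
    and "\<And>x y c. \<lbrakk>x \<in> carrier A; y \<in> carrier B\<rbrakk> \<Longrightarrow> P (Poly_Mapping.single (x, y) c)"
    and "\<And>p q. \<lbrakk>p \<in> carrier PA; q \<in> carrier PA; P p; P q\<rbrakk> \<Longrightarrow> P (p + q)"
  shows "P p"
  using assms(1) unfolding pair_simps mem_Collect_eq
  by (induct rule: poly_mapping_span_induct) (use assms(2-4) in \<open>auto simp: pair_simps\<close>)

lemma add_in_pair: "\<lbrakk>p \<in> carrier PA; q \<in> carrier PA\<rbrakk> \<Longrightarrow> p + q \<in> carrier PA"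
  using keys_add[of p q] by (auto simp: pair_simps)

lemma single_in_pair: "\<lbrakk>x \<in> carrier A; y \<in> carrier B\<rbrakk> \<Longrightarrow> Poly_Mapping.single (x, y) c \<in> carrier PA"
  by (auto simp: pair_simps split: if_splits)

lemma pmul_closed: "\<lbrakk>p \<in> carrier PA; q \<in> carrier PA\<rbrakk> \<Longrightarrow> pmul p q \<in> carrier PA"
proof (induct p rule: pair_induct)
  case (single x y c)
  from single(3) show ?case
    by (induct q rule: pair_induct)
      (simp_all add: single pmul_zero pmul_single single_in_pair pmul_add_right add_in_pair,
        simp add: pair_simps)
qed (simp_all add: pmul_zero pmul_add_left add_in_pair, simp add: pair_simps)

lemma pmul_assoc:
  assumes "p \<in> carrier PA" "q \<in> carrier PA" "w \<in> carrier PA"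
  shows "pmul (pmul p q) w = pmul p (pmul q w)"
  using assms(1)
proof (induct p rule: pair_induct)
  case (single x y c)
  note s1 = single
  from assms(2) show ?case
  proof (induct q rule: pair_induct)
    case (single x' y' c')
    from assms(3) show ?case
      by (induct w rule: pair_induct)
        (use s1 single in \<open>simp_all add: pmul_zero pmul_single pmul_add_right A.m_assoc B.m_assoc mult.assoc\<close>)
  qed (simp_all add: pmul_zero pmul_add_left pmul_add_right)
qed (simp_all add: pmul_zero pmul_add_left)

lemma pmul_scale_left: "p \<in> carrier PA \<Longrightarrow> q \<in> carrier PA \<Longrightarrow>
  pmul (Poly_Mapping.map ((*) c) p) q = Poly_Mapping.map ((*) c) (pmul p q)"
proof (induct p rule: pair_induct)
  case (single x y d)
  from single(3) show ?case
    by (induct q rule: pair_induct) (simp_all add: pmul_zero pmul_single pmul_add_right scale_add mult.assoc)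
qed (simp_all add: pmul_zero pmul_add_left scale_add)

lemma pmul_scale_right: "p \<in> carrier PA \<Longrightarrow> q \<in> carrier PA \<Longrightarrow>
  pmul p (Poly_Mapping.map ((*) c) q) = Poly_Mapping.map ((*) c) (pmul p q)"
proof (induct p rule: pair_induct)
  case (single x y d)
  from single(3) show ?case
    by (induct q rule: pair_induct) (simp_all add: pmul_zero pmul_single pmul_add_right scale_add mult.left_commute)
qed (simp_all add: pmul_zero pmul_add_left scale_add)

lemma pmul_one: assumes "p \<in> carrier PA"
  shows "pmul (one PA) p = p" "pmul p (one PA) = p"
  using assms unfolding pair_simps(4)
  by (induct p rule: pair_induct) (simp_all add: pmul_zero pmul_single pmul_add_right pmul_add_left)

lemma k_algebra_pair: "k_algebra PA"
proof (rule k_algebraI)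
  show "ring PA"
  proof (rule ringI)
    show "abelian_group PA"
    proof (rule abelian_groupI)
      fix x assume "x \<in> carrier PA"
      then have "- x \<in> carrier PA" by (simp add: pair_simps)
      then show "\<exists>y\<in>carrier PA. y \<oplus>\<^bsub>PA\<^esub> x = \<zero>\<^bsub>PA\<^esub>"
        by (rule bexI[rotated]) (simp add: pair_simps)
    qed (use add_in_pair in \<open>simp_all add: pair_simps add_ac\<close>)
    show "Group.monoid PA"
    proof (rule monoidI)
      show "one PA \<in> carrier PA" unfolding pair_simps(4) by (rule single_in_pair) simp_all
    qed (rule pmul_closed pmul_assoc pmul_one; assumption)+
  qed (simp_all add: pair_simps(2) pmul_add_left pmul_add_right)
  fix c c' and x y
  assume x: "x \<in> carrier PA"
  show "c \<odot>\<^bsub>PA\<^esub> x \<in> carrier PA"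
    using x keys_scale[of c x] by (auto simp: pair_simps)
  show "(c + c') \<odot>\<^bsub>PA\<^esub> x = c \<odot>\<^bsub>PA\<^esub> x \<oplus>\<^bsub>PA\<^esub> c' \<odot>\<^bsub>PA\<^esub> x"
    and "(c * c') \<odot>\<^bsub>PA\<^esub> x = c \<odot>\<^bsub>PA\<^esub> (c' \<odot>\<^bsub>PA\<^esub> x)" and "1 \<odot>\<^bsub>PA\<^esub> x = x"
    by (rule poly_mapping_eqI; simp add: pair_simps lookup_add algebra_simps)+
  assume y: "y \<in> carrier PA"
  show "c \<odot>\<^bsub>PA\<^esub> (x \<oplus>\<^bsub>PA\<^esub> y) = c \<odot>\<^bsub>PA\<^esub> x \<oplus>\<^bsub>PA\<^esub> c \<odot>\<^bsub>PA\<^esub> y"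
    by (simp add: pair_simps scale_add)
  show "(c \<odot>\<^bsub>PA\<^esub> x) \<otimes>\<^bsub>PA\<^esub> y = c \<odot>\<^bsub>PA\<^esub> (x \<otimes>\<^bsub>PA\<^esub> y)"
    and "x \<otimes>\<^bsub>PA\<^esub> (c \<odot>\<^bsub>PA\<^esub> y) = c \<odot>\<^bsub>PA\<^esub> (x \<otimes>\<^bsub>PA\<^esub> y)"
    using pmul_scale_left[OF x y] pmul_scale_right[OF x y] by (simp_all add: pair_simps(5))
qed

sublocale PA: k_algebra "pair_algebra A B" by (rule k_algebra_pair)

lemma PA_minus: "\<lbrakk>p \<in> carrier PA; q \<in> carrier PA\<rbrakk> \<Longrightarrow> p \<ominus>\<^bsub>PA\<^esub> q = p - q"
  by (simp add: PA.minus_eq_sm) (rule poly_mapping_eqI, simp add: pair_simps lookup_add lookup_minus)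

lemma relations_in_pair: "bilinearity_relations A B \<subseteq> carrier PA"
proof
  fix p assume "p \<in> bilinearity_relations A B"
  then show "p \<in> carrier PA"
    by cases (auto simp: single_in_pair A.sm_closed B.sm_closed simp flip: PA_minus
        intro!: PA.minus_closed)
qed

lemma tensor_ideal_ideal: "ideal (tensor_ideal A B) PA"
  unfolding tensor_ideal_def by (rule PA.genideal_ideal[OF relations_in_pair])

lemma k_algebra_tensor: "k_algebra TA"
  unfolding tensor_algebra_def by (rule k_algebra_quotient[OF k_algebra_pair tensor_ideal_ideal])

sublocale TA: k_algebra "tensor_algebra A B" by (rule k_algebra_tensor)

abbreviation "pt \<equiv> pure_tensor A B"

lemmas tensor_simps = quotient_algebra_simps[OF k_algebra_pair tensor_ideal_ideal, folded tensor_algebra_def]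

lemma pt_closed [simp]: "\<lbrakk>x \<in> carrier A; y \<in> carrier B\<rbrakk> \<Longrightarrow> pt x y \<in> carrier TA"
  unfolding tensor_simps pure_tensor_def using single_in_pair by auto

lemma pt_mult [simp]:
  "\<lbrakk>x \<in> carrier A; y \<in> carrier B; x' \<in> carrier A; y' \<in> carrier B\<rbrakk> \<Longrightarrow>
    pt x y \<otimes>\<^bsub>TA\<^esub> pt x' y' = pt (x \<otimes>\<^bsub>A\<^esub> x') (y \<otimes>\<^bsub>B\<^esub> y')"
  by (simp add: pure_tensor_def tensor_simps single_in_pair pmul_single)

lemma pt_one: "\<one>\<^bsub>TA\<^esub> = pt \<one>\<^bsub>A\<^esub> \<one>\<^bsub>B\<^esub>"
  by (simp add: pure_tensor_def tensor_simps pair_simps)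

lemma coset_relation:
  assumes "p - q \<in> bilinearity_relations A B" "p \<in> carrier PA" "q \<in> carrier PA"
  shows "tensor_ideal A B +>\<^bsub>PA\<^esub> p = tensor_ideal A B +>\<^bsub>PA\<^esub> q"
proof -
  have "p \<ominus>\<^bsub>PA\<^esub> q \<in> tensor_ideal A B"
    using assms PA.genideal_self[OF relations_in_pair] by (auto simp: PA_minus tensor_ideal_def)
  then show ?thesis
    using coset_eq_iff[OF k_algebra_pair tensor_ideal_ideal assms(2,3)] by blast
qed

lemma pt_add_left: "\<lbrakk>x \<in> carrier A; x' \<in> carrier A; y \<in> carrier B\<rbrakk> \<Longrightarrow>
    pt (x \<oplus>\<^bsub>A\<^esub> x') y = pt x y \<oplus>\<^bsub>TA\<^esub> pt x' y"
  using bilinearity_relations.add_left[of x A x' y B]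
  by (simp add: pure_tensor_def tensor_simps single_in_pair)
    (rule coset_relation, simp_all add: pair_simps(2) single_in_pair add_in_pair diff_diff_eq)

lemma pt_add_right: "\<lbrakk>x \<in> carrier A; y \<in> carrier B; y' \<in> carrier B\<rbrakk> \<Longrightarrow>
    pt x (y \<oplus>\<^bsub>B\<^esub> y') = pt x y \<oplus>\<^bsub>TA\<^esub> pt x y'"
  using bilinearity_relations.add_right[of x A y B y']
  by (simp add: pure_tensor_def tensor_simps single_in_pair)
    (rule coset_relation, simp_all add: pair_simps(2) single_in_pair add_in_pair diff_diff_eq)

lemma pt_smult_left [simp]: "\<lbrakk>x \<in> carrier A; y \<in> carrier B\<rbrakk> \<Longrightarrow>
    pt (c \<odot>\<^bsub>A\<^esub> x) y = c \<odot>\<^bsub>TA\<^esub> pt x y"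
  using bilinearity_relations.smult_left[of x A y B c]
  by (simp add: pure_tensor_def tensor_simps single_in_pair)
    (rule coset_relation, simp_all add: pair_simps(5) single_in_pair)

lemma pt_smult_right [simp]: "\<lbrakk>x \<in> carrier A; y \<in> carrier B\<rbrakk> \<Longrightarrow>
    pt x (c \<odot>\<^bsub>B\<^esub> y) = c \<odot>\<^bsub>TA\<^esub> pt x y"
  using bilinearity_relations.smult_right[of x A y B c]
  by (simp add: pure_tensor_def tensor_simps single_in_pair)
    (rule coset_relation, simp_all add: pair_simps(5) single_in_pair)

lemma pt_zero [simp]: "y \<in> carrier B \<Longrightarrow> pt \<zero>\<^bsub>A\<^esub> y = \<zero>\<^bsub>TA\<^esub>"
  "x \<in> carrier A \<Longrightarrow> pt x \<zero>\<^bsub>B\<^esub> = \<zero>\<^bsub>TA\<^esub>"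
  using pt_smult_left[of "\<zero>\<^bsub>A\<^esub>" y 0] pt_smult_right[of x "\<zero>\<^bsub>B\<^esub>" 0] by auto

lemma tensor_induct [consumes 1, case_names pure add]:
  assumes "t \<in> carrier TA"
    and pure: "\<And>x y. \<lbrakk>x \<in> carrier A; y \<in> carrier B\<rbrakk> \<Longrightarrow> P (pt x y)"
    and add: "\<And>t t'. \<lbrakk>t \<in> carrier TA; t' \<in> carrier TA; P t; P t'\<rbrakk> \<Longrightarrow> P (t \<oplus>\<^bsub>TA\<^esub> t')"
  shows "P t"
proof -
  let ?h = "\<lambda>p. tensor_ideal A B +>\<^bsub>PA\<^esub> p"
  obtain p where p: "p \<in> carrier PA" "t = ?h p"
    using assms(1) by (auto simp: tensor_simps)
  have "?h p \<in> carrier TA \<and> P (?h p)"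
    using p(1)
  proof (induct p rule: pair_induct)
    case zero
    have "?h 0 = \<zero>\<^bsub>TA\<^esub>" by (simp add: tensor_simps pair_simps)
    then show ?case using pure[of "\<zero>\<^bsub>A\<^esub>" "\<zero>\<^bsub>B\<^esub>"] by simp
  next
    case (single x y c)
    have "Poly_Mapping.single (x, y) c = c \<odot>\<^bsub>PA\<^esub> Poly_Mapping.single (x, y) 1"
      by (simp add: pair_simps)
    then have "?h (Poly_Mapping.single (x, y) c) = c \<odot>\<^bsub>TA\<^esub> pt x y"
      by (simp add: pure_tensor_def tensor_simps single single_in_pair)
    also have "\<dots> = pt (c \<odot>\<^bsub>A\<^esub> x) y" using single by simp
    finally show ?case using single pure[of "c \<odot>\<^bsub>A\<^esub> x" y] by simp
  next
    case (add p q)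
    then have "?h (p + q) = ?h p \<oplus>\<^bsub>TA\<^esub> ?h q"
      by (simp add: tensor_simps pair_simps(2))
    then show ?case using add assms(3)[of "?h p" "?h q"] by simp
  qed
  then show ?thesis using p by simp
qed

context
  fixes C :: "('k, 'c, 'l) module_scheme"
  assumes C: "k_algebra C"
begin

interpretation C: k_algebra C by (fact C)

lemma lin_ext_pair_closed: "\<lbrakk>bilinear_form A B C b; p \<in> carrier PA\<rbrakk> \<Longrightarrow> b \<in> Poly_Mapping.keys p \<rightarrow> carrier C"
  using bilinear_formD(1)[of A B C b] by (auto simp: pair_simps)

lemma lin_ext_pmul_left:
  assumes b: "bilinear_form A B C b" and x: "x \<in> carrier A" "y \<in> carrier B" and p: "p \<in> carrier PA"
  shows "bilinear_form A B C (\<lambda>v. c \<odot>\<^bsub>C\<^esub> b (x \<otimes>\<^bsub>A\<^esub> fst v, y \<otimes>\<^bsub>B\<^esub> snd v))"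
    and "lin_ext C b (pmul (Poly_Mapping.single (x, y) c) p) = lin_ext C (\<lambda>v. c \<odot>\<^bsub>C\<^esub> b (x \<otimes>\<^bsub>A\<^esub> fst v, y \<otimes>\<^bsub>B\<^esub> snd v)) p"
proof -
  let ?b = "(\<lambda>v. c \<odot>\<^bsub>C\<^esub> b (x \<otimes>\<^bsub>A\<^esub> fst v, y \<otimes>\<^bsub>B\<^esub> snd v))"
  show b': "bilinear_form A B C ?b"
    unfolding bilinear_form_def
    by (simp add: bilinear_formD[OF b] x A.r_distr B.r_distr C.sm_add_right mult.commute)
  show "lin_ext C b (pmul (Poly_Mapping.single (x, y) c) p) = lin_ext C ?b p"
    using p
  proof (induct p rule: pair_induct)
    case (single x' y' d)
    then show ?case
      by (simp add: pmul_single C.lin_ext_single bilinear_formD[OF b] x mult.commute)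
  next
    case (add p q)
    have "pmul (Poly_Mapping.single (x, y) c) p \<in> carrier PA" "pmul (Poly_Mapping.single (x, y) c) q \<in> carrier PA"
      using add x by (auto intro: pmul_closed single_in_pair)
    then show ?case
      unfolding pmul_add_right
      by (subst (1 2) C.lin_ext_add) (use add lin_ext_pair_closed[OF b] lin_ext_pair_closed[OF b'] in \<open>auto simp: Pi_Un\<close>)
  qed (simp add: pmul_zero C.lin_ext_zero)
qed

lemma lin_ext_pmul_right:
  assumes b: "bilinear_form A B C b" and x: "x \<in> carrier A" "y \<in> carrier B" and p: "p \<in> carrier PA"
  shows "bilinear_form A B C (\<lambda>v. c \<odot>\<^bsub>C\<^esub> b (fst v \<otimes>\<^bsub>A\<^esub> x, snd v \<otimes>\<^bsub>B\<^esub> y))"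
    and "lin_ext C b (pmul p (Poly_Mapping.single (x, y) c)) = lin_ext C (\<lambda>v. c \<odot>\<^bsub>C\<^esub> b (fst v \<otimes>\<^bsub>A\<^esub> x, snd v \<otimes>\<^bsub>B\<^esub> y)) p"
proof -
  let ?b = "(\<lambda>v. c \<odot>\<^bsub>C\<^esub> b (fst v \<otimes>\<^bsub>A\<^esub> x, snd v \<otimes>\<^bsub>B\<^esub> y))"
  show b': "bilinear_form A B C ?b"
    unfolding bilinear_form_def
    by (simp add: bilinear_formD[OF b] x A.l_distr B.l_distr C.sm_add_right mult.commute)
  show "lin_ext C b (pmul p (Poly_Mapping.single (x, y) c)) = lin_ext C ?b p"
    using p
  proof (induct p rule: pair_induct)
    case (single x' y' d)
    then show ?case
      by (simp add: pmul_single C.lin_ext_single bilinear_formD[OF b] x)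
  next
    case (add p q)
    have "pmul p (Poly_Mapping.single (x, y) c) \<in> carrier PA" "pmul q (Poly_Mapping.single (x, y) c) \<in> carrier PA"
      using add x by (auto intro: pmul_closed single_in_pair)
    then show ?case
      unfolding pmul_add_left
      by (subst (1 2) C.lin_ext_add) (use add lin_ext_pair_closed[OF b] lin_ext_pair_closed[OF b'] in \<open>auto simp: Pi_Un\<close>)
  qed (simp add: pmul_zero C.lin_ext_zero)
qed

text \<open>The tensor ideal lies in the common kernel of all bilinear maps into \<open>C\<close>: this kernel is an
  ideal, because composing a bilinear map with a multiplication of the arguments gives a bilinear
  map again.\<close>

lemma lin_ext_tensor_ideal:
  assumes b: "bilinear_form A B C b" and p: "p \<in> tensor_ideal A B"
  shows "lin_ext C b p = \<zero>\<^bsub>C\<^esub>"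
proof -
  define Z where "Z = {p \<in> carrier PA. \<forall>b. bilinear_form A B C b \<longrightarrow> lin_ext C b p = \<zero>\<^bsub>C\<^esub>}"
  have Zadd: "p + q \<in> Z" if "p \<in> Z" "q \<in> Z" for p q
    using that lin_ext_pair_closed by (auto simp: Z_def add_in_pair C.lin_ext_add Pi_Un)
  have Z0: "0 \<in> Z" by (simp add: Z_def C.lin_ext_zero pair_simps)
  have "ideal Z PA"
  proof (rule idealI[OF PA.ring_axioms])
    show "subgroup Z (add_monoid PA)"
    proof (rule PA.add.subgroupI)
      show "Z \<subseteq> carrier PA" by (auto simp: Z_def)
      show "Z \<noteq> {}" using Z0 by auto
      show "a \<oplus>\<^bsub>PA\<^esub> b \<in> Z" if "a \<in> Z" "b \<in> Z" for a b
        using Zadd[OF that] by (simp add: pair_simps)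
      show "\<ominus>\<^bsub>PA\<^esub> a \<in> Z" if "a \<in> Z" for a
      proof -
        have "\<ominus>\<^bsub>PA\<^esub> a \<in> carrier PA" "a \<in> carrier PA" using that by (auto simp: Z_def)
        moreover have "\<ominus>\<^bsub>PA\<^esub> a = Poly_Mapping.map ((*) (- 1)) a"
          using that by (subst PA.neg_eq_sm) (auto simp: Z_def pair_simps)
        ultimately show ?thesis
          using that lin_ext_pair_closed by (auto simp: Z_def C.lin_ext_smult)
      qed
    qed
  next
    fix a q assume a: "a \<in> Z" and q: "q \<in> carrier PA"
    have ac: "a \<in> carrier PA" using a by (simp add: Z_def)
    show "q \<otimes>\<^bsub>PA\<^esub> a \<in> Z"
      using q
    proof (induct q rule: pair_induct)
      case (single x y c)
      then show ?case
        using a lin_ext_pmul_left[OF _ single ac, of _ c]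
        by (auto simp: Z_def pmul_closed single_in_pair)
    qed (simp_all add: pmul_zero pmul_add_left Z0 Zadd)
    show "a \<otimes>\<^bsub>PA\<^esub> q \<in> Z"
      using q
    proof (induct q rule: pair_induct)
      case (single x y c)
      then show ?case
        using a lin_ext_pmul_right[OF _ single ac, of _ c]
        by (auto simp: Z_def pmul_closed single_in_pair)
    qed (simp_all add: pmul_zero pmul_add_right Z0 Zadd)
  qed
  moreover have "bilinearity_relations A B \<subseteq> Z"
  proof
    fix p assume rel: "p \<in> bilinearity_relations A B"
    have "lin_ext C b p = \<zero>\<^bsub>C\<^esub>" if b: "bilinear_form A B C b" for b
    proof -
      have L: "lin_ext C b (p - q) = lin_ext C b p \<ominus>\<^bsub>C\<^esub> lin_ext C b q" if "p \<in> carrier PA" "q \<in> carrier PA" for p q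
        by (rule C.lin_ext_minus) (use that lin_ext_pair_closed[OF b] in \<open>auto simp: Pi_Un\<close>)
      have M: "p - q \<in> carrier PA" if "p \<in> carrier PA" "q \<in> carrier PA" for p q
        using that PA.minus_closed[OF that] by (simp add: PA_minus)
      note bD = bilinear_formD[OF b]
      from rel show ?thesis
      proof cases
        case (add_left x x' y)
        then show ?thesis
          by (simp add: L M single_in_pair C.lin_ext_single bD C.minus_eq C.a_assoc C.r_neg C.minus_add C.a_ac C.r_neg1)
      next
        case (add_right x y y')
        then show ?thesis
          by (simp add: L M single_in_pair C.lin_ext_single bD C.minus_eq C.a_assoc C.r_neg C.minus_add C.a_ac C.r_neg1)
      qed (simp_all add: L single_in_pair C.lin_ext_single bD C.minus_eq C.r_neg)
    qed
    then show "p \<in> Z" using rel relations_in_pair by (auto simp: Z_def)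
  qed
  ultimately have "tensor_ideal A B \<subseteq> Z"
    unfolding tensor_ideal_def by (rule PA.genideal_minimal)
  then show ?thesis using p b by (auto simp: Z_def)
qed

lemma tensor_lift_rep:
  assumes b: "bilinear_form A B C b" and t: "t \<in> carrier TA" and p: "p \<in> t"
  shows "p \<in> carrier PA" and "t = tensor_ideal A B +>\<^bsub>PA\<^esub> p" and "tensor_lift C b t = lin_ext C b p"
proof -
  interpret J: ideal "tensor_ideal A B" PA by (rule tensor_ideal_ideal)
  have rep: "q \<in> carrier PA \<and> t = tensor_ideal A B +>\<^bsub>PA\<^esub> q" if q: "q \<in> t" for q
  proof -
    obtain p' where p': "p' \<in> carrier PA" "t = tensor_ideal A B +>\<^bsub>PA\<^esub> p'"
      using t by (auto simp: tensor_simps)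
    have "q \<in> carrier PA" using q p' PA.a_r_coset_subset_G[OF J.a_subset p'(1)] by auto
    moreover have "t = tensor_ideal A B +>\<^bsub>PA\<^esub> q"
      using J.a_repr_independence'[of q p'] q p' by auto
    ultimately show ?thesis by simp
  qed
  then show pc: "p \<in> carrier PA" and te: "t = tensor_ideal A B +>\<^bsub>PA\<^esub> p" using p by auto
  define q where "q = (SOME q. q \<in> t)"
  have "q \<in> t" unfolding q_def using p by (rule someI)
  from rep[OF this] have q: "q \<in> carrier PA" "t = tensor_ideal A B +>\<^bsub>PA\<^esub> q" by auto
  then have "q - p \<in> tensor_ideal A B"
    using coset_eq_iff[OF k_algebra_pair tensor_ideal_ideal q(1) pc] te PA_minus[OF q(1) pc] by simp
  then have "lin_ext C b (q - p) = \<zero>\<^bsub>C\<^esub>" by (rule lin_ext_tensor_ideal[OF b])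
  moreover have "lin_ext C b (q - p) = lin_ext C b q \<ominus>\<^bsub>C\<^esub> lin_ext C b p"
    by (rule C.lin_ext_minus) (use q pc lin_ext_pair_closed[OF b] in \<open>auto simp: Pi_Un\<close>)
  ultimately have "lin_ext C b q = lin_ext C b p"
    using q pc lin_ext_pair_closed[OF b] by (simp add: C.lin_ext_closed)
  then show "tensor_lift C b t = lin_ext C b p" by (simp add: tensor_lift_def q_def)
qed

lemma tensor_lift_coset:
  assumes b: "bilinear_form A B C b" and p: "p \<in> carrier PA"
  shows "tensor_lift C b (tensor_ideal A B +>\<^bsub>PA\<^esub> p) = lin_ext C b p"
proof -
  interpret J: ideal "tensor_ideal A B" PA by (rule tensor_ideal_ideal)
  show ?thesis
    by (rule tensor_lift_rep[OF b]) (use p J.a_rcos_self in \<open>auto simp: tensor_simps\<close>)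
qed

lemma tensor_lift_pure: "\<lbrakk>bilinear_form A B C b; x \<in> carrier A; y \<in> carrier B\<rbrakk> \<Longrightarrow>
    tensor_lift C b (pt x y) = b (x, y)"
  by (simp add: pure_tensor_def tensor_lift_coset single_in_pair C.lin_ext_single bilinear_formD)

lemma tensor_lift_closed: "\<lbrakk>bilinear_form A B C b; t \<in> carrier TA\<rbrakk> \<Longrightarrow> tensor_lift C b t \<in> carrier C"
  using lin_ext_pair_closed by (auto simp: tensor_simps tensor_lift_coset C.lin_ext_closed)

lemma tensor_lift_add: "\<lbrakk>bilinear_form A B C b; t \<in> carrier TA; t' \<in> carrier TA\<rbrakk> \<Longrightarrow>
    tensor_lift C b (t \<oplus>\<^bsub>TA\<^esub> t') = tensor_lift C b t \<oplus>\<^bsub>C\<^esub> tensor_lift C b t'"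
  using lin_ext_pair_closed
  by (auto simp: tensor_simps(1,3) tensor_lift_coset pair_simps(2) add_in_pair C.lin_ext_add Pi_Un)

lemma tensor_lift_smult: "\<lbrakk>bilinear_form A B C b; t \<in> carrier TA\<rbrakk> \<Longrightarrow>
    tensor_lift C b (c \<odot>\<^bsub>TA\<^esub> t) = c \<odot>\<^bsub>C\<^esub> tensor_lift C b t"
  using lin_ext_pair_closed PA.sm_closed
  by (auto simp: tensor_simps(1,6) tensor_lift_coset) (simp add: pair_simps(5) C.lin_ext_smult)

end

end


section \<open>Gaussian binomial coefficients\<close>

text \<open>\<open>qbinomial v m k\<close> does not vanish for \<open>k > m\<close>, because of the truncated difference
  in its definition; the Pascal rules hold for its extension by zero.\<close>

definition gauss :: "'k::field \<Rightarrow> nat \<Rightarrow> nat \<Rightarrow> 'k" where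
  "gauss v m k = (if k \<le> m then qbinomial v m k else 0)"

lemma qfact_nonzero: "(\<And>n. n > 0 \<Longrightarrow> v ^ n \<noteq> 1) \<Longrightarrow> qfact v m \<noteq> (0::'k::field)"
  using power_one_right[of v] by (auto simp: qfact_def qint_def) (metis zero_less_one power_one_right)

lemma gauss_self: "(\<And>n. n > 0 \<Longrightarrow> v ^ n \<noteq> 1) \<Longrightarrow> gauss v m m = (1::'k::field)"
  using qfact_nonzero[of v m] qfact_nonzero[of v 0] by (simp add: gauss_def qbinomial_def) (simp add: qfact_def)

lemma gauss_zero: "(\<And>n. n > 0 \<Longrightarrow> v ^ n \<noteq> 1) \<Longrightarrow> gauss v m 0 = (1::'k::field)"
  using qfact_nonzero[of v m] by (simp add: gauss_def qbinomial_def) (simp add: qfact_def)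

lemma gauss_Pascal:
  fixes v :: "'k::field"
  assumes v: "\<And>n. n > 0 \<Longrightarrow> v ^ n \<noteq> 1" and k: "k \<le> m"
  shows "gauss v (Suc m) (Suc k) = gauss v m (Suc k) + v ^ (m - k) * gauss v m k"
    and "gauss v (Suc m) (Suc k) = v ^ Suc k * gauss v m (Suc k) + gauss v m k"
proof -
  have v1: "v \<noteq> 1" using v[of 1] by simp
  have nz: "qfact v n \<noteq> 0" for n using qfact_nonzero[OF v] by blast
  have qS: "qfact v (Suc n) = qfact v n * qint v (Suc n)" for n by (simp add: qfact_def)
  have nzi: "qint v (Suc n) \<noteq> 0" for n using nz[of "Suc n"] by (simp add: qS)
  show "gauss v (Suc m) (Suc k) = gauss v m (Suc k) + v ^ (m - k) * gauss v m k"
    and "gauss v (Suc m) (Suc k) = v ^ Suc k * gauss v m (Suc k) + gauss v m k"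
  proof (atomize (full), cases "k = m")
    case True
    then show "gauss v (Suc m) (Suc k) = gauss v m (Suc k) + v ^ (m - k) * gauss v m k \<and>
      gauss v (Suc m) (Suc k) = v ^ Suc k * gauss v m (Suc k) + gauss v m k"
      using gauss_self[OF v, of m] gauss_self[OF v, of "Suc m"] by (simp add: gauss_def)
  next
    case False
    then obtain l where m: "m = k + Suc l" using k by (metis less_imp_Suc_add le_neq_implies_less add_Suc_right)
    have mk: "m - k = Suc l" by (simp add: m)
    define F where "F = qfact v m / (qfact v k * qfact v l)"
    define a where "a = qint v (Suc k)"
    define b where "b = qint v (Suc l)"
    have ab: "a \<noteq> 0" "b \<noteq> 0" using nzi by (auto simp: a_def b_def)
    have G: "gauss v (Suc m) (Suc k) = F * qint v (Suc m) / (a * b)" "gauss v m (Suc k) = F / a" "gauss v m k = F / b"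
      by (simp_all add: gauss_def qbinomial_def m F_def a_def b_def qS)
    have I: "qint v (Suc m) = b + v ^ Suc l * a" "qint v (Suc m) = v ^ Suc k * b + a"
    proof -
      have q: "qint v n * (v - 1) = v ^ n - 1" for n using v1 by (simp add: qint_def)
      have "(b + v ^ Suc l * a) * (v - 1) = b * (v - 1) + v ^ Suc l * (a * (v - 1))"
        "(v ^ Suc k * b + a) * (v - 1) = v ^ Suc k * (b * (v - 1)) + a * (v - 1)"
        by (simp_all add: algebra_simps)
      then have "(b + v ^ Suc l * a) * (v - 1) = qint v (Suc m) * (v - 1)"
        "(v ^ Suc k * b + a) * (v - 1) = qint v (Suc m) * (v - 1)"
        by (simp_all add: a_def b_def q) (simp_all add: m algebra_simps power_add)
      then show "qint v (Suc m) = b + v ^ Suc l * a" "qint v (Suc m) = v ^ Suc k * b + a"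
        using v1 by auto
    qed
    have "F * qint v (Suc m) / (a * b) = F / a + v ^ Suc l * (F / b)"
      unfolding I(1) using ab by (simp add: field_simps)
    moreover have "F * qint v (Suc m) / (a * b) = v ^ Suc k * (F / a) + F / b"
      unfolding I(2) using ab by (simp add: field_simps)
    ultimately show "gauss v (Suc m) (Suc k) = gauss v m (Suc k) + v ^ (m - k) * gauss v m k \<and>
      gauss v (Suc m) (Suc k) = v ^ Suc k * gauss v m (Suc k) + gauss v m k"
      unfolding G mk by blast
  qed
qed

section \<open>Quantum Serre elements as iterated skew commutators\<close>

context k_algebra
begin

text \<open>For a \<open>q\<close>-parameter \<open>v\<close>, the Serre relation of length \<open>m\<close> is the vanishing of
  \<open>(L\<^sub>x - v\<^sup>m\<^sup>-\<^sup>1 c R\<^sub>x) \<dots> (L\<^sub>x - c R\<^sub>x) y\<close>, where \<open>L\<^sub>x\<close> and \<open>R\<^sub>x\<close> are left and right multiplication by \<open>x\<close>.\<close>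

definition skew_comm :: "'k \<Rightarrow> 'a \<Rightarrow> 'a \<Rightarrow> 'a" where
  "skew_comm t x y = x \<otimes> y \<oplus> (- t) \<odot> (y \<otimes> x)"

primrec qserre :: "'k \<Rightarrow> 'k \<Rightarrow> 'a \<Rightarrow> 'a \<Rightarrow> nat \<Rightarrow> 'a" where
  "qserre v c x y 0 = y"
| "qserre v c x y (Suc m) = skew_comm (v ^ m * c) x (qserre v c x y m)"

lemma skew_comm_closed [simp]: "\<lbrakk>x \<in> carrier A; y \<in> carrier A\<rbrakk> \<Longrightarrow> skew_comm t x y \<in> carrier A"
  by (simp add: skew_comm_def)

lemma qserre_closed [simp]: "\<lbrakk>x \<in> carrier A; y \<in> carrier A\<rbrakk> \<Longrightarrow> qserre v c x y m \<in> carrier A"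
  by (induct m) simp_all

lemma skew_comm_add: "\<lbrakk>x \<in> carrier A; y \<in> carrier A; z \<in> carrier A\<rbrakk> \<Longrightarrow>
    skew_comm t x (y \<oplus> z) = skew_comm t x y \<oplus> skew_comm t x z"
  by (simp add: skew_comm_def l_distr r_distr sm_add_right a_ac)

lemma skew_comm_smult: "\<lbrakk>x \<in> carrier A; y \<in> carrier A\<rbrakk> \<Longrightarrow>
    skew_comm t x (c \<odot> y) = c \<odot> skew_comm t x y"
  by (simp add: skew_comm_def sm_add_right mult.commute)

lemma skew_comm_zero: "x \<in> carrier A \<Longrightarrow> skew_comm t x \<zero> = \<zero>"
  by (simp add: skew_comm_def)

lemma skew_comm_finsum: "\<lbrakk>finite S; x \<in> carrier A; f \<in> S \<rightarrow> carrier A\<rbrakk> \<Longrightarrow>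
    skew_comm t x (\<Oplus>i\<in>S. f i) = (\<Oplus>i\<in>S. skew_comm t x (f i))"
  by (induct set: finite) (simp_all add: skew_comm_zero Pi_def skew_comm_add)

lemma move_power:
  assumes xy: "x \<in> carrier A" "y \<in> carrier A" and comm: "y \<otimes> x = c \<odot> (x \<otimes> y)"
  shows "y \<otimes> x [^] (n::nat) = c ^ n \<odot> (x [^] n \<otimes> y)"
proof (induct n)
  case (Suc n)
  have "y \<otimes> x [^] Suc n = (y \<otimes> x [^] n) \<otimes> x" using xy by (simp add: m_assoc)
  also have "\<dots> = c ^ n \<odot> (x [^] n \<otimes> (y \<otimes> x))" using xy by (simp add: Suc m_assoc)
  also have "\<dots> = c ^ Suc n \<odot> (x [^] Suc n \<otimes> y)" using xy by (simp add: comm m_assoc mult.commute)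
  finally show ?case .
qed (use xy in simp)

lemma move_qserre:
  assumes c: "x \<in> carrier A" "y \<in> carrier A" "w \<in> carrier A"
    and wx: "w \<otimes> x = p \<odot> (x \<otimes> w)" and wy: "w \<otimes> y = q \<odot> (y \<otimes> w)"
  shows "w \<otimes> qserre v c x y m = (p ^ m * q) \<odot> (qserre v c x y m \<otimes> w)"
proof (induct m)
  case (Suc m)
  let ?S = "qserre v c x y m"
  have "w \<otimes> (x \<otimes> ?S) = (p ^ Suc m * q) \<odot> ((x \<otimes> ?S) \<otimes> w)"
  proof -
    have "w \<otimes> (x \<otimes> ?S) = (w \<otimes> x) \<otimes> ?S" using c by (simp add: m_assoc)
    also have "\<dots> = p \<odot> (x \<otimes> (w \<otimes> ?S))" using c by (simp add: wx m_assoc)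
    finally show ?thesis using c by (simp add: Suc m_assoc mult_ac)
  qed
  moreover have "w \<otimes> (?S \<otimes> x) = (p ^ Suc m * q) \<odot> ((?S \<otimes> x) \<otimes> w)"
  proof -
    have "w \<otimes> (?S \<otimes> x) = (w \<otimes> ?S) \<otimes> x" using c by (simp add: m_assoc)
    also have "\<dots> = (p ^ m * q) \<odot> (?S \<otimes> (w \<otimes> x))" using c by (simp add: Suc m_assoc)
    finally show ?thesis using c by (simp add: wx m_assoc mult_ac)
  qed
  ultimately show ?case
    using c by (simp add: skew_comm_def r_distr l_distr sm_add_right mult_ac)
qed (use c wy in simp)

lemma hom_qserre:
  assumes B: "k_algebra B" and h: "h \<in> algebra_hom A B" and c: "x \<in> carrier A" "y \<in> carrier A"
  shows "h (qserre v c x y m) = k_algebra.qserre B v c (h x) (h y) m"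
proof -
  interpret B: k_algebra B by fact
  show ?thesis
    by (induct m) (use c in \<open>simp_all add: skew_comm_def B.skew_comm_def algebra_homD[OF h]\<close>)
qed

text \<open>If \<open>x'\<close>, \<open>y'\<close> skew commute with \<open>x\<close>, \<open>y\<close>, the Serre element of the sums splits: all mixed
  terms have the form \<open>x\<^sup>m\<^sup>-\<^sup>k S\<^sub>k(x', y')\<close>, and their coefficients are Gaussian binomials times
  products of factors \<open>1 - \<zeta> v\<^sup>p\<close>, of which the last one vanishes at the length of the Serre
  relation.\<close>

context
  fixes v c \<zeta> c' :: 'k and x y x' y' :: 'a
  assumes carr: "x \<in> carrier A" "y \<in> carrier A" "x' \<in> carrier A" "y' \<in> carrier A"
    and x'x: "x' \<otimes> x = v \<odot> (x \<otimes> x')" and x'y: "x' \<otimes> y = c \<odot> (y \<otimes> x')"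
    and y'x: "y' \<otimes> x = c' \<odot> (x \<otimes> y')"
begin

lemma skew_comm_mixed_first:
  "skew_comm (v ^ m * c) (x \<oplus> x') (qserre v c x y m) = qserre v c x y (Suc m)"
proof -
  let ?S = "qserre v c x y m"
  have "x' \<otimes> ?S = (v ^ m * c) \<odot> (?S \<otimes> x')"
    by (rule move_qserre[OF carr(1,2,3) x'x x'y])
  then show ?thesis
    using carr by (simp add: skew_comm_def l_distr r_distr sm_add_right)
      (simp add: a_ac flip: sm_add_left)
qed

lemma skew_comm_mixed_second:
  assumes k: "k \<le> m"
  shows "skew_comm (v ^ m * c) (x \<oplus> x') (x [^] (m - k) \<otimes> qserre v c x' y' k) =
    (1 - v ^ (m + k) * (c * c')) \<odot> (x [^] (Suc m - k) \<otimes> qserre v c x' y' k) \<oplus>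
    v ^ (m - k) \<odot> (x [^] (Suc m - Suc k) \<otimes> qserre v c x' y' (Suc k))"
proof -
  let ?S = "qserre v c x' y' k" and ?x = "x [^] (m - k)"
  have S: "?S \<in> carrier A" and X: "?x \<in> carrier A" using carr by simp_all
  have Sx: "?S \<otimes> x = (v ^ k * c') \<odot> (x \<otimes> ?S)"
  proof (induct k)
    case 0 show ?case by (simp add: y'x)
  next
    case (Suc k)
    let ?S = "qserre v c x' y' k"
    have "(x' \<otimes> ?S) \<otimes> x = (v ^ Suc k * c') \<odot> (x \<otimes> (x' \<otimes> ?S))"
    proof -
      have "(x' \<otimes> ?S) \<otimes> x = x' \<otimes> (?S \<otimes> x)" using carr by (simp add: m_assoc)
      also have "\<dots> = (v ^ k * c') \<odot> ((x' \<otimes> x) \<otimes> ?S)" using carr by (simp add: Suc m_assoc)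
      finally show ?thesis using carr by (simp add: x'x m_assoc mult_ac)
    qed
    moreover have "(?S \<otimes> x') \<otimes> x = (v ^ Suc k * c') \<odot> (x \<otimes> (?S \<otimes> x'))"
    proof -
      have "(?S \<otimes> x') \<otimes> x = v \<odot> ((?S \<otimes> x) \<otimes> x')" using carr by (simp add: x'x m_assoc)
      then show ?thesis using carr by (simp add: Suc m_assoc mult_ac)
    qed
    ultimately show ?case
      using carr by (simp add: skew_comm_def r_distr l_distr sm_add_right mult_ac)
  qed
  have x'X: "x' \<otimes> ?x = v ^ (m - k) \<odot> (?x \<otimes> x')"
    using move_power[OF carr(1,3) x'x] .
  have xX: "x \<otimes> (?x \<otimes> ?S) = x [^] (Suc m - k) \<otimes> ?S"
    using carr k nat_pow_Suc2[of x "m - k"] by (simp add: Suc_diff_le flip: m_assoc)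
  have 1: "(?x \<otimes> ?S) \<otimes> x = (v ^ k * c') \<odot> (x [^] (Suc m - k) \<otimes> ?S)"
  proof -
    have "(?x \<otimes> ?S) \<otimes> x = (v ^ k * c') \<odot> ((?x \<otimes> x) \<otimes> ?S)"
      using carr by (simp add: m_assoc Sx)
    also have "?x \<otimes> x = x [^] (Suc m - k)" using carr k by (simp add: Suc_diff_le)
    finally show ?thesis .
  qed
  have 2: "x' \<otimes> (?x \<otimes> ?S) = v ^ (m - k) \<odot> (?x \<otimes> (x' \<otimes> ?S))"
  proof -
    have "x' \<otimes> (?x \<otimes> ?S) = (x' \<otimes> ?x) \<otimes> ?S" using carr by (simp add: m_assoc)
    then show ?thesis using carr by (simp add: x'X m_assoc)
  qed
  have 3: "(?x \<otimes> ?S) \<otimes> x' = ?x \<otimes> (?S \<otimes> x')" using carr by (simp add: m_assoc)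
  have pw: "v ^ (m - k) * (v ^ k * c) = v ^ m * c"
    using k by (simp flip: power_add mult.assoc)
  let ?P = "x [^] (Suc m - k) \<otimes> ?S" and ?Q = "?x \<otimes> (x' \<otimes> ?S)" and ?R = "?x \<otimes> (?S \<otimes> x')"
  have PQR: "?P \<in> carrier A" "?Q \<in> carrier A" "?R \<in> carrier A" using carr by simp_all
  have "skew_comm (v ^ m * c) (x \<oplus> x') (?x \<otimes> ?S) =
      (?P \<oplus> v ^ (m - k) \<odot> ?Q) \<oplus> (- (v ^ m * c)) \<odot> ((v ^ k * c') \<odot> ?P \<oplus> ?R)"
    using carr by (simp add: skew_comm_def l_distr r_distr xX 1 2 3)
  also have "\<dots> = (?P \<oplus> (- (v ^ m * c) * (v ^ k * c')) \<odot> ?P) \<oplus>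
      (v ^ (m - k) \<odot> ?Q \<oplus> (- (v ^ m * c)) \<odot> ?R)"
    using PQR by (simp add: sm_add_right a_assoc a_lcomm)
  also have "?P \<oplus> (- (v ^ m * c) * (v ^ k * c')) \<odot> ?P = (1 - v ^ (m + k) * (c * c')) \<odot> ?P"
    using PQR sm_add_left[of ?P 1 "- (v ^ m * c) * (v ^ k * c')"] by (simp add: power_add mult_ac)
  also have "v ^ (m - k) \<odot> ?Q \<oplus> (- (v ^ m * c)) \<odot> ?R =
      v ^ (m - k) \<odot> (?x \<otimes> qserre v c x' y' (Suc k))"
    using carr by (simp add: skew_comm_def r_distr sm_add_right pw)
  finally show ?thesis by simp
qed

primrec mixed_coeff :: "nat \<Rightarrow> nat \<Rightarrow> 'k" where
  "mixed_coeff 0 k = (if k = 0 then 1 else 0)"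
| "mixed_coeff (Suc m) k = (1 - v ^ (m + k) * (c * c')) * mixed_coeff m k +
     (if k = 0 then 0 else v ^ (Suc m - k) * mixed_coeff m (k - 1))"

lemma mixed_coeff_zero: "m < k \<Longrightarrow> mixed_coeff m k = 0"
  by (induct m arbitrary: k) auto

lemma qserre_add_expansion:
  "qserre v c (x \<oplus> x') (y \<oplus> y') m = qserre v c x y m \<oplus>
    (\<Oplus>k\<in>{..m}. mixed_coeff m k \<odot> (x [^] (m - k) \<otimes> qserre v c x' y' k))"
proof (induct m)
  case 0
  show ?case using carr by simp
next
  case (Suc m)
  define T where "T = (\<lambda>k. x [^] (Suc m - k) \<otimes> qserre v c x' y' k)"
  define f where "f = (\<lambda>k. ((1 - v ^ (m + k) * (c * c')) * mixed_coeff m k) \<odot> T k)"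
  define g where "g = (\<lambda>k. (if k = 0 then 0 else v ^ (Suc m - k) * mixed_coeff m (k - 1)) \<odot> T k)"
  have T: "T k \<in> carrier A" for k using carr by (simp add: T_def)
  have fg: "f \<in> S \<rightarrow> carrier A" "g \<in> S \<rightarrow> carrier A" for S using T by (auto simp: f_def g_def)
  have "qserre v c (x \<oplus> x') (y \<oplus> y') (Suc m) = qserre v c x y (Suc m) \<oplus>
    (\<Oplus>k\<in>{..m}. skew_comm (v ^ m * c) (x \<oplus> x') (mixed_coeff m k \<odot> (x [^] (m - k) \<otimes> qserre v c x' y' k)))"
  proof -
    have "qserre v c (x \<oplus> x') (y \<oplus> y') (Suc m) =
        skew_comm (v ^ m * c) (x \<oplus> x') (qserre v c (x \<oplus> x') (y \<oplus> y') m)" by simp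
    then show ?thesis
      using carr by (simp only: Suc) (simp add: skew_comm_add skew_comm_mixed_first skew_comm_finsum
          del: qserre.simps(2))
  qed
  also have "(\<Oplus>k\<in>{..m}. skew_comm (v ^ m * c) (x \<oplus> x') (mixed_coeff m k \<odot> (x [^] (m - k) \<otimes> qserre v c x' y' k))) =
    (\<Oplus>k\<in>{..m}. f k \<oplus> g (Suc k))"
  proof (rule finsum_cong')
    show "skew_comm (v ^ m * c) (x \<oplus> x') (mixed_coeff m k \<odot> (x [^] (m - k) \<otimes> qserre v c x' y' k)) = f k \<oplus> g (Suc k)"
      if "k \<in> {..m}" for k
    proof -
      have "skew_comm (v ^ m * c) (x \<oplus> x') (mixed_coeff m k \<odot> (x [^] (m - k) \<otimes> qserre v c x' y' k)) =
        mixed_coeff m k \<odot> ((1 - v ^ (m + k) * (c * c')) \<odot> T k \<oplus> v ^ (m - k) \<odot> T (Suc k))"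
        unfolding T_def skew_comm_mixed_second[of k m, symmetric, OF that[unfolded atMost_iff]]
        using carr by (simp add: skew_comm_smult del: qserre.simps(2))
      then show ?thesis
        using T by (simp add: f_def g_def sm_add_right mult_ac)
    qed
  qed (use fg T in \<open>auto simp: f_def g_def\<close>)
  also have "\<dots> = (\<Oplus>k\<in>{..m}. f k) \<oplus> (\<Oplus>k\<in>{..m}. g (Suc k))"
    by (rule finsum_addf) (use fg[of UNIV] in auto)
  also have "(\<Oplus>k\<in>{..m}. f k) = (\<Oplus>k\<in>{..Suc m}. f k)"
  proof -
    have "(\<Oplus>k\<in>{..Suc m}. f k) = f (Suc m) \<oplus> (\<Oplus>k\<in>{..m}. f k)"
      by (rule finsum_Suc) (use fg in auto)
    moreover have "f (Suc m) = \<zero>" using T by (simp add: f_def mixed_coeff_zero)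
    ultimately show ?thesis using finsum_closed[OF fg(1)] by simp
  qed
  also have "(\<Oplus>k\<in>{..m}. g (Suc k)) = (\<Oplus>k\<in>{..Suc m}. g k)"
  proof -
    have "(\<Oplus>k\<in>{..Suc m}. g k) = (\<Oplus>k\<in>{..m}. g (Suc k)) \<oplus> g 0"
      by (rule finsum_Suc2) (use fg in auto)
    moreover have "g 0 = \<zero>" using T by (simp add: g_def)
    moreover have "(\<Oplus>k\<in>{..m}. g (Suc k)) \<in> carrier A" by (rule finsum_closed) (use fg[of UNIV] in auto)
    ultimately show ?thesis by simp
  qed
  also have "(\<Oplus>k\<in>{..Suc m}. f k) \<oplus> (\<Oplus>k\<in>{..Suc m}. g k) = (\<Oplus>k\<in>{..Suc m}. f k \<oplus> g k)"
    by (rule finsum_addf[symmetric]) (use fg in auto)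
  also have "\<dots> = (\<Oplus>k\<in>{..Suc m}. mixed_coeff (Suc m) k \<odot> T k)"
    by (rule finsum_cong') (use T in \<open>auto simp: f_def g_def sm_add_left\<close>)
  finally show ?case by (simp add: T_def)
qed

lemma mixed_coeff_eq:
  assumes v: "\<And>n. n > 0 \<Longrightarrow> v ^ n \<noteq> 1"
  shows "mixed_coeff m k = gauss v m k * (\<Prod>p = k..<m. 1 - v ^ p * (c * c'))"
proof (induct m arbitrary: k)
  case 0
  show ?case using gauss_zero[OF v, of 0] by (simp add: gauss_def)
next
  case (Suc m)
  define P where "P = (\<lambda>k. \<Prod>p = k..<m. 1 - v ^ p * (c * c'))"
  have top: "(\<Prod>p = k..<Suc m. 1 - v ^ p * (c * c')) = P k * (1 - v ^ m * (c * c'))" if "k \<le> m" for k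
    using that by (simp add: P_def prod.atLeastLessThan_Suc)
  show ?case
  proof (cases k)
    case 0
    then show ?thesis
      by (simp add: Suc gauss_zero[OF v] top[unfolded P_def])
  next
    case (Suc j)
    consider "j < m" | "j = m" | "m < j" by linarith
    then show ?thesis
    proof cases
      case 1
      have bot: "P j = (1 - v ^ j * (c * c')) * P (Suc j)"
        using 1 by (simp add: P_def prod.atLeast_Suc_lessThan)
      let ?z = "c * c'"
      have vm: "v ^ m = v ^ (m - j) * v ^ j" using 1 by (simp flip: power_add)
      have G1: "gauss v (Suc m) (Suc j) = gauss v m (Suc j) + v ^ (m - j) * gauss v m j"
        and G2: "gauss v (Suc m) (Suc j) = v ^ Suc j * gauss v m (Suc j) + gauss v m j"
        using gauss_Pascal[OF v, of j m] 1 by auto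
      have "mixed_coeff (Suc m) k = (1 - v ^ (m + Suc j) * ?z) * (gauss v m (Suc j) * P (Suc j)) +
          v ^ (m - j) * (gauss v m j * P j)"
        by (simp add: Suc \<open>\<And>k. mixed_coeff m k = _\<close> P_def)
      also have "\<dots> = P (Suc j) * ((gauss v m (Suc j) + v ^ (m - j) * gauss v m j) -
          v ^ m * ?z * (v ^ Suc j * gauss v m (Suc j) + gauss v m j))"
        unfolding bot vm by (simp add: algebra_simps power_add vm)
      also have "\<dots> = P (Suc j) * (gauss v (Suc m) (Suc j) - v ^ m * ?z * gauss v (Suc m) (Suc j))"
        by (simp only: flip: G1 G2)
      also have "\<dots> = gauss v (Suc m) k * (P k * (1 - v ^ m * ?z))"
        by (simp add: Suc algebra_simps)
      also have "P k * (1 - v ^ m * ?z) = (\<Prod>p = k..<Suc m. 1 - v ^ p * ?z)"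
        by (rule top[symmetric]) (use 1 Suc in simp)
      finally show ?thesis .
    next
      case 2
      then show ?thesis
        using mixed_coeff_zero[of m "Suc m"] gauss_self[OF v]
        by (simp add: Suc \<open>\<And>k. mixed_coeff m k = _\<close>)
    next
      case 3
      then show ?thesis by (simp add: Suc mixed_coeff_zero gauss_def)
    qed
  qed
qed

lemma qserre_add:
  assumes v: "\<And>n. n > 0 \<Longrightarrow> v ^ n \<noteq> 1" and N: "N > 0" and zeta: "v ^ (N - 1) * (c * c') = 1"
  shows "qserre v c (x \<oplus> x') (y \<oplus> y') N = qserre v c x y N \<oplus> qserre v c x' y' N"
proof -
  have low: "mixed_coeff N k = 0" if "k < N" for k
  proof -
    have "N - 1 \<in> {k..<N}" using that by auto
    then have "(\<Prod>p = k..<N. 1 - v ^ p * (c * c')) = 0"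
      using zeta by (intro prod_zero) auto
    then show ?thesis by (simp add: mixed_coeff_eq[OF v])
  qed
  have "(\<Oplus>k\<in>{..N}. mixed_coeff N k \<odot> (x [^] (N - k) \<otimes> qserre v c x' y' k)) =
      (\<Oplus>k\<in>{..N}. if N = k then qserre v c x' y' k else \<zero>)"
    using carr by (intro finsum_cong') (auto simp: low mixed_coeff_eq[OF v, of N N] gauss_self[OF v] le_less)
  also have "\<dots> = qserre v c x' y' N"
    using carr by (intro finsum_singleton) auto
  finally show ?thesis by (simp add: qserre_add_expansion)
qed

end

end


subsection \<open>Commutators with Serre elements\<close>

context k_algebra
begin

text \<open>The elements \<open>w\<^sub>1\<close> and \<open>w\<^sub>2\<close> stand for the two Cartan parts of the commutator of \<open>e\<^sub>i\<close> and
  \<open>f\<^sub>i\<close>. The first cancels in every step of the iteration; the contributions \<open>1 / (v\<^sup>p c') - v\<^sup>p c\<close> of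
  the second cancel in total, since \<open>v\<^sup>N\<^sup>-\<^sup>1 c c' = 1\<close> makes the two sums equal in reversed order.\<close>

lemma qserre_commutes_first:
  fixes v c c' :: 'k and N :: nat
  assumes c: "x \<in> carrier A" "y \<in> carrier A" "f \<in> carrier A" "w1 \<in> carrier A" "w2 \<in> carrier A"
    and xf: "x \<otimes> f = f \<otimes> x \<oplus> (w1 \<oplus> w2)" and yf: "y \<otimes> f = f \<otimes> y"
    and w1x: "w1 \<otimes> x = v \<odot> (x \<otimes> w1)" and w1y: "w1 \<otimes> y = c \<odot> (y \<otimes> w1)"
    and w2x: "w2 \<otimes> x = (1 / v) \<odot> (x \<otimes> w2)" and w2y: "w2 \<otimes> y = (1 / c') \<odot> (y \<otimes> w2)"
    and v: "v \<noteq> 0" and c': "c' \<noteq> 0" and N: "N > 0" and zeta: "v ^ (N - 1) * (c * c') = 1"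
  shows "qserre v c x y N \<otimes> f = f \<otimes> qserre v c x y N"
proof -
  define \<tau> where "\<tau> = (\<lambda>m. \<Sum>p<m. 1 / (v ^ p * c') - v ^ p * c)"
  have gen: "qserre v c x y m \<otimes> f = f \<otimes> qserre v c x y m \<oplus> \<tau> m \<odot> (qserre v c x y (m - 1) \<otimes> w2)" for m
  proof (induct m)
    case 0
    then show ?case using c by (simp add: \<tau>_def yf)
  next
    case (Suc m)
    define S where "S = qserre v c x y m"
    define R where "R = qserre v c x y (m - 1) \<otimes> w2"
    define t where "t = v ^ m * c"
    have car: "S \<in> carrier A" "R \<in> carrier A" using c by (simp_all add: S_def R_def)
    have SS: "qserre v c x y (Suc m) = x \<otimes> S \<oplus> (- t) \<odot> (S \<otimes> x)"
      by (simp add: S_def t_def skew_comm_def)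
    have IH: "S \<otimes> f = f \<otimes> S \<oplus> \<tau> m \<odot> R" using Suc by (simp add: S_def R_def)
    have w1S: "w1 \<otimes> S = t \<odot> (S \<otimes> w1)"
      using move_qserre[OF c(1,2,4) w1x w1y] by (simp add: S_def t_def)
    have w2S: "w2 \<otimes> S = (1 / (v ^ m * c')) \<odot> (S \<otimes> w2)"
      using move_qserre[OF c(1,2,5) w2x w2y, of v c m] by (simp add: S_def power_one_over)
    have R: "\<tau> m \<odot> (x \<otimes> R \<oplus> (- t) \<odot> (R \<otimes> x)) = \<tau> m \<odot> (S \<otimes> w2)"
    proof (cases m)
      case 0
      then show ?thesis using c car by (simp add: \<tau>_def)
    next
      case (Suc n)
      have "R \<otimes> x = (1 / v) \<odot> (qserre v c x y n \<otimes> x \<otimes> w2)"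
        using c by (simp add: R_def Suc m_assoc w2x)
      then show ?thesis
        using c v by (simp add: R_def S_def Suc t_def skew_comm_def l_distr m_assoc)
    qed
    have 1: "(x \<otimes> S) \<otimes> f = f \<otimes> (x \<otimes> S) \<oplus> t \<odot> (S \<otimes> w1) \<oplus> (1 / (v ^ m * c')) \<odot> (S \<otimes> w2) \<oplus> \<tau> m \<odot> (x \<otimes> R)"
    proof -
      have "(x \<otimes> S) \<otimes> f = (x \<otimes> f) \<otimes> S \<oplus> \<tau> m \<odot> (x \<otimes> R)"
        using c car by (simp add: m_assoc IH r_distr)
      also have "(x \<otimes> f) \<otimes> S = f \<otimes> (x \<otimes> S) \<oplus> (w1 \<otimes> S \<oplus> w2 \<otimes> S)"
        using c car by (simp add: xf l_distr m_assoc)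
      finally show ?thesis using c car by (simp add: w1S w2S a_assoc)
    qed
    have 2: "(S \<otimes> x) \<otimes> f = f \<otimes> (S \<otimes> x) \<oplus> \<tau> m \<odot> (R \<otimes> x) \<oplus> S \<otimes> w1 \<oplus> S \<otimes> w2"
    proof -
      have "(S \<otimes> x) \<otimes> f = (S \<otimes> f) \<otimes> x \<oplus> S \<otimes> w1 \<oplus> S \<otimes> w2"
        using c car by (simp add: m_assoc xf r_distr a_assoc)
      then show ?thesis using c car by (simp add: IH l_distr m_assoc)
    qed
    let ?a = "f \<otimes> (x \<otimes> S)" and ?b = "f \<otimes> (S \<otimes> x)" and ?h = "S \<otimes> w1" and ?i = "S \<otimes> w2"
      and ?d = "x \<otimes> R" and ?g = "R \<otimes> x" and ?q = "1 / (v ^ m * c')"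
    have carr: "?a \<in> carrier A" "?b \<in> carrier A" "?h \<in> carrier A" "?i \<in> carrier A" "?d \<in> carrier A" "?g \<in> carrier A"
      using c car by simp_all
    have "qserre v c x y (Suc m) \<otimes> f = (x \<otimes> S) \<otimes> f \<oplus> (- t) \<odot> ((S \<otimes> x) \<otimes> f)"
      using c car by (simp only: SS) (simp add: l_distr)
    also have "\<dots> = (?a \<oplus> (- t) \<odot> ?b) \<oplus> ((t \<odot> ?h \<oplus> (- t) \<odot> ?h) \<oplus>
        ((?q \<odot> ?i \<oplus> (- t) \<odot> ?i) \<oplus> (\<tau> m \<odot> ?d \<oplus> (- t * \<tau> m) \<odot> ?g)))"
      unfolding 1 2 using carr by (simp add: sm_add_right a_ac)
    also have "t \<odot> ?h \<oplus> (- t) \<odot> ?h = \<zero>" using carr by (simp flip: sm_add_left)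
    also have "?q \<odot> ?i \<oplus> (- t) \<odot> ?i = (?q - t) \<odot> ?i" using carr by (simp flip: sm_add_left)
    also have "\<tau> m \<odot> ?d \<oplus> (- t * \<tau> m) \<odot> ?g = \<tau> m \<odot> ?i"
      using R carr by (simp add: sm_add_right mult.commute)
    also have "?a \<oplus> (- t) \<odot> ?b = f \<otimes> qserre v c x y (Suc m)"
      using c car by (simp only: SS) (simp add: r_distr)
    also have "\<zero> \<oplus> ((?q - t) \<odot> ?i \<oplus> \<tau> m \<odot> ?i) = \<tau> (Suc m) \<odot> ?i"
      using carr by (simp add: \<tau>_def t_def add.commute flip: sm_add_left)
    finally show ?case by (simp add: S_def)
  qed
  have "\<tau> N = 0"
  proof -
    have c: "c = 1 / (v ^ (N - 1) * c')" using zeta v c' by (simp add: field_simps)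
    have "v ^ p * c = 1 / (v ^ (N - Suc p) * c')" if "p < N" for p
    proof -
      have "v ^ (N - 1) = v ^ p * v ^ (N - Suc p)" using that by (simp flip: power_add)
      then show ?thesis using v c' by (simp add: c field_simps)
    qed
    then have "(\<Sum>p<N. v ^ p * c) = (\<Sum>p<N. 1 / (v ^ (N - Suc p) * c'))" by simp
    also have "\<dots> = (\<Sum>p<N. 1 / (v ^ p * c'))" by (rule sum.nat_diff_reindex)
    finally show ?thesis by (simp add: \<tau>_def sum_subtractf)
  qed
  then show ?thesis using gen[of N] c by simp
qed

text \<open>Here both Cartan parts enter only at the start of the iteration and then pick up one factor
  per step. For \<open>w\<^sub>1\<close> the last factor vanishes, for \<open>w\<^sub>2\<close> already the first one.\<close>

lemma qserre_commutes_second: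
  fixes v c c' :: 'k and N :: nat
  assumes c: "x \<in> carrier A" "y \<in> carrier A" "f \<in> carrier A" "w1 \<in> carrier A" "w2 \<in> carrier A"
    and xf: "x \<otimes> f = f \<otimes> x" and yf: "y \<otimes> f = f \<otimes> y \<oplus> (w1 \<oplus> w2)"
    and w1x: "w1 \<otimes> x = c' \<odot> (x \<otimes> w1)" and w2x: "w2 \<otimes> x = (1 / c) \<odot> (x \<otimes> w2)"
    and const_term: "c \<noteq> 0" and N: "N > 0" and zeta: "v ^ (N - 1) * (c * c') = 1"
  shows "qserre v c x y N \<otimes> f = f \<otimes> qserre v c x y N"
proof -
  define a where "a = (\<lambda>m. \<Prod>p<m. 1 - v ^ p * (c * c'))"
  define b where "b = (\<lambda>m. \<Prod>p<m. 1 - v ^ p)"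
  have gen: "qserre v c x y m \<otimes> f = f \<otimes> qserre v c x y m \<oplus>
      (a m \<odot> (x [^] m \<otimes> w1) \<oplus> b m \<odot> (x [^] m \<otimes> w2))" for m
  proof (induct m)
    case 0
    then show ?case using c by (simp add: a_def b_def yf)
  next
    case (Suc m)
    define S where "S = qserre v c x y m"
    define t where "t = v ^ m * c"
    let ?X = "x [^] m"
    have car: "S \<in> carrier A" "?X \<in> carrier A" using c by (simp_all add: S_def)
    have SS: "qserre v c x y (Suc m) = x \<otimes> S \<oplus> (- t) \<odot> (S \<otimes> x)"
      by (simp add: S_def t_def skew_comm_def)
    have IH: "S \<otimes> f = f \<otimes> S \<oplus> (a m \<odot> (?X \<otimes> w1) \<oplus> b m \<odot> (?X \<otimes> w2))"
      using Suc by (simp add: S_def)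
    let ?W1 = "x [^] Suc m \<otimes> w1" and ?W2 = "x [^] Suc m \<otimes> w2"
    have W: "x \<otimes> (?X \<otimes> w1) = ?W1" "x \<otimes> (?X \<otimes> w2) = ?W2"
      using c nat_pow_Suc2[of x m] by (simp_all flip: m_assoc)
    have V: "(?X \<otimes> w1) \<otimes> x = c' \<odot> ?W1" "(?X \<otimes> w2) \<otimes> x = (1 / c) \<odot> ?W2"
      using c by (simp_all add: m_assoc w1x w2x)
    let ?a = "f \<otimes> (x \<otimes> S)" and ?b = "f \<otimes> (S \<otimes> x)"
    have carr: "?a \<in> carrier A" "?b \<in> carrier A" "?W1 \<in> carrier A" "?W2 \<in> carrier A"
      using c car by simp_all
    have 1: "(x \<otimes> S) \<otimes> f = ?a \<oplus> (a m \<odot> ?W1 \<oplus> b m \<odot> ?W2)"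
    proof -
      have "(x \<otimes> S) \<otimes> f = (x \<otimes> f) \<otimes> S \<oplus> (a m \<odot> (x \<otimes> (?X \<otimes> w1)) \<oplus> b m \<odot> (x \<otimes> (?X \<otimes> w2)))"
        using c car by (simp add: m_assoc IH r_distr del: nat_pow_Suc)
      then show ?thesis using c car by (simp add: W xf m_assoc del: nat_pow_Suc)
    qed
    have 2: "(S \<otimes> x) \<otimes> f = ?b \<oplus> ((a m * c') \<odot> ?W1 \<oplus> (b m * (1 / c)) \<odot> ?W2)"
    proof -
      have "(S \<otimes> x) \<otimes> f = (S \<otimes> f) \<otimes> x"
        using c car by (simp add: m_assoc xf)
      then show ?thesis
        using c car by (simp add: IH l_distr V del: nat_pow_Suc) (simp add: m_assoc)
    qed
    have "qserre v c x y (Suc m) \<otimes> f = (x \<otimes> S) \<otimes> f \<oplus> (- t) \<odot> ((S \<otimes> x) \<otimes> f)"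
      using c car by (simp only: SS) (simp add: l_distr)
    also have "\<dots> = (?a \<oplus> (- t) \<odot> ?b) \<oplus> ((a m \<odot> ?W1 \<oplus> (- t * (a m * c')) \<odot> ?W1) \<oplus>
        (b m \<odot> ?W2 \<oplus> (- t * (b m * (1 / c))) \<odot> ?W2))"
      unfolding 1 2 using carr by (simp add: sm_add_right a_ac del: nat_pow_Suc)
    also have "a m \<odot> ?W1 \<oplus> (- t * (a m * c')) \<odot> ?W1 = a (Suc m) \<odot> ?W1"
      using carr by (simp add: a_def t_def algebra_simps del: nat_pow_Suc flip: sm_add_left)
    also have "b m \<odot> ?W2 \<oplus> (- t * (b m * (1 / c))) \<odot> ?W2 = b (Suc m) \<odot> ?W2"
      using carr const_term by (simp add: b_def t_def algebra_simps del: nat_pow_Suc flip: sm_add_left)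
    also have "?a \<oplus> (- t) \<odot> ?b = f \<otimes> qserre v c x y (Suc m)"
      using c car by (simp only: SS) (simp add: r_distr)
    finally show ?case .
  qed
  have "a N = 0" unfolding a_def using N zeta by (intro prod_zero bexI[of _ "N - 1"]) auto
  moreover have "b N = 0" unfolding b_def using N by (intro prod_zero bexI[of _ 0]) auto
  ultimately show ?thesis using gen[of N] c by simp
qed

subsection \<open>The opposite algebra\<close>

definition opp :: "('k, 'a) module" where
  "opp = \<lparr>carrier = carrier A, monoid.mult = (\<lambda>x y. y \<otimes> x), one = \<one>, ring.zero = \<zero>, add = (\<oplus>),
     module.smult = (\<odot>)\<rparr>"

lemma opp_simps [simp]: "carrier opp = carrier A" "monoid.mult opp = (\<lambda>x y. y \<otimes> x)" "one opp = \<one>"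
  "ring.zero opp = \<zero>" "add opp = (\<oplus>)" "module.smult opp = (\<odot>)"
  by (simp_all add: opp_def)

lemma k_algebra_opp: "k_algebra opp"
proof (rule k_algebraI)
  show "ring opp"
  proof (rule ringI)
    show "abelian_group opp"
    proof (rule abelian_groupI)
      fix x assume "x \<in> carrier opp"
      then show "\<exists>y\<in>carrier opp. y \<oplus>\<^bsub>opp\<^esub> x = \<zero>\<^bsub>opp\<^esub>"
        by (intro bexI[of _ "\<ominus> x"]) (simp_all add: l_neg)
    qed (simp_all add: a_ac)
    show "Group.monoid opp"
      by (rule monoidI) (simp_all add: m_assoc)
  qed (simp_all add: l_distr r_distr)
qed (simp_all add: sm_add_left sm_add_right)

text \<open>The skew commutators \<open>x y - t y x\<close> for different \<open>t\<close> commute, so the Serre element can be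
  built up in the reverse order; this is the Serre element of the opposite algebra with the inverse
  parameters.\<close>

lemma skew_comm_commute: "\<lbrakk>x \<in> carrier A; y \<in> carrier A\<rbrakk> \<Longrightarrow>
    skew_comm t x (skew_comm t' x y) = skew_comm t' x (skew_comm t x y)"
  by (simp add: skew_comm_def l_distr r_distr sm_add_right m_assoc a_ac mult.commute)

lemma skew_comm_foldr_snoc: "\<lbrakk>x \<in> carrier A; y \<in> carrier A\<rbrakk> \<Longrightarrow>
    foldr (\<lambda>t. skew_comm t x) ts y \<in> carrier A \<and>
    foldr (\<lambda>t. skew_comm t x) (ts @ [t]) y = skew_comm t x (foldr (\<lambda>t. skew_comm t x) ts y)"
  by (induct ts) (simp_all add: skew_comm_commute)

lemma skew_comm_foldr_rev: "\<lbrakk>x \<in> carrier A; y \<in> carrier A\<rbrakk> \<Longrightarrow>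
    foldr (\<lambda>t. skew_comm t x) (rev ts) y = foldr (\<lambda>t. skew_comm t x) ts y"
  by (induct ts) (simp_all add: skew_comm_foldr_snoc del: foldr_append)

lemma qserre_foldr: "qserre v c x y m = foldr (\<lambda>t. skew_comm t x) (map (\<lambda>p. v ^ p * c) (rev [0..<m])) y"
  by (induct m) simp_all

lemma qserre_opp:
  fixes v c c' :: 'k and N :: nat
  assumes car: "x \<in> carrier A" "y \<in> carrier A" and v: "v \<noteq> 0" and c': "c' \<noteq> 0"
    and zeta: "v ^ (N - 1) * (c * c') = 1"
  shows "\<exists>\<kappa>. k_algebra.qserre opp v c' x y N = \<kappa> \<odot> qserre v c x y N"
proof -
  interpret opp: k_algebra opp by (rule k_algebra_opp)
  have opp: "opp.skew_comm t x z = (- t) \<odot> skew_comm (1 / t) x z" if "t \<noteq> 0" "z \<in> carrier A" for t z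
    using that car by (simp add: opp.skew_comm_def skew_comm_def sm_add_right a_ac)
  let ?F = "\<lambda>m. foldr (\<lambda>t. skew_comm t x) (map (\<lambda>p. 1 / (v ^ p * c')) (rev [0..<m])) y"
  have F: "?F m \<in> carrier A" for m using skew_comm_foldr_snoc[OF car] by blast
  have "\<exists>\<kappa>. opp.qserre v c' x y m = \<kappa> \<odot> ?F m" for m
  proof (induct m)
    case 0 show ?case using car by (intro exI[of _ 1]) simp
  next
    case (Suc m)
    then obtain \<kappa> where "opp.qserre v c' x y m = \<kappa> \<odot> ?F m" by blast
    then have "opp.qserre v c' x y (Suc m) = (- (v ^ m * c') * \<kappa>) \<odot> ?F (Suc m)"
      using v c' F[of m] car by (simp add: opp skew_comm_smult)
    then show ?case by blast
  qed
  moreover have "?F N = qserre v c x y N"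
  proof -
    have "map (\<lambda>p. 1 / (v ^ p * c')) (rev [0..<N]) = rev (map (\<lambda>p. v ^ p * c) (rev [0..<N]))"
    proof (rule nth_equalityI)
      fix i assume "i < length (map (\<lambda>p. 1 / (v ^ p * c')) (rev [0..<N]))"
      then have i: "i < N" by simp
      have "v ^ (N - 1) = v ^ (N - Suc i) * v ^ i" using i by (simp flip: power_add)
      then have "v ^ (N - Suc i) * v ^ i * (c * c') = 1" using zeta by simp
      then have "1 / (v ^ (N - Suc i) * c') = v ^ i * c" using v c' by (simp add: field_simps)
      then show "map (\<lambda>p. 1 / (v ^ p * c')) (rev [0..<N]) ! i = rev (map (\<lambda>p. v ^ p * c) (rev [0..<N])) ! i"
        using i by (simp add: rev_nth rev_map)
    qed simp
    then show ?thesis using skew_comm_foldr_rev[OF car] by (simp add: qserre_foldr)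
  qed
  ultimately show ?thesis by metis
qed

end

subsection \<open>Expansion in the free algebra\<close>

text \<open>The expansions below are the \<open>q\<close>-binomial formula for the commuting operators of left and
  right multiplication by \<open>x\<close>.\<close>

definition serre_gauss_coeff :: "'k::field \<Rightarrow> 'k \<Rightarrow> nat \<Rightarrow> nat \<Rightarrow> 'k" where
  "serre_gauss_coeff v c m k = (- 1) ^ k * gauss v m k * (v ^ (k * (k - 1) div 2) * c ^ k)"

lemma serre_gauss_coeff_Suc:
  fixes v c :: "'k::field"
  assumes v: "\<And>n. n > 0 \<Longrightarrow> v ^ n \<noteq> 1"
  shows "serre_gauss_coeff v c (Suc m) 0 = serre_gauss_coeff v c m 0"
    and "k \<le> m \<Longrightarrow> serre_gauss_coeff v c (Suc m) (Suc k) =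
      serre_gauss_coeff v c m (Suc k) - v ^ m * c * serre_gauss_coeff v c m k"
    and "m < k \<Longrightarrow> serre_gauss_coeff v c m k = 0"
proof -
  show "serre_gauss_coeff v c (Suc m) 0 = serre_gauss_coeff v c m 0"
    using gauss_zero[OF v] by (simp add: serre_gauss_coeff_def)
  show "m < k \<Longrightarrow> serre_gauss_coeff v c m k = 0"
    by (simp add: serre_gauss_coeff_def gauss_def)
  assume k: "k \<le> m"
  define q where "q = k * (k - 1) div 2"
  have "Suc k * (Suc k - 1) = k * (k - 1) + k * 2" by (cases k) (simp_all add: algebra_simps)
  then have e: "Suc k * (Suc k - 1) div 2 = q + k" by (simp add: q_def)
  have m: "v ^ m = v ^ (m - k) * v ^ k" using k by (simp flip: power_add)
  have G: "gauss v (Suc m) (Suc k) = gauss v m (Suc k) + v ^ (m - k) * gauss v m k"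
    using gauss_Pascal(1)[OF v k] .
  show "serre_gauss_coeff v c (Suc m) (Suc k) =
      serre_gauss_coeff v c m (Suc k) - v ^ m * c * serre_gauss_coeff v c m k"
    unfolding serre_gauss_coeff_def e G q_def[symmetric] m
    by (simp add: algebra_simps power_add)
qed

lemma serre_sum_step:
  fixes v c :: "'k::field" and M :: "nat \<Rightarrow> ('g, 'k) free_alg"
  assumes v: "\<And>n. n > 0 \<Longrightarrow> v ^ n \<noteq> 1"
  shows "(\<Sum>k=0..Suc m. free_scalar (serre_gauss_coeff v c (Suc m) k) * M k) =
    (\<Sum>k=0..m. free_scalar (serre_gauss_coeff v c m k) * M k) -
    (\<Sum>k=0..m. free_scalar (v ^ m * c * serre_gauss_coeff v c m k) * M (Suc k))"
proof -
  let ?a = "serre_gauss_coeff v c"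
  have "(\<Sum>k=0..m. free_scalar (?a m k) * M k) = (\<Sum>k=0..Suc m. free_scalar (?a m k) * M k)"
    by (simp add: serre_gauss_coeff_Suc(3)[OF v])
  also have "\<dots> = free_scalar (?a m 0) * M 0 + (\<Sum>k=0..m. free_scalar (?a m (Suc k)) * M (Suc k))"
    by (rule sum.atLeast0_atMost_Suc_shift[unfolded comp_def])
  finally have 1: "(\<Sum>k=0..m. free_scalar (?a m k) * M k) =
      free_scalar (?a m 0) * M 0 + (\<Sum>k=0..m. free_scalar (?a m (Suc k)) * M (Suc k))" .
  have "(\<Sum>k=0..Suc m. free_scalar (?a (Suc m) k) * M k) =
      free_scalar (?a (Suc m) 0) * M 0 + (\<Sum>k=0..m. free_scalar (?a (Suc m) (Suc k)) * M (Suc k))"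
    by (rule sum.atLeast0_atMost_Suc_shift[unfolded comp_def])
  also have "(\<Sum>k=0..m. free_scalar (?a (Suc m) (Suc k)) * M (Suc k)) =
      (\<Sum>k=0..m. free_scalar (?a m (Suc k)) * M (Suc k) - free_scalar (v ^ m * c * ?a m k) * M (Suc k))"
    by (intro sum.cong refl) (simp add: serre_gauss_coeff_Suc(2)[OF v] free_scalar_diff left_diff_distrib)
  finally show ?thesis
    by (simp add: 1 serre_gauss_coeff_Suc(1)[OF v] sum_subtractf)
qed

lemma free_qserre_expansion:
  fixes v c :: "'k::field" and x y :: "('g, 'k) free_alg"
  assumes v: "\<And>n. n > 0 \<Longrightarrow> v ^ n \<noteq> 1"
  shows "k_algebra.qserre free_algebra v c x y m =
    (\<Sum>k=0..m. free_scalar (serre_gauss_coeff v c m k) * (x ^ (m - k) * y * x ^ k))"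
proof (induct m)
  case 0
  show ?case by (simp add: serre_gauss_coeff_def gauss_zero[OF v] Free.qserre.simps)
next
  case (Suc m)
  have p: "x * x ^ (m - k) = x ^ (Suc m - k)" if "k \<le> m" for k
    using that by (simp add: Suc_diff_le)
  have "k_algebra.qserre free_algebra v c x y (Suc m) =
      x * (\<Sum>k=0..m. free_scalar (serre_gauss_coeff v c m k) * (x ^ (m - k) * y * x ^ k)) -
      free_scalar (v ^ m * c) * ((\<Sum>k=0..m. free_scalar (serre_gauss_coeff v c m k) * (x ^ (m - k) * y * x ^ k)) * x)"
    by (simp add: Free.qserre.simps Free.skew_comm_def Suc free_scalar_minus)
  also have "\<dots> = (\<Sum>k=0..m. free_scalar (serre_gauss_coeff v c m k) * (x ^ (Suc m - k) * y * x ^ k)) -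
      (\<Sum>k=0..m. free_scalar (v ^ m * c * serre_gauss_coeff v c m k) * (x ^ (Suc m - Suc k) * y * x ^ Suc k))"
    unfolding sum_distrib_left sum_distrib_right
    by (intro arg_cong2[of _ _ _ _ "(-)"] sum.cong refl)
      (simp_all add: free_scalar_left_commute[of x] mult.assoc power_commutes flip: p)
  finally show ?case by (simp only: serre_sum_step[OF v])
qed

lemma free_qserre_opp_expansion:
  fixes v c :: "'k::field" and x y :: "('g, 'k) free_alg"
  assumes v: "\<And>n. n > 0 \<Longrightarrow> v ^ n \<noteq> 1"
  shows "k_algebra.qserre (k_algebra.opp free_algebra) v c x y m =
    (\<Sum>k=0..m. free_scalar (serre_gauss_coeff v c m k) * (x ^ k * y * x ^ (m - k)))"
proof -
  interpret opp: k_algebra "k_algebra.opp free_algebra :: ('k, ('g, 'k) free_alg) module"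
    by (rule Free.k_algebra_opp)
  show ?thesis
  proof (induct m)
    case 0
    show ?case by (simp add: serre_gauss_coeff_def gauss_zero[OF v])
  next
    case (Suc m)
    have p: "x ^ (m - k) * x = x ^ (Suc m - k)" if "k \<le> m" for k
      using that by (simp add: Suc_diff_le power_commutes)
    have "opp.qserre v c x y (Suc m) =
        (\<Sum>k=0..m. free_scalar (serre_gauss_coeff v c m k) * (x ^ k * y * x ^ (m - k))) * x -
        free_scalar (v ^ m * c) * (x * (\<Sum>k=0..m. free_scalar (serre_gauss_coeff v c m k) * (x ^ k * y * x ^ (m - k))))"
      by (simp add: opp.skew_comm_def Suc free_scalar_minus)
    also have "\<dots> = (\<Sum>k=0..m. free_scalar (serre_gauss_coeff v c m k) * (x ^ k * y * x ^ (Suc m - k))) -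
        (\<Sum>k=0..m. free_scalar (v ^ m * c * serre_gauss_coeff v c m k) * (x ^ Suc k * y * x ^ (Suc m - Suc k)))"
      unfolding sum_distrib_left sum_distrib_right
      by (intro arg_cong2[of _ _ _ _ "(-)"] sum.cong refl)
        (simp_all add: free_scalar_left_commute[of x] mult.assoc flip: p)
    finally show ?case by (simp only: serre_sum_step[OF v])
  qed
qed


section \<open>The parameters\<close>

lemma k_algebra_ground: "k_algebra (ground_algebra :: ('k::field, 'k) module)"
proof (rule k_algebraI)
  show "ring (ground_algebra :: ('k, 'k) module)"
  proof (rule ringI)
    show "abelian_group (ground_algebra :: ('k, 'k) module)"
    proof (rule abelian_groupI)
      fix x :: 'k
      show "\<exists>y\<in>carrier ground_algebra. y \<oplus>\<^bsub>ground_algebra\<^esub> x = \<zero>\<^bsub>ground_algebra\<^esub>"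
        by (rule bexI[of _ "- x"]) (simp_all add: ground_algebra_def)
    qed (simp_all add: ground_algebra_def algebra_simps)
    show "Group.monoid (ground_algebra :: ('k, 'k) module)"
      by (rule monoidI) (simp_all add: ground_algebra_def algebra_simps)
  qed (simp_all add: ground_algebra_def algebra_simps)
qed (simp_all add: ground_algebra_def algebra_simps)

locale two_parameter =
  fixes a :: "'i::{finite,linorder} \<Rightarrow> 'i \<Rightarrow> int" and d :: "'i \<Rightarrow> nat" and r s :: "'k::field_char_0"
  assumes a_diag: "\<And>i. a i i = 2" and a_neg: "\<And>i j. i \<noteq> j \<Longrightarrow> a i j \<le> 0"
    and d_pos: "\<And>i. d i > 0" and d_symm: "\<And>i j. int (d i) * a i j = int (d j) * a j i"
    and r_nonzero: "r \<noteq> 0" and s_nonzero: "s \<noteq> 0"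
    and not_root: "\<And>n::nat. n > 0 \<Longrightarrow> (r / s) ^ n \<noteq> 1"
begin

abbreviation "eul \<equiv> euler a d"

definition v :: "'i \<Rightarrow> 'k" where "v i = r ^ d i / s ^ d i"

text \<open>The scalar by which \<open>\<omega>\<^sub>i\<close> acts on \<open>e\<^sub>j\<close> by conjugation; \<open>\<omega>\<^sub>i'\<close> acts by \<open>chi j i\<inverse>\<close>.\<close>

definition chi :: "'i \<Rightarrow> 'i \<Rightarrow> 'k" where
  "chi i j = r powi eul j i * s powi (- eul i j)"

definition kappa :: "'i \<Rightarrow> 'k" where "kappa i = 1 / (r ^ d i - s ^ d i)"

definition serre_len :: "'i \<Rightarrow> 'i \<Rightarrow> nat" where "serre_len i j = nat (1 - a i j)"

lemma v_not_root: "n > 0 \<Longrightarrow> v i ^ n \<noteq> 1"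
  using not_root[of "d i * n"] d_pos[of i] by (simp add: v_def power_mult flip: power_divide)

lemma v_nonzero [simp]: "v i \<noteq> 0"
  using r_nonzero s_nonzero by (simp add: v_def)

lemma chi_nonzero [simp]: "chi i j \<noteq> 0"
  using r_nonzero s_nonzero by (simp add: chi_def power_int_not_zero)

lemma kappa_nonzero [simp]: "kappa i \<noteq> 0"
proof -
  have "v i \<noteq> 1" using v_not_root[of 1 i] by simp
  then show ?thesis using s_nonzero by (auto simp: kappa_def v_def)
qed

lemma chi_diag: "chi i i = v i"
  by (simp add: chi_def v_def euler_def power_int_minus field_simps)

lemma chi_inverse: "1 / chi i j = r powi (- eul j i) * s powi eul i j"
  by (simp add: chi_def power_int_minus field_simps)

lemma serre_len_pos: "i \<noteq> j \<Longrightarrow> serre_len i j > 0"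
  using a_neg[of i j] by (simp add: serre_len_def)

text \<open>The relation between the scalars and the length of the Serre relation on which every
  cancellation in the Serre elements rests; it holds because \<open>\<langle>i, j\<rangle> + \<langle>j, i\<rangle> = d\<^sub>i a\<^sub>i\<^sub>j\<close> and \<open>v i\<close> is the \<open>d\<^sub>i\<close>-th power of \<open>r / s\<close>.\<close>

lemma chi_zeta: assumes ij: "i \<noteq> j" shows "v i ^ (serre_len i j - 1) * (chi i j * chi j i) = 1"
proof -
  define n where "n = nat (- a i j)"
  have n: "serre_len i j - 1 = n" "a i j = - int n" using a_neg[OF ij] by (simp_all add: n_def serre_len_def)
  have e: "eul i j + eul j i = - int (d i * n)"
    using ij d_symm[of i j] n by (cases "i < j") (auto simp: euler_def)
  have "chi i j * chi j i = r powi (eul j i + eul i j) * s powi (- (eul i j + eul j i))"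
    using r_nonzero s_nonzero by (simp add: chi_def power_int_add power_int_minus power_int_diff field_simps)
  also have "\<dots> = r powi (- int (d i * n)) * s powi int (d i * n)"
    using e by (simp add: add.commute)
  also have "\<dots> = 1 / v i ^ n"
    unfolding power_int_minus power_int_of_nat v_def
    by (simp add: power_divide field_simps flip: power_mult)
  finally show ?thesis by (simp only: n) simp
qed

lemma serre_coeff_eq: "k \<le> serre_len i j \<Longrightarrow> serre_coeff a d r s i j k = serre_gauss_coeff (v i) (chi i j) (serre_len i j) k"
proof -
  assume k: "k \<le> serre_len i j"
  have 1: "r powi (int k * eul j i) * s powi (- (int k * eul i j)) = chi i j ^ k"
    by (simp add: chi_def power_mult_distrib power_int_mult mult.commute[of "int k"] flip: mult_minus_left)
  have "serre_coeff a d r s i j k = (- 1) ^ k * qbinomial (v i) (serre_len i j) k *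
      (v i ^ (k * (k - 1) div 2) * (r powi (int k * eul j i) * s powi (- (int k * eul i j))))"
    unfolding serre_coeff_def v_def serre_len_def by (simp only: mult.assoc)
  then show ?thesis
    using k by (simp only: 1 serre_gauss_coeff_def gauss_def if_True)
qed

section \<open>Operators on the free algebra of the positive part\<close>

definition diag :: "('i \<Rightarrow> 'k) \<Rightarrow> ('i, 'k) free_alg \<Rightarrow> ('i, 'k) free_alg" where
  "diag g = Free.free_hom (\<lambda>l. free_scalar (g l) * free_gen l)"

lemma diag_simps [simp]:
  "diag g (x + y) = diag g x + diag g y" "diag g (x * y) = diag g x * diag g y" "diag g 1 = 1"
  "diag g (free_scalar c * x) = free_scalar c * diag g x" "diag g (free_gen l) = free_scalar (g l) * free_gen l"
  "diag g 0 = 0"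
  unfolding diag_def
  by (rule Free.free_hom_add Free.free_hom_mult Free.free_hom_one Free.free_hom_smult Free.free_hom_gen
      Free.free_hom_zero; simp)+

lemma diag_scalar [simp]: "diag g (free_scalar c) = free_scalar c"
  using diag_simps(4)[of g c 1] unfolding mult_1_right diag_simps(3) .

lemma free_gen_scalar [simp]: "free_gen l * (free_scalar c * x) = free_scalar c * (free_gen l * x)"
  by (rule free_scalar_left_commute)

lemma diag_diag: "diag g (diag h x) = diag (\<lambda>l. g l * h l) x"
  by (induct x rule: free_alg_induct) (simp_all add: distrib_left mult.assoc mult.commute)

lemma diag_one: "diag (\<lambda>l. 1) x = x"
  by (induct x rule: free_alg_induct) simp_all

abbreviation "Om i \<equiv> diag (chi i)"
abbreviation "Om' i \<equiv> diag (\<lambda>l. 1 / chi l i)"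

text \<open>The rule \<open>F l (e\<^sub>k t) = e\<^sub>k F l t + \<delta>\<^sub>k\<^sub>l \<omega>\<^sub>l' t\<close> as a recursion on words. It is the product rule for
  \<open>\<Delta> f\<^sub>l = 1 \<otimes> f\<^sub>l + f\<^sub>l \<otimes> \<omega>\<^sub>l'\<close>.\<close>

primrec deriv_word :: "'i \<Rightarrow> 'i list \<Rightarrow> ('i, 'k) free_alg" where
  "deriv_word l [] = 0"
| "deriv_word l (k # w) = free_gen k * deriv_word l w +
     (if k = l then Om' l (Poly_Mapping.single (Word w) 1) else 0)"

definition F :: "'i \<Rightarrow> ('i, 'k) free_alg \<Rightarrow> ('i, 'k) free_alg" where
  "F l = lin_ext free_algebra (\<lambda>w. deriv_word l (letters w))"

definition E :: "'i \<Rightarrow> ('i, 'k) free_alg \<Rightarrow> ('i, 'k) free_alg" where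
  "E i t = free_scalar (kappa i) * (free_gen i * t - Om i t * free_gen i)"

lemma F_add [simp]: "F l (x + y) = F l x + F l y"
  unfolding F_def by (rule Free.lin_ext_add) simp

lemma F_scalar [simp]: "F l (free_scalar c * x) = free_scalar c * F l x"
  unfolding F_def free_scalar_def mult_map_scale_conv_mult[symmetric]
  by (subst Free.lin_ext_smult) (simp_all add: free_scalar_def mult_map_scale_conv_mult)

lemma F_zero [simp]: "F l 0 = 0"
  using F_scalar[of l 0 0] by simp

lemma F_word: "F l (Poly_Mapping.single (Word w) c) = free_scalar c * deriv_word l w"
  unfolding F_def by (subst Free.lin_ext_single) simp_all

lemma F_one [simp]: "F l 1 = 0"
  using F_word[of l "[]" 1] by (simp add: zero_free_monoid_def[symmetric])

lemma F_gen_mult [simp]: "F l (free_gen k * t) = free_gen k * F l t + (if k = l then Om' l t else 0)"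
proof -
  have "Poly_Mapping.keys t \<subseteq> UNIV" by simp
  then show ?thesis
  proof (induct t rule: poly_mapping_span_induct)
    case (single u c)
    obtain w where w: "u = Word w" by (cases u)
    have 1: "free_gen k * Poly_Mapping.single (Word w) c = Poly_Mapping.single (Word (k # w)) c"
      by (simp add: free_gen_def mult_single plus_free_monoid_def)
    have 2: "Poly_Mapping.single (Word w) c = free_scalar c * Poly_Mapping.single (Word w) 1"
      by (simp add: free_scalar_def mult_single)
    have 3: "Om' l (Poly_Mapping.single (Word w) c) = free_scalar c * Om' l (Poly_Mapping.single (Word w) 1)"
      by (subst 2) (rule diag_simps(4))
    show ?case
      unfolding w 1 F_word 3 by (simp add: distrib_left)
  qed (simp_all add: distrib_left)
qed

lemma F_gen: "F l (free_gen k) = (if k = l then 1 else 0)"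
  using F_gen_mult[of l k 1] by (simp del: F_gen_mult)

lemma F_mult: "F l (x * y) = x * F l y + F l x * Om' l y"
proof (induct x rule: free_alg_induct)
  case (smult c x)
  then show ?case by (simp add: mult.assoc distrib_left)
next
  case (gen k x)
  then show ?case by (simp add: mult.assoc distrib_left distrib_right)
qed (simp_all add: distrib_right add_ac)

lemma F_diag: "F l (diag g t) = free_scalar (g l) * diag g (F l t)"
proof (induct t rule: free_alg_induct)
  case (gen k x)
  have "diag (\<lambda>m. 1 / chi m l) (diag g x) = diag g (Om' l x)" by (simp add: diag_diag mult.commute)
  then show ?case
    by (simp add: gen distrib_left mult.assoc) (simp add: mult.commute)
qed (simp_all add: distrib_left mult.commute)

lemma diff_by_add:
  fixes P :: "('i, 'k) free_alg \<Rightarrow> 'b::ab_group_add"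
  assumes "\<And>x y. P (x + y) = P x + P y"
  shows "P (x - y) = P x - P y"
  unfolding eq_diff_eq using assms[of "x - y" y, symmetric] by (simp only: diff_add_cancel)

lemma F_diff [simp]: "F l (x - y) = F l x - F l y" by (rule diff_by_add) simp
lemma diag_diff [simp]: "diag g (x - y) = diag g x - diag g y" by (rule diff_by_add) simp

lemma F_minus [simp]: "F l (- x) = - F l x" using F_diff[of l 0 x] by simp
lemma diag_minus [simp]: "diag g (- x) = - diag g x" using diag_diff[of g 0 x] by simp

lemma E_add [simp]: "E i (x + y) = E i x + E i y"
  by (simp add: E_def algebra_simps)

lemma E_scalar [simp]: "E i (free_scalar c * x) = free_scalar c * E i x"
  by (simp add: E_def right_diff_distrib mult.assoc mult.commute[of c])

lemma E_zero [simp]: "E i 0 = 0" and E_one [simp]: "E i 1 = 0"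
  by (simp_all add: E_def)

lemma E_diff [simp]: "E i (x - y) = E i x - E i y" by (rule diff_by_add) simp

lemma diag_E: "diag g (E i t) = free_scalar (g i) * E i (diag g t)"
proof -
  have "diag g (Om i t) = Om i (diag g t)" by (simp add: diag_diag mult.commute)
  then show ?thesis
    by (simp add: E_def right_diff_distrib mult.assoc free_scalar_left_commute[of "Om i (diag g t)"])
      (simp add: mult.commute)
qed

text \<open>The terms in which \<open>F j\<close> does not hit the outer letter cancel, because \<open>\<omega>\<^sub>i\<close> passes \<open>F j\<close> with the
  same scalar with which \<open>\<omega>\<^sub>j'\<close> passes \<open>e\<^sub>i\<close>.\<close>

lemma E_F: "E i (F j t) - F j (E i t) = (if i = j then free_scalar (kappa i) * (Om i t - Om' i t) else 0)"
proof -
  have 1: "F j (Om i t * free_gen i) = free_scalar (1 / chi i j) * (F j (Om i t) * free_gen i) +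
      (if i = j then Om i t else 0)"
    by (simp add: F_mult F_gen free_scalar_left_commute add.commute)
  have 2: "Om i (F j t) = free_scalar (1 / chi i j) * F j (Om i t)"
    by (simp add: F_diag)
  show ?thesis
    by (simp add: E_def 1 2 right_diff_distrib distrib_left mult.assoc)
qed

lemma E_mult: "E i (x * y) = E i x * y + Om i x * E i y"
  by (simp add: E_def algebra_simps free_scalar_left_commute[of "Om i x"])

subsection \<open>The algebra of linear operators\<close>

definition linear_op :: "(('i, 'k) free_alg \<Rightarrow> ('i, 'k) free_alg) \<Rightarrow> bool" where
  "linear_op P \<longleftrightarrow> (\<forall>x y. P (x + y) = P x + P y) \<and> (\<forall>c x. P (free_scalar c * x) = free_scalar c * P x)"

definition endo :: "('k, ('i, 'k) free_alg \<Rightarrow> ('i, 'k) free_alg) module" where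
  "endo = \<lparr>carrier = Collect linear_op, monoid.mult = (\<lambda>P Q x. P (Q x)), one = (\<lambda>x. x),
     ring.zero = (\<lambda>x. 0), add = (\<lambda>P Q x. P x + Q x), module.smult = (\<lambda>c P x. free_scalar c * P x)\<rparr>"

lemma endo_simps:
  "carrier endo = Collect linear_op" "monoid.mult endo = (\<lambda>P Q x. P (Q x))" "one endo = (\<lambda>x. x)"
  "ring.zero endo = (\<lambda>x. 0)" "add endo = (\<lambda>P Q x. P x + Q x)"
  "module.smult endo = (\<lambda>c P x. free_scalar c * P x)"
  by (simp_all add: endo_def)

lemma linear_op_minus: "linear_op P \<Longrightarrow> linear_op (\<lambda>x. - P x)"
  by (simp add: linear_op_def)

lemma k_algebra_endo: "k_algebra endo"
proof (rule k_algebraI)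
  show "ring endo"
  proof (rule ringI)
    show "abelian_group endo"
    proof (rule abelian_groupI)
      fix P assume "P \<in> carrier endo"
      then show "\<exists>Q\<in>carrier endo. Q \<oplus>\<^bsub>endo\<^esub> P = \<zero>\<^bsub>endo\<^esub>"
        by (intro bexI[of _ "\<lambda>x. - P x"]) (simp_all add: endo_simps linear_op_minus)
    qed (auto simp: endo_simps linear_op_def algebra_simps)
    show "Group.monoid endo"
      by (rule monoidI) (auto simp: endo_simps linear_op_def)
  qed (auto simp: endo_simps linear_op_def)
qed (auto simp: endo_simps linear_op_def free_scalar_add algebra_simps intro!: ext)

interpretation endo: k_algebra endo by (rule k_algebra_endo)

text \<open>The operators of the action, before passing to the quotient \<open>U\<^sup>+\<close> of the free algebra.\<close>

fun gen_op :: "'i generator \<Rightarrow> ('i, 'k) free_alg \<Rightarrow> ('i, 'k) free_alg" where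
  "gen_op (Gen_e i) = E i"
| "gen_op (Gen_f i) = F i"
| "gen_op (Gen_om i) = Om i"
| "gen_op (Gen_om_inv i) = diag (\<lambda>l. 1 / chi i l)"
| "gen_op (Gen_om' i) = Om' i"
| "gen_op (Gen_om_inv' i) = diag (\<lambda>l. chi l i)"

lemma linear_ops: "linear_op (E i)" "linear_op (F i)" "linear_op (diag g)" "linear_op (gen_op q)"
  by (auto simp: linear_op_def) (cases q; simp)+

lemma gen_op_carrier: "gen_op q \<in> carrier endo"
  by (simp add: endo_simps linear_ops)

definition rho :: "('i generator, 'k) free_alg \<Rightarrow> ('i, 'k) free_alg \<Rightarrow> ('i, 'k) free_alg" where
  "rho = endo.free_hom gen_op"

lemma rho_hom: "rho \<in> algebra_hom free_algebra endo"
  unfolding rho_def by (rule endo.free_hom_hom[OF gen_op_carrier])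

lemma rho_linear: "linear_op (rho x)"
  using endo.free_hom_closed[of gen_op x, OF gen_op_carrier] by (simp add: rho_def endo_simps)

lemma rho_simps [simp]:
  "rho (x + y) t = rho x t + rho y t" "rho (x * y) t = rho x (rho y t)" "rho 1 t = t"
  "rho (free_scalar c * x) t = free_scalar c * rho x t" "rho (free_gen q) = gen_op q" "rho 0 t = 0"
  using fun_cong[OF endo.free_hom_add[of gen_op x y, OF gen_op_carrier], of t]
    fun_cong[OF endo.free_hom_mult[of gen_op x y, OF gen_op_carrier], of t]
    fun_cong[OF endo.free_hom_one[of gen_op, OF gen_op_carrier], of t]
    fun_cong[OF endo.free_hom_smult[of gen_op c x, OF gen_op_carrier], of t]
    endo.free_hom_gen[of gen_op q, OF gen_op_carrier] fun_cong[OF endo.free_hom_zero[of gen_op, OF gen_op_carrier], of t]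
  by (simp_all only: endo_simps rho_def)

lemma rho_diff [simp]: "rho (x - y) t = rho x t - rho y t"
  using rho_simps(1)[of "x - y" y t] by (simp del: rho_simps)

lemma rho_arg [simp]: "rho x (t + t') = rho x t + rho x t'" "rho x (free_scalar c * t) = free_scalar c * rho x t"
  using rho_linear[of x] by (auto simp: linear_op_def)

lemma rho_arg_diff [simp]: "rho x (t - t') = rho x t - rho x t'" by (rule diff_by_add) simp
lemma rho_arg_zero [simp]: "rho x 0 = 0" using rho_arg(2)[of x 0 0] by (simp del: rho_arg)

subsection \<open>The Serre relations as operators\<close>

abbreviation "gE i \<equiv> (free_gen (Gen_e i) :: ('i generator, 'k) free_alg)"
abbreviation "gF i \<equiv> (free_gen (Gen_f i) :: ('i generator, 'k) free_alg)"

definition serre_e :: "'i \<Rightarrow> 'i \<Rightarrow> ('i generator, 'k) free_alg" where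
  "serre_e i j = (\<Sum>k=0..nat (1 - a i j). free_scalar (serre_coeff a d r s i j k) *
       (gE i ^ (nat (1 - a i j) - k) * gE j * gE i ^ k))"

definition serre_f :: "'i \<Rightarrow> 'i \<Rightarrow> ('i generator, 'k) free_alg" where
  "serre_f i j = (\<Sum>k=0..nat (1 - a i j). free_scalar (serre_coeff a d r s i j k) *
       (gF i ^ k * gF j * gF i ^ (nat (1 - a i j) - k)))"

lemma serre_e_qserre: "serre_e i j = Free.qserre (v i) (chi i j) (gE i) (gE j) (serre_len i j)"
  by (simp add: free_qserre_expansion[OF v_not_root] serre_e_def serre_coeff_eq flip: serre_len_def)

lemma serre_f_qserre: "serre_f i j = k_algebra.qserre Free.opp (v i) (chi i j) (gF i) (gF j) (serre_len i j)"
  by (simp add: free_qserre_opp_expansion[OF v_not_root] serre_f_def serre_coeff_eq flip: serre_len_def)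

lemma algebra_hom_opp:
  assumes "k_algebra A" "k_algebra B" "h \<in> algebra_hom A B"
  shows "h \<in> algebra_hom (k_algebra.opp A) (k_algebra.opp B)"
  by (rule algebra_homI)
    (simp_all add: k_algebra.opp_simps[OF assms(1)] k_algebra.opp_simps[OF assms(2)] algebra_homD[OF assms(3)])

lemma rho_serre_e: "rho (serre_e i j) = endo.qserre (v i) (chi i j) (E i) (E j) (serre_len i j)"
  unfolding serre_e_qserre
  using Free.hom_qserre[OF k_algebra_endo rho_hom, of "gE i" "gE j"] by simp

lemma rho_serre_f: "rho (serre_f i j) = k_algebra.qserre endo.opp (v i) (chi i j) (F i) (F j) (serre_len i j)"
  unfolding serre_f_qserre
  using k_algebra.hom_qserre[OF Free.k_algebra_opp endo.k_algebra_opp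
      algebra_hom_opp[OF k_algebra_free k_algebra_endo rho_hom], of "gF i" "gF j"] by simp

definition left_op :: "'i \<Rightarrow> ('i, 'k) free_alg \<Rightarrow> ('i, 'k) free_alg" where
  "left_op l t = free_gen l * t"

lemma left_op_carrier: "left_op l \<in> carrier endo"
  by (simp add: endo_simps linear_op_def left_op_def distrib_left)

text \<open>The Serre operator of the skew derivations kills the unit and commutes with left
  multiplications, hence vanishes. The commutator of \<open>F l\<close> with the left multiplication by \<open>e\<^sub>l\<close> has only
  one Cartan part, so the first of the two parts is zero.\<close>

lemma rho_serre_f_zero:
  assumes ij: "i \<noteq> j"
  shows "rho (serre_f i j) t = 0"
proof -
  interpret opp: k_algebra endo.opp by (rule endo.k_algebra_opp)
  define S where "S = opp.qserre (v i) (chi i j) (F i) (F j)"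
  have c: "F i \<in> carrier endo.opp" for i by (simp add: endo_simps linear_ops)
  have Z: "(\<lambda>x. 0) \<in> carrier endo.opp" by (simp add: endo_simps linear_op_def)
  have L: "left_op l \<in> carrier endo.opp" for l using left_op_carrier by simp
  let ?W = "\<lambda>m x. - Om' m x"
  have W: "?W m \<in> carrier endo.opp" for m by (simp add: endo_simps linear_op_def)
  have FL: "F p \<otimes>\<^bsub>endo.opp\<^esub> left_op l = left_op l \<otimes>\<^bsub>endo.opp\<^esub> F p" if "l \<noteq> p" for l p
    using that by (intro ext) (simp add: endo_simps left_op_def)
  have FL': "F l \<otimes>\<^bsub>endo.opp\<^esub> left_op l = left_op l \<otimes>\<^bsub>endo.opp\<^esub> F l \<oplus>\<^bsub>endo.opp\<^esub> ((\<lambda>x. 0) \<oplus>\<^bsub>endo.opp\<^esub> ?W l)" for l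
    by (intro ext) (simp add: endo_simps left_op_def)
  have WF: "?W m \<otimes>\<^bsub>endo.opp\<^esub> F q = (1 / chi q m) \<odot>\<^bsub>endo.opp\<^esub> (F q \<otimes>\<^bsub>endo.opp\<^esub> ?W m)" for q m
    by (intro ext) (simp add: endo_simps F_diag)
  have ZF: "(\<lambda>x. 0) \<otimes>\<^bsub>endo.opp\<^esub> F q = e \<odot>\<^bsub>endo.opp\<^esub> (F q \<otimes>\<^bsub>endo.opp\<^esub> (\<lambda>x. 0))" for q e
    by (intro ext) (simp add: endo_simps)
  have Z0: "(\<lambda>x. 0) = \<zero>\<^bsub>endo.opp\<^esub>" by (simp add: endo_simps)
  note zeta = serre_len_pos[OF ij] chi_zeta[OF ij]
  have comm: "S (serre_len i j) \<otimes>\<^bsub>endo.opp\<^esub> left_op l = left_op l \<otimes>\<^bsub>endo.opp\<^esub> S (serre_len i j)" for l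
  proof -
    consider "l = j" | "l = i" | "l \<noteq> i" "l \<noteq> j" by blast
    then show ?thesis
    proof cases
      case 1
      show ?thesis
        unfolding S_def 1
        by (rule opp.qserre_commutes_second[OF c c L Z W[of j] FL[OF ij[symmetric]] FL' ZF WF chi_nonzero zeta])
    next
      case 2
      show ?thesis
        unfolding S_def 2
        by (rule opp.qserre_commutes_first[OF c c L Z W[of i] FL' FL[OF ij] ZF ZF WF[of i i, unfolded chi_diag]
              WF v_nonzero chi_nonzero zeta])
    next
      case 3
      have "F i \<otimes>\<^bsub>endo.opp\<^esub> left_op l =
          left_op l \<otimes>\<^bsub>endo.opp\<^esub> F i \<oplus>\<^bsub>endo.opp\<^esub> ((\<lambda>x. 0) \<oplus>\<^bsub>endo.opp\<^esub> (\<lambda>x. 0))"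
        using 3 by (intro ext) (simp add: endo_simps left_op_def)
      from opp.qserre_commutes_first[OF c c L Z Z this FL[OF 3(2)] ZF ZF ZF ZF v_nonzero chi_nonzero zeta]
      show ?thesis unfolding S_def .
    qed
  qed
  have S_lin: "linear_op (S m)" for m
    using opp.qserre_closed[OF c c, of "v i" "chi i j" i j m] by (simp add: S_def endo_simps)
  have one: "S m 1 = 0" for m
  proof (induct m)
    case (Suc m)
    have "S m 0 = 0" using S_lin[of m, unfolded linear_op_def] by (metis free_scalar_simps(1) mult_zero_left)
    then show ?case using Suc by (simp add: S_def opp.skew_comm_def endo_simps)
  qed (simp add: S_def)
  have "S (serre_len i j) t = 0"
  proof (induct t rule: free_alg_induct)
    case (gen l x)
    then show ?case using fun_cong[OF comm[of l], of x] by (simp add: endo_simps left_op_def)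
  qed (use S_lin[of "serre_len i j"] one in \<open>simp_all add: linear_op_def\<close>)
  then show ?thesis by (simp add: rho_serre_f S_def)
qed

text \<open>The commutator of \<open>E l\<close> and \<open>F l\<close> has the two Cartan parts \<open>\<omega>\<^sub>l\<close> and \<open>- \<omega>\<^sub>l'\<close>, up to a scalar.\<close>

lemma rho_serre_e_F:
  assumes ij: "i \<noteq> j"
  shows "rho (serre_e i j) (F l t) = F l (rho (serre_e i j) t)"
proof -
  define S where "S = endo.qserre (v i) (chi i j) (E i) (E j)"
  have c: "E i \<in> carrier endo" "F i \<in> carrier endo" for i by (simp_all add: endo_simps linear_ops)
  let ?W = "\<lambda>e g x. free_scalar e * diag g x"
  have W: "?W e g \<in> carrier endo" for e g
    by (simp add: endo_simps linear_op_def distrib_left mult.commute)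
  have Z: "(\<lambda>x. 0) \<in> carrier endo" by (simp add: endo_simps linear_op_def)
  have EF: "E p \<otimes>\<^bsub>endo\<^esub> F l = F l \<otimes>\<^bsub>endo\<^esub> E p" if "l \<noteq> p" for p l
    using E_F[of p l] that by (intro ext) (simp add: endo_simps)
  have EF': "E l \<otimes>\<^bsub>endo\<^esub> F l = F l \<otimes>\<^bsub>endo\<^esub> E l \<oplus>\<^bsub>endo\<^esub> (?W (kappa l) (chi l) \<oplus>\<^bsub>endo\<^esub> ?W (- kappa l) (\<lambda>m. 1 / chi m l))" for l
  proof
    fix t
    show "(E l \<otimes>\<^bsub>endo\<^esub> F l) t = (F l \<otimes>\<^bsub>endo\<^esub> E l \<oplus>\<^bsub>endo\<^esub> (?W (kappa l) (chi l) \<oplus>\<^bsub>endo\<^esub> ?W (- kappa l) (\<lambda>m. 1 / chi m l))) t"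
      using E_F[of l l t] by (simp add: endo_simps free_scalar_minus right_diff_distrib diff_eq_eq add.commute)
  qed
  have WE: "?W e g \<otimes>\<^bsub>endo\<^esub> E q = g q \<odot>\<^bsub>endo\<^esub> (E q \<otimes>\<^bsub>endo\<^esub> ?W e g)" for q e g
    by (intro ext) (simp add: endo_simps diag_E mult.commute)
  have ZE: "(\<lambda>x. 0) \<otimes>\<^bsub>endo\<^esub> E q = e \<odot>\<^bsub>endo\<^esub> (E q \<otimes>\<^bsub>endo\<^esub> (\<lambda>x. 0))" for q e
    by (intro ext) (simp add: endo_simps)
  note zeta = serre_len_pos[OF ij] chi_zeta[OF ij]
  have "S (serre_len i j) \<otimes>\<^bsub>endo\<^esub> F l = F l \<otimes>\<^bsub>endo\<^esub> S (serre_len i j)"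
  proof -
    consider "l = j" | "l = i" | "l \<noteq> i" "l \<noteq> j" by blast
    then show ?thesis
    proof cases
      case 1
      show ?thesis
        unfolding S_def 1
        by (rule endo.qserre_commutes_second[OF c(1) c(1) c(2) W W EF[OF ij[symmetric]] EF' WE WE chi_nonzero zeta])
    next
      case 2
      show ?thesis
        unfolding S_def 2
        by (rule endo.qserre_commutes_first[OF c(1) c(1) c(2) W W EF' EF[OF ij]
              WE[of _ "chi i" i, unfolded chi_diag] WE
              WE[of _ "\<lambda>m. 1 / chi m i" i, unfolded chi_diag] WE v_nonzero chi_nonzero zeta])
    next
      case 3
      have "E i \<otimes>\<^bsub>endo\<^esub> F l = F l \<otimes>\<^bsub>endo\<^esub> E i \<oplus>\<^bsub>endo\<^esub> ((\<lambda>x. 0) \<oplus>\<^bsub>endo\<^esub> (\<lambda>x. 0))"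
        using fun_cong[OF EF[OF 3(1)]] by (intro ext) (simp add: endo_simps)
      from endo.qserre_commutes_first[OF c(1) c(1) c(2) Z Z this EF[OF 3(2)] ZE ZE ZE ZE v_nonzero chi_nonzero zeta]
      show ?thesis unfolding S_def .
    qed
  qed
  then show ?thesis by (simp add: rho_serre_e S_def endo_simps fun_eq_iff)
qed

end


section \<open>The algebra given by generators and relations\<close>

lemma ring_free: "ring (free_algebra :: ('k::field, ('g, 'k) free_alg) module)"
  by (rule k_algebra.axioms(2)[OF k_algebra_free])

lemma free_ideal_subset:
  fixes R :: "('g, 'k::field) free_alg set"
  assumes "R \<subseteq> Z" and "0 \<in> Z" and "\<And>x y. \<lbrakk>x \<in> Z; y \<in> Z\<rbrakk> \<Longrightarrow> x + y \<in> Z"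
    and left: "\<And>x y. y \<in> Z \<Longrightarrow> x * y \<in> Z" and "\<And>x y. y \<in> Z \<Longrightarrow> y * x \<in> Z"
  shows "Idl\<^bsub>free_algebra\<^esub> R \<subseteq> Z"
proof -
  note fs = free_algebra_def
  have "ideal Z free_algebra"
  proof (rule idealI[OF ring_free])
    have "abelian_group (free_algebra :: ('k, ('g, 'k) free_alg) module)"
      by (rule ring.axioms(1)[OF ring_free])
    then show "subgroup Z (add_monoid free_algebra)"
    proof (rule group.subgroupI[OF abelian_group.a_group])
      show "inv\<^bsub>add_monoid free_algebra\<^esub> x \<in> Z" if "x \<in> Z" for x
        using left[OF that, of "free_scalar (- 1)"] Free.neg_eq_sm[of x] by (simp add: a_inv_def)
    qed (use assms in \<open>auto simp: fs\<close>)
  qed (use assms in \<open>auto simp: fs\<close>)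
  then show ?thesis by (rule ring.genideal_minimal[OF ring_free _ assms(1)])
qed

text \<open>The kernel of \<open>h\<close> is an ideal containing \<open>R\<close>, so \<open>h\<close> is constant on cosets. Extensionality makes
  the induced map a unique function, not only unique on the carrier.\<close>

lemma presented_algebra_hom:
  fixes R :: "('g, 'k::field) free_alg set" and B :: "('k, 'b, 'n) module_scheme"
  assumes B: "k_algebra B" and h: "h \<in> algebra_hom free_algebra B" and R: "\<And>x. x \<in> R \<Longrightarrow> h x = \<zero>\<^bsub>B\<^esub>"
  shows "\<exists>h'. h' \<in> algebra_hom (presented_algebra R) B \<and> h' \<in> extensional (carrier (presented_algebra R)) \<and>
    (\<forall>x. h' (Idl\<^bsub>free_algebra\<^esub> R +>\<^bsub>free_algebra\<^esub> x) = h x)"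
proof -
  interpret B: k_algebra B by fact
  let ?J = "Idl\<^bsub>free_algebra\<^esub> R" and ?P = "presented_algebra R"
  let ?c = "\<lambda>x. ?J +>\<^bsub>free_algebra\<^esub> x"
  have UN: "x \<in> carrier free_algebra" for x :: "('g, 'k) free_alg" by (simp add: free_algebra_def)
  have J: "ideal ?J free_algebra" by (rule ring.genideal_ideal[OF ring_free]) (simp add: free_algebra_def)
  have ker: "?J \<subseteq> {x. h x = \<zero>\<^bsub>B\<^esub>}"
  proof (rule free_ideal_subset)
    show "0 \<in> {x. h x = \<zero>\<^bsub>B\<^esub>}"
      using algebra_hom_zero[OF k_algebra_free B h] by (simp add: free_algebra_def)
    show "x + y \<in> {x. h x = \<zero>\<^bsub>B\<^esub>}" if "x \<in> {x. h x = \<zero>\<^bsub>B\<^esub>}" "y \<in> {x. h x = \<zero>\<^bsub>B\<^esub>}" for x y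
      using that algebra_homD(3)[OF h UN UN, of x y] by (simp add: free_algebra_def)
    show "x * y \<in> {x. h x = \<zero>\<^bsub>B\<^esub>}" "y * x \<in> {x. h x = \<zero>\<^bsub>B\<^esub>}" if "y \<in> {x. h x = \<zero>\<^bsub>B\<^esub>}" for x y
      using that algebra_homD(2)[OF h UN UN, of x y] algebra_homD(2)[OF h UN UN, of y x]
        algebra_homD(1)[OF h UN, of x] by (simp_all add: free_algebra_def)
  qed (use R in auto)
  have eq: "h x = h y" if "?c x = ?c y" for x y
  proof -
    have "x \<ominus>\<^bsub>free_algebra\<^esub> y \<in> ?J" using that coset_eq_iff[OF k_algebra_free J UN UN] by blast
    then have "h (x \<ominus>\<^bsub>free_algebra\<^esub> y) = \<zero>\<^bsub>B\<^esub>" using ker by auto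
    then show ?thesis
      using algebra_hom_minus[OF k_algebra_free B h UN UN] algebra_homD(1)[OF h UN] by simp
  qed
  note qs = quotient_algebra_simps[OF k_algebra_free J, folded presented_algebra_def]
  define h' where "h' = restrict (\<lambda>C. h (SOME x. ?c x = C)) (carrier ?P)"
  have h': "h' (?c x) = h x" for x
  proof -
    have "?c (SOME x'. ?c x' = ?c x) = ?c x" by (rule someI[of _ x]) simp
    then have "h (SOME x'. ?c x' = ?c x) = h x" by (rule eq)
    moreover have "?c x \<in> carrier ?P" unfolding qs(1) using UN by (rule imageI)
    ultimately show ?thesis by (simp add: h'_def)
  qed
  have "h' \<in> algebra_hom ?P B"
    by (rule algebra_homI)
      (auto simp: qs UN h' algebra_homD[OF h])
  moreover have "h' \<in> extensional (carrier ?P)" by (simp add: h'_def)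
  ultimately show ?thesis using h' by blast
qed

context k_algebra
begin

lemma skew_comm_smult_both: 
  assumes "x \<in> carrier A" "y \<in> carrier A"
  shows "skew_comm t (k \<odot> x) (k' \<odot> y) = (k * k') \<odot> skew_comm t x y"
proof -
  have "skew_comm t (k \<odot> x) (k' \<odot> y) = (k * k') \<odot> (x \<otimes> y) \<oplus> (- t * (k * k')) \<odot> (y \<otimes> x)"
    unfolding skew_comm_def using assms
    by (simp only: sm_mult_left sm_mult_right sm_sm sm_closed m_closed mult.commute[of k' k])
  also have "- t * (k * k') = k * k' * - t" by (rule mult.commute)
  also have "(k * k') \<odot> (x \<otimes> y) \<oplus> (k * k' * - t) \<odot> (y \<otimes> x) = (k * k') \<odot> skew_comm t x y"
    unfolding skew_comm_def using assms by (simp only: sm_add_right sm_sm sm_closed m_closed)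
  finally show ?thesis .
qed

lemma qserre_smult: 
  assumes "x \<in> carrier A" "y \<in> carrier A"
  shows "qserre v c (k \<odot> x) (k' \<odot> y) m = (k ^ m * k') \<odot> qserre v c x y m"
  by (induct m) (use assms in \<open>simp_all add: skew_comm_smult_both mult.assoc\<close>)

end

context two_parameter
begin

abbreviation "U \<equiv> uq a d r s"
abbreviation "cl \<equiv> uq_class a d r s"

lemma relation_ideal: "ideal (Idl\<^bsub>free_algebra\<^esub> (uq_relations a d r s)) free_algebra"
  by (rule ring.genideal_ideal) (use k_algebra_free in \<open>auto simp: k_algebra_def free_algebra_def\<close>)

lemma k_algebra_U: "k_algebra U"
  unfolding uq_def presented_algebra_def by (rule k_algebra_quotient[OF k_algebra_free relation_ideal])

sublocale U: k_algebra "uq a d r s" by (rule k_algebra_U)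

lemma cl_hom: "cl \<in> algebra_hom free_algebra U"
  unfolding uq_def presented_algebra_def uq_class_def
  by (rule quotient_algebra_hom[OF k_algebra_free relation_ideal])

lemma cl_simps [simp]:
  "cl (x * y) = cl x \<otimes>\<^bsub>U\<^esub> cl y" "cl (x + y) = cl x \<oplus>\<^bsub>U\<^esub> cl y" "cl 1 = \<one>\<^bsub>U\<^esub>"
  "cl (free_scalar c * x) = c \<odot>\<^bsub>U\<^esub> cl x" "cl x \<in> carrier U"
  using algebra_homD[OF cl_hom, unfolded free_algebra_def, simplified] by auto

lemma cl_zero [simp]: "cl 0 = \<zero>\<^bsub>U\<^esub>"
  using algebra_hom_zero[OF k_algebra_free k_algebra_U cl_hom] by (simp add: free_algebra_def)

lemma cl_scalar [simp]: "cl (free_scalar c) = c \<odot>\<^bsub>U\<^esub> \<one>\<^bsub>U\<^esub>"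
  using cl_simps(4)[of c 1] by (simp del: cl_simps(4))

lemma cl_diff [simp]: "cl (x - y) = cl x \<ominus>\<^bsub>U\<^esub> cl y"
proof -
  have 1: "x - y = x + free_scalar (- 1) * y" by (simp add: free_scalar_minus)
  show ?thesis unfolding 1 cl_simps by (simp add: U.minus_eq_sm)
qed

lemma U_cases: assumes "u \<in> carrier U" obtains x where "u = cl x"
  using assms quotient_algebra_simps(1)[OF k_algebra_free relation_ideal]
  by (auto simp: uq_def presented_algebra_def uq_class_def)

lemma cl_eq_zero: "cl x = \<zero>\<^bsub>U\<^esub> \<longleftrightarrow> x \<in> Idl\<^bsub>free_algebra\<^esub> (uq_relations a d r s)"
proof -
  have "cl x = cl 0 \<longleftrightarrow> x \<ominus>\<^bsub>free_algebra\<^esub> 0 \<in> Idl\<^bsub>free_algebra\<^esub> (uq_relations a d r s)"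
    unfolding uq_class_def by (rule coset_eq_iff[OF k_algebra_free relation_ideal]) (simp_all add: free_algebra_def)
  moreover have "x \<ominus>\<^bsub>free_algebra\<^esub> 0 = x"
    using Free.minus_eq_sm[of x 0] by (simp add: free_algebra_def)
  ultimately show ?thesis by simp
qed

lemma cl_relation: "x \<in> uq_relations a d r s \<Longrightarrow> cl x = \<zero>\<^bsub>U\<^esub>"
  using ring.genideal_self[of free_algebra "uq_relations a d r s"] k_algebra_free
  by (auto simp: cl_eq_zero k_algebra_def free_algebra_def)

subsection \<open>The positive part as a quotient of the free algebra\<close>

definition incl :: "('i, 'k) free_alg \<Rightarrow> ('i generator, 'k) free_alg" where
  "incl = Free.free_hom gE"

lemma incl_simps [simp]:
  "incl (x + y) = incl x + incl y" "incl (x * y) = incl x * incl y" "incl 1 = 1"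
  "incl (free_scalar c * x) = free_scalar c * incl x" "incl (free_gen l) = gE l" "incl 0 = 0"
  unfolding incl_def
  by (rule Free.free_hom_add Free.free_hom_mult Free.free_hom_one Free.free_hom_smult Free.free_hom_gen
      Free.free_hom_zero; simp)+

lemma incl_scalar [simp]: "incl (free_scalar c) = free_scalar c"
  using incl_simps(4)[of c 1] unfolding mult_1_right incl_simps(3) .

definition eta :: "('i, 'k) free_alg \<Rightarrow> ('i generator, 'k) free_alg set" where
  "eta t = cl (incl t)"

lemma eta_simps [simp]:
  "eta (x + y) = eta x \<oplus>\<^bsub>U\<^esub> eta y" "eta (x * y) = eta x \<otimes>\<^bsub>U\<^esub> eta y" "eta 1 = \<one>\<^bsub>U\<^esub>"
  "eta (free_scalar c * x) = c \<odot>\<^bsub>U\<^esub> eta x" "eta (free_gen l) = uq_e a d r s l" "eta 0 = \<zero>\<^bsub>U\<^esub>"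
  "eta x \<in> carrier U"
  by (simp_all add: eta_def uq_e_def)

lemma eta_scalar [simp]: "eta (free_scalar c) = c \<odot>\<^bsub>U\<^esub> \<one>\<^bsub>U\<^esub>"
  by (simp add: eta_def)

lemma eta_diff [simp]: "eta (x - y) = eta x \<ominus>\<^bsub>U\<^esub> eta y"
proof -
  have 1: "x - y = x + free_scalar (- 1) * y" by (simp add: free_scalar_minus)
  show ?thesis unfolding 1 eta_simps by (simp add: U.minus_eq_sm)
qed

abbreviation "ker_eta \<equiv> {t. eta t = \<zero>\<^bsub>U\<^esub>}"

definition serre_el :: "'i \<Rightarrow> 'i \<Rightarrow> ('i, 'k) free_alg" where
  "serre_el i j = Free.qserre (v i) (chi i j) (free_gen i) (free_gen j) (serre_len i j)"

lemma incl_hom: "incl \<in> algebra_hom free_algebra free_algebra"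
  by (rule algebra_homI) (simp_all add: free_algebra_def)

lemma eta_serre_el: assumes "i \<noteq> j" shows "eta (serre_el i j) = \<zero>\<^bsub>U\<^esub>"
proof -
  have "incl (serre_el i j) = serre_e i j"
    unfolding serre_el_def serre_e_qserre
    using Free.hom_qserre[OF k_algebra_free incl_hom, of "free_gen i" "free_gen j"] by simp
  moreover have "serre_e i j \<in> uq_relations a d r s"
    unfolding serre_e_def by (rule uq_relations.serre_E[OF assms])
  ultimately show ?thesis by (simp add: eta_def cl_relation)
qed

lemma diag_qserre: "diag g (k_algebra.qserre Free.opp v' c (free_gen i) (free_gen j) m) =
    free_scalar (g i ^ m * g j) * k_algebra.qserre Free.opp v' c (free_gen i) (free_gen j) m"
proof -
  interpret opp: k_algebra Free.opp by (rule Free.k_algebra_opp)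
  show ?thesis
  proof (induct m)
    case (Suc m)
    let ?Z = "opp.qserre v' c (free_gen i) (free_gen j) m"
    have 1: "opp.qserre v' c (free_gen i) (free_gen j) (Suc m) =
        ?Z * free_gen i + free_scalar (- (v' ^ m * c)) * (free_gen i * ?Z)"
      by (simp add: opp.skew_comm_def)
    have 2: "diag g (?Z * free_gen i) = free_scalar (g i ^ Suc m * g j) * (?Z * free_gen i)"
      unfolding diag_simps Suc by (simp add: mult.assoc free_scalar_left_commute[of ?Z] mult.left_commute[of "g i"] mult.commute[of _ "g i"])
    have 3: "diag g (free_gen i * ?Z) = free_scalar (g i ^ Suc m * g j) * (free_gen i * ?Z)"
      unfolding diag_simps Suc by (simp add: mult.assoc)
    show ?case
      unfolding 1 diag_simps(1,4) 2 3 distrib_left by (simp only: free_scalar_simps mult.commute)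
  qed simp
qed

text \<open>The operator \<open>E i\<close> is, up to a scalar, the sum of a left multiplication and a twisted right
  multiplication that skew commute, so the Serre operator splits. The part in the right multiplications
  is a right multiplication by the Serre element of the opposite algebra with \<open>chi j i\<close> in place of
  \<open>chi i j\<close>, which is a multiple of the Serre element itself.\<close>

lemma rho_serre_e_eq:
  assumes ij: "i \<noteq> j"
  shows "\<exists>\<alpha> \<beta> g. \<forall>t. rho (serre_e i j) t =
    free_scalar \<alpha> * (serre_el i j * t) + free_scalar \<beta> * (diag g t * serre_el i j)"
proof -
  interpret endo: k_algebra endo by (rule k_algebra_endo)
  interpret opp: k_algebra "Free.opp :: ('k, ('i, 'k) free_alg) module" by (rule Free.k_algebra_opp)
  define B where "B = (\<lambda>p t. free_scalar (- 1) * (Om p t * free_gen p))"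
  have B: "B p \<in> carrier endo" for p
    by (simp add: B_def endo_simps linear_op_def distrib_left distrib_right mult.assoc)
  have E: "E p = kappa p \<odot>\<^bsub>endo\<^esub> (left_op p \<oplus>\<^bsub>endo\<^esub> B p)" for p
    by (simp add: endo_simps fun_eq_iff E_def B_def left_op_def free_scalar_minus)
  have BL: "B p \<otimes>\<^bsub>endo\<^esub> left_op q = chi p q \<odot>\<^bsub>endo\<^esub> (left_op q \<otimes>\<^bsub>endo\<^esub> B p)" for p q
    by (simp add: endo_simps fun_eq_iff B_def left_op_def mult.assoc del: free_scalar_simps(2))
  note lc = left_op_carrier
  have S: "rho (serre_e i j) = (kappa i ^ serre_len i j * kappa j) \<odot>\<^bsub>endo\<^esub>
      (endo.qserre (v i) (chi i j) (left_op i) (left_op j) (serre_len i j) \<oplus>\<^bsub>endo\<^esub>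
       endo.qserre (v i) (chi i j) (B i) (B j) (serre_len i j))"
    using lc B
    by (simp add: rho_serre_e E endo.qserre_smult
      endo.qserre_add[OF lc lc B B BL[of i i, unfolded chi_diag] BL BL v_not_root serre_len_pos[OF ij] chi_zeta[OF ij]])
  have A: "endo.qserre (v i) (chi i j) (left_op i) (left_op j) (serre_len i j) t = serre_el i j * t" for t
  proof -
    have hom: "(\<lambda>x t. x * t) \<in> algebra_hom free_algebra endo"
      by (rule algebra_homI)
        (auto simp: free_algebra_def endo_simps linear_op_def algebra_simps free_scalar_left_commute[of _ _ "_ :: ('i, 'k) free_alg"])
    show ?thesis
      using Free.hom_qserre[OF k_algebra_endo hom, of "free_gen i" "free_gen j" "v i" "chi i j" "serre_len i j"]
      by (simp add: serre_el_def fun_eq_iff flip: left_op_def)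
  qed
  let ?Z = "\<lambda>m. opp.qserre (v i) (chi j i) (free_gen i) (free_gen j) m"
  let ?g = "\<lambda>m l. chi i l ^ m * chi j l"
  have "\<exists>\<kappa>. \<forall>t. endo.qserre (v i) (chi i j) (B i) (B j) m t = free_scalar \<kappa> * (diag (?g m) t * ?Z m)" for m
  proof (induct m)
    case 0
    show ?case by (intro exI[of _ "- 1"]) (simp add: B_def)
  next
    case (Suc m)
    then obtain \<kappa> where IH: "\<And>t. endo.qserre (v i) (chi i j) (B i) (B j) m t = free_scalar \<kappa> * (diag (?g m) t * ?Z m)"
      by blast
    have Z: "?Z (Suc m) = ?Z m * free_gen i + free_scalar (- (v i ^ m * chi j i)) * (free_gen i * ?Z m)"
      by (simp add: opp.skew_comm_def)
    have OmZ: "Om i (?Z m) = free_scalar (v i ^ m * chi i j) * ?Z m"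
      by (simp add: diag_qserre chi_diag)
    have "endo.qserre (v i) (chi i j) (B i) (B j) (Suc m) t =
        free_scalar (- (\<kappa> * (v i ^ m * chi i j))) * (diag (?g (Suc m)) t * ?Z (Suc m))" for t
    proof -
      define D where "D = diag (?g (Suc m)) t"
      have D: "Om i (diag (?g m) t) = D" "diag (?g m) (Om i t) = D"
        by (simp_all add: D_def diag_diag mult_ac)
      have b1: "B i (free_scalar \<kappa> * (diag (?g m) t * ?Z m)) =
          free_scalar (- (\<kappa> * (v i ^ m * chi i j))) * (D * (?Z m * free_gen i))"
        by (simp add: B_def D OmZ mult.assoc free_scalar_left_commute[of D])
      have b2: "free_scalar \<kappa> * (diag (?g m) (B i t) * ?Z m) =
          free_scalar (- (\<kappa> * (v i ^ m * chi j i))) * (D * (free_gen i * ?Z m))"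
        by (simp add: B_def D mult.assoc free_scalar_left_commute[of D] chi_diag)
      have step: "endo.qserre (v i) (chi i j) (B i) (B j) (Suc m) t =
          B i (free_scalar \<kappa> * (diag (?g m) t * ?Z m)) +
          free_scalar (- (v i ^ m * chi i j)) * (free_scalar \<kappa> * (diag (?g m) (B i t) * ?Z m))"
        unfolding endo.qserre.simps(2) endo.skew_comm_def by (simp only: endo_simps IH)
      show ?thesis
        unfolding step b1 b2 Z D_def[symmetric]
        by (simp add: distrib_left free_scalar_left_commute[of D] mult_ac(1-2))
          (simp add: mult.left_commute mult.commute)
    qed
    then show ?case by blast
  qed
  then obtain \<kappa> where Bq: "\<And>t. endo.qserre (v i) (chi i j) (B i) (B j) (serre_len i j) t =
      free_scalar \<kappa> * (diag (?g (serre_len i j)) t * ?Z (serre_len i j))" by blast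
  obtain \<kappa>' where "?Z (serre_len i j) = free_scalar \<kappa>' * serre_el i j"
    unfolding serre_el_def
    using Free.qserre_opp[OF _ _ v_nonzero chi_nonzero chi_zeta[OF ij], of "free_gen i" "free_gen j"] by auto
  then have "rho (serre_e i j) t = free_scalar (kappa i ^ serre_len i j * kappa j) * (serre_el i j * t) +
      free_scalar (kappa i ^ serre_len i j * kappa j * (\<kappa> * \<kappa>')) * (diag (?g (serre_len i j)) t * serre_el i j)" for t
    by (simp add: S endo_simps A Bq distrib_left free_scalar_left_commute[of "diag (?g (serre_len i j)) t"] mult.assoc)
  then show ?thesis by blast
qed

lemma eta_rho_serre_e: "i \<noteq> j \<Longrightarrow> eta (rho (serre_e i j) t) = \<zero>\<^bsub>U\<^esub>"
  using rho_serre_e_eq[of i j] by (auto simp: eta_serre_el)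

lemma rho_scalar [simp]: "rho (free_scalar c) t = free_scalar c * t"
  using rho_simps(4)[of c 1 t] unfolding mult_1_right rho_simps(3) .

subsection \<open>The relation ideal as operators\<close>

lemma rho_relation:
  assumes "x \<in> uq_relations a d r s"
  shows "(\<forall>t. rho x t = 0) \<or> (\<exists>i j. i \<noteq> j \<and> x = serre_e i j)"
proof -
  note EF = E_F
  have dd: "diag g (diag h t) = diag h (diag g t)" for g h t by (simp add: diag_diag mult.commute)
  have dinv: "diag g (diag h t) = t" if "\<And>l. g l * h l = 1" for g h t
    using that by (simp add: diag_diag diag_one)
  show ?thesis
    using assms
  proof cases
    case (E_F i j)
    then show ?thesis
      using EF[of i j] by (auto simp: kappa_def[symmetric] right_diff_distrib)
  next
    case (serre_E i j)
    then show ?thesis by (auto simp: serre_e_def)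
  next
    case (serre_F i j)
    then show ?thesis using rho_serre_f_zero[of i j] by (auto simp: serre_f_def)
  next
    case (Om_E i j)
    then show ?thesis by (simp add: diag_E flip: chi_def)
  next
    case (Om'_E i j)
    then show ?thesis by (simp add: diag_E flip: chi_inverse)
  next
    case (Om_F i j)
    then show ?thesis by (simp add: F_diag flip: chi_inverse)
  next
    case (Om'_F i j)
    then show ?thesis by (simp add: F_diag flip: chi_def)
  qed (simp_all add: dinv dd[of "chi _" "chi _"] dd)
qed

text \<open>For a stable subspace \<open>M\<close>, the elements that map everything into \<open>M\<close> form an ideal.\<close>

lemma rho_relation_ideal:
  assumes "\<And>t t'. \<lbrakk>t \<in> M; t' \<in> M\<rbrakk> \<Longrightarrow> t + t' \<in> M" "0 \<in> M"
    and stable: "\<And>x t. t \<in> M \<Longrightarrow> rho x t \<in> M"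
    and serre: "\<And>i j t. i \<noteq> j \<Longrightarrow> rho (serre_e i j) t \<in> M"
    and x: "cl x = \<zero>\<^bsub>U\<^esub>"
  shows "rho x t \<in> M"
proof -
  have "Idl\<^bsub>free_algebra\<^esub> (uq_relations a d r s) \<subseteq> {x. \<forall>t. rho x t \<in> M}"
  proof (rule free_ideal_subset)
    show "uq_relations a d r s \<subseteq> {x. \<forall>t. rho x t \<in> M}"
      using rho_relation serre \<open>0 \<in> M\<close> by fastforce
  qed (use assms in auto)
  then show ?thesis using x cl_eq_zero by auto
qed

end


section \<open>Comultiplication and counit\<close>

context two_parameter
begin

abbreviation "\<omega> i \<equiv> cl (free_gen (Gen_om i))"
abbreviation "\<omega>i i \<equiv> cl (free_gen (Gen_om_inv i))"
abbreviation "\<omega>' i \<equiv> cl (free_gen (Gen_om' i))"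
abbreviation "\<omega>i' i \<equiv> cl (free_gen (Gen_om_inv' i))"
abbreviation "e i \<equiv> cl (gE i)"
abbreviation "f i \<equiv> cl (gF i)"

lemma om_inverse [simp]:
  "\<omega> i \<otimes>\<^bsub>U\<^esub> \<omega>i i = \<one>\<^bsub>U\<^esub>" "\<omega>i i \<otimes>\<^bsub>U\<^esub> \<omega> i = \<one>\<^bsub>U\<^esub>" "\<omega>' i \<otimes>\<^bsub>U\<^esub> \<omega>i' i = \<one>\<^bsub>U\<^esub>" "\<omega>i' i \<otimes>\<^bsub>U\<^esub> \<omega>' i = \<one>\<^bsub>U\<^esub>"
  using cl_relation[OF uq_relations.Om_OmInv, of i] cl_relation[OF uq_relations.OmInv_Om, of i]
    cl_relation[OF uq_relations.Om'_OmInv', of i] cl_relation[OF uq_relations.OmInv'_Om', of i]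
  by simp_all

lemma om_commute:
  "\<omega> i \<otimes>\<^bsub>U\<^esub> \<omega> j = \<omega> j \<otimes>\<^bsub>U\<^esub> \<omega> i" "\<omega> i \<otimes>\<^bsub>U\<^esub> \<omega>' j = \<omega>' j \<otimes>\<^bsub>U\<^esub> \<omega> i" "\<omega>' i \<otimes>\<^bsub>U\<^esub> \<omega>' j = \<omega>' j \<otimes>\<^bsub>U\<^esub> \<omega>' i"
  using cl_relation[OF uq_relations.Om_Om, of i j] cl_relation[OF uq_relations.Om_Om', of i j]
    cl_relation[OF uq_relations.Om'_Om', of i j]
  by simp_all

lemma om_move:
  "\<omega> i \<otimes>\<^bsub>U\<^esub> e j = chi i j \<odot>\<^bsub>U\<^esub> (e j \<otimes>\<^bsub>U\<^esub> \<omega> i)" "\<omega>' i \<otimes>\<^bsub>U\<^esub> e j = (1 / chi j i) \<odot>\<^bsub>U\<^esub> (e j \<otimes>\<^bsub>U\<^esub> \<omega>' i)"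
  "\<omega> i \<otimes>\<^bsub>U\<^esub> f j = (1 / chi i j) \<odot>\<^bsub>U\<^esub> (f j \<otimes>\<^bsub>U\<^esub> \<omega> i)" "\<omega>' i \<otimes>\<^bsub>U\<^esub> f j = chi j i \<odot>\<^bsub>U\<^esub> (f j \<otimes>\<^bsub>U\<^esub> \<omega>' i)"
  using cl_relation[OF uq_relations.Om_E, of i j] cl_relation[OF uq_relations.Om'_E, of i j]
    cl_relation[OF uq_relations.Om_F, of i j] cl_relation[OF uq_relations.Om'_F, of i j]
  by (simp_all flip: chi_def chi_inverse add: chi_inverse[symmetric] chi_def[symmetric])

lemma e_f: "e i \<otimes>\<^bsub>U\<^esub> f j = f j \<otimes>\<^bsub>U\<^esub> e i \<oplus>\<^bsub>U\<^esub> (if i = j then kappa i \<odot>\<^bsub>U\<^esub> (\<omega> i \<ominus>\<^bsub>U\<^esub> \<omega>' i) else \<zero>\<^bsub>U\<^esub>)"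
proof -
  have eq: "x = y \<oplus>\<^bsub>U\<^esub> z" if "x \<ominus>\<^bsub>U\<^esub> y \<ominus>\<^bsub>U\<^esub> z = \<zero>\<^bsub>U\<^esub>" "x \<in> carrier U" "y \<in> carrier U" "z \<in> carrier U" for x y z
  proof -
    have "x \<ominus>\<^bsub>U\<^esub> y = z" using that by simp
    then have "z \<oplus>\<^bsub>U\<^esub> y = (x \<ominus>\<^bsub>U\<^esub> y) \<oplus>\<^bsub>U\<^esub> y" by simp
    also have "\<dots> = x" using that by (simp add: U.minus_eq U.a_assoc U.l_neg)
    finally show ?thesis using that by (simp add: U.a_comm)
  qed
  show ?thesis
  proof (rule eq)
    show "e i \<otimes>\<^bsub>U\<^esub> f j \<ominus>\<^bsub>U\<^esub> f j \<otimes>\<^bsub>U\<^esub> e i \<ominus>\<^bsub>U\<^esub> (if i = j then kappa i \<odot>\<^bsub>U\<^esub> (\<omega> i \<ominus>\<^bsub>U\<^esub> \<omega>' i) else \<zero>\<^bsub>U\<^esub>) = \<zero>\<^bsub>U\<^esub>"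
      using cl_relation[OF uq_relations.E_F, of i j]
      by (auto simp: kappa_def U.sm_minus split: if_splits)
  qed simp_all
qed

lemma serre_zero:
  assumes "i \<noteq> j"
  shows "U.qserre (v i) (chi i j) (e i) (e j) (serre_len i j) = \<zero>\<^bsub>U\<^esub>"
    and "k_algebra.qserre U.opp (v i) (chi i j) (f i) (f j) (serre_len i j) = \<zero>\<^bsub>U\<^esub>"
proof -
  have "cl (serre_e i j) = \<zero>\<^bsub>U\<^esub>" "cl (serre_f i j) = \<zero>\<^bsub>U\<^esub>"
    using uq_relations.serre_E[OF assms] uq_relations.serre_F[OF assms]
    by (auto simp: serre_e_def serre_f_def intro!: cl_relation)
  then show "U.qserre (v i) (chi i j) (e i) (e j) (serre_len i j) = \<zero>\<^bsub>U\<^esub>"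
    and "k_algebra.qserre U.opp (v i) (chi i j) (f i) (f j) (serre_len i j) = \<zero>\<^bsub>U\<^esub>"
    using Free.hom_qserre[OF k_algebra_U cl_hom, of "gE i" "gE j" "v i" "chi i j" "serre_len i j"]
      k_algebra.hom_qserre[OF Free.k_algebra_opp U.k_algebra_opp
        algebra_hom_opp[OF k_algebra_free k_algebra_U cl_hom], of "gF i" "gF j" "v i" "chi i j" "serre_len i j"]
    by (simp_all add: serre_e_qserre serre_f_qserre)
qed

subsection \<open>Products of the group-like elements\<close>

lemma cl_power: "cl (x ^ n) = cl x [^]\<^bsub>U\<^esub> n"
proof (induct n)
  case (Suc n)
  then show ?case using U.nat_pow_Suc2[of "cl x" n] by (simp del: U.nat_pow_Suc)
qed simp

text \<open>The common form of \<open>\<omega>\<^sub>\<mu>\<close> and \<open>\<omega>\<^sub>\<mu>'\<close>; the family \<open>H\<close> consists of the inverses of \<open>G\<close>.\<close>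

definition ordered_product :: "('i \<Rightarrow> 'i generator) \<Rightarrow> ('i \<Rightarrow> 'i generator) \<Rightarrow> 'i list \<Rightarrow> ('i \<Rightarrow> int)
    \<Rightarrow> ('i generator, 'k) free_alg set" where
  "ordered_product G H L \<beta> = cl (\<Prod>i\<leftarrow>L. free_gen (G i) ^ nat (\<beta> i) * free_gen (H i) ^ nat (- \<beta> i))"

lemma ordered_product_step:
  assumes GH: "\<And>i. cl (free_gen (G i)) \<otimes>\<^bsub>U\<^esub> cl (free_gen (H i)) = \<one>\<^bsub>U\<^esub>"
    and HG: "\<And>i. cl (free_gen (H i)) \<otimes>\<^bsub>U\<^esub> cl (free_gen (G i)) = \<one>\<^bsub>U\<^esub>"
    and GG: "\<And>i j. cl (free_gen (G i)) \<otimes>\<^bsub>U\<^esub> cl (free_gen (G j)) = cl (free_gen (G j)) \<otimes>\<^bsub>U\<^esub> cl (free_gen (G i))"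
    and L: "distinct L" "j \<in> set L"
  shows "cl (free_gen (G j)) \<otimes>\<^bsub>U\<^esub> ordered_product G H L \<beta> = ordered_product G H L (\<beta>(j := \<beta> j + 1))"
proof -
  define g where "g i = cl (free_gen (G i))" for i
  define h where "h i = cl (free_gen (H i))" for i
  have c: "g i \<in> carrier U" "h i \<in> carrier U" for i by (simp_all add: g_def h_def)
  note GH = GH[folded g_def h_def] and HG = HG[folded g_def h_def] and GG = GG[folded g_def]
  have gh: "g i \<otimes>\<^bsub>U\<^esub> h l = h l \<otimes>\<^bsub>U\<^esub> g i" for i l
  proof -
    have "g i \<otimes>\<^bsub>U\<^esub> h l = h l \<otimes>\<^bsub>U\<^esub> (g l \<otimes>\<^bsub>U\<^esub> g i) \<otimes>\<^bsub>U\<^esub> h l"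
      using c HG[of l] by (simp flip: U.m_assoc)
    also have "\<dots> = h l \<otimes>\<^bsub>U\<^esub> (g i \<otimes>\<^bsub>U\<^esub> (g l \<otimes>\<^bsub>U\<^esub> h l))"
      using c by (simp add: GG[of l i] U.m_assoc)
    finally show ?thesis using c by (simp add: GH)
  qed
  define w where "w i n = g i [^]\<^bsub>U\<^esub> nat n \<otimes>\<^bsub>U\<^esub> h i [^]\<^bsub>U\<^esub> nat (- n)" for i and n :: int
  have w: "w i n \<in> carrier U" for i n using c by (simp add: w_def)
  have pw: "y \<otimes>\<^bsub>U\<^esub> x [^]\<^bsub>U\<^esub> (n::nat) = x [^]\<^bsub>U\<^esub> n \<otimes>\<^bsub>U\<^esub> y"
    if "y \<otimes>\<^bsub>U\<^esub> x = x \<otimes>\<^bsub>U\<^esub> y" "x \<in> carrier U" "y \<in> carrier U" for x y n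
    using U.move_power[of x y 1 n] that by simp
  have gw: "g i \<otimes>\<^bsub>U\<^esub> w l n = w l n \<otimes>\<^bsub>U\<^esub> g i" for i l n
  proof -
    have "g i \<otimes>\<^bsub>U\<^esub> w l n = (g i \<otimes>\<^bsub>U\<^esub> g l [^]\<^bsub>U\<^esub> nat n) \<otimes>\<^bsub>U\<^esub> h l [^]\<^bsub>U\<^esub> nat (- n)"
      using c by (simp add: w_def U.m_assoc)
    also have "\<dots> = g l [^]\<^bsub>U\<^esub> nat n \<otimes>\<^bsub>U\<^esub> (g i \<otimes>\<^bsub>U\<^esub> h l [^]\<^bsub>U\<^esub> nat (- n))"
      using c by (simp add: pw[OF GG] U.m_assoc)
    finally show ?thesis using c by (simp add: pw[OF gh] w_def U.m_assoc)
  qed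
  have same: "g i \<otimes>\<^bsub>U\<^esub> w i n = w i (n + 1)" for i n
  proof (cases "n \<ge> 0")
    case True
    define k where "k = nat n"
    have k: "nat n = k" "nat (n + 1) = Suc k" "nat (- n) = 0" "nat (- (n + 1)) = 0"
      using True by (auto simp: k_def)
    show ?thesis
      unfolding w_def k using c U.nat_pow_Suc2[of "g i" k] by (simp del: U.nat_pow_Suc)
  next
    case False
    define k where "k = nat (- n) - 1"
    have k: "nat (- n) = Suc k" "nat (- n - 1) = k" "nat n = 0" "nat (n + 1) = 0"
      using False by (auto simp: k_def)
    show ?thesis
      using c U.nat_pow_Suc2[of "h i" k] by (simp add: w_def k GH del: U.nat_pow_Suc flip: U.m_assoc)
  qed
  have op: "ordered_product G H (l # L) \<gamma> = w l (\<gamma> l) \<otimes>\<^bsub>U\<^esub> ordered_product G H L \<gamma>" for l L \<gamma>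
    by (simp add: ordered_product_def w_def g_def h_def cl_power)
  have op0: "ordered_product G H [] \<gamma> = \<one>\<^bsub>U\<^esub>" for \<gamma> by (simp add: ordered_product_def)
  have opc: "ordered_product G H L \<gamma> \<in> carrier U" for L \<gamma> by (simp add: ordered_product_def)
  have other: "ordered_product G H L (\<beta>(j := x)) = ordered_product G H L \<beta>" if "j \<notin> set L" for L x
    using that by (induct L) (auto simp: op op0)
  have "g j \<otimes>\<^bsub>U\<^esub> ordered_product G H L \<beta> = ordered_product G H L (\<beta>(j := \<beta> j + 1))"
    using L
  proof (induct L)
    case (Cons l L)
    show ?case
    proof (cases "l = j")
      case True
      then have "ordered_product G H L (\<beta>(j := \<beta> j + 1)) = ordered_product G H L \<beta>"
        using Cons.prems by (intro other) simp
      then have "ordered_product G H (l # L) (\<beta>(j := \<beta> j + 1)) = w j (\<beta> j + 1) \<otimes>\<^bsub>U\<^esub> ordered_product G H L \<beta>"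
        unfolding op True by (simp only: fun_upd_same)
      then show ?thesis
        using c w opc True by (simp only: op flip: same) (simp add: U.m_assoc)
    next
      case False
      have "g j \<otimes>\<^bsub>U\<^esub> ordered_product G H (l # L) \<beta> = w l (\<beta> l) \<otimes>\<^bsub>U\<^esub> (g j \<otimes>\<^bsub>U\<^esub> ordered_product G H L \<beta>)"
        using c w opc by (simp add: op gw flip: U.m_assoc)
      then show ?thesis using Cons False by (simp add: op)
    qed
  qed simp
  then show ?thesis by (simp add: g_def)
qed

lemma lookup_simple_root: "Poly_Mapping.lookup (simple_root j + \<mu>) =
    (Poly_Mapping.lookup \<mu>)(j := Poly_Mapping.lookup \<mu> j + 1)"
  by (auto simp: fun_eq_iff simple_root_def lookup_add lookup_single when_def)

abbreviation "\<Omega> \<equiv> uq_om a d r s"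
abbreviation "\<Omega>' \<equiv> uq_om' a d r s"

lemma Omega_step: "\<Omega> (simple_root j + \<mu>) = \<omega> j \<otimes>\<^bsub>U\<^esub> \<Omega> \<mu>" "\<Omega>' (simple_root j + \<mu>) = \<omega>' j \<otimes>\<^bsub>U\<^esub> \<Omega>' \<mu>"
proof -
  have 1: "\<Omega> \<mu> = ordered_product Gen_om Gen_om_inv (sorted_list_of_set UNIV) (Poly_Mapping.lookup \<mu>)"
    "\<Omega>' \<mu> = ordered_product Gen_om' Gen_om_inv' (sorted_list_of_set UNIV) (Poly_Mapping.lookup \<mu>)" for \<mu>
    by (simp_all add: uq_om_def uq_om'_def ordered_product_def)
  show "\<Omega> (simple_root j + \<mu>) = \<omega> j \<otimes>\<^bsub>U\<^esub> \<Omega> \<mu>" "\<Omega>' (simple_root j + \<mu>) = \<omega>' j \<otimes>\<^bsub>U\<^esub> \<Omega>' \<mu>"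
    unfolding 1 lookup_simple_root
    by (rule ordered_product_step[symmetric]; simp add: om_commute)+
qed

lemma Omega_zero [simp]: "\<Omega> 0 = \<one>\<^bsub>U\<^esub>" "\<Omega>' 0 = \<one>\<^bsub>U\<^esub>"
  by (simp_all add: uq_om_def uq_om'_def map_replicate_const prod_list_replicate)

lemma Omega_closed [simp]: "\<Omega> \<mu> \<in> carrier U" "\<Omega>' \<mu> \<in> carrier U"
  by (simp_all add: uq_om_def uq_om'_def)

lemma Omega_simple_root [simp]: "\<Omega> (simple_root j) = \<omega> j" "\<Omega>' (simple_root j) = \<omega>' j"
  using Omega_step[of j 0] by simp_all

lemma uq_e_f [simp]: "uq_e a d r s i = e i" "uq_f a d r s i = f i"
  by (simp_all add: uq_e_def uq_f_def)

text \<open>Multiplication by a group-like generator relates the products \<open>\<omega>\<^sub>\<mu>\<close> whose indices differ by a simple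
  root, so the induction goes by such steps, in both directions.\<close>

lemma root_lattice_induct [case_names zero plus minus]:
  fixes \<mu> :: "'i root_lattice"
  assumes "P 0" and "\<And>\<mu> j. P \<mu> \<Longrightarrow> P (simple_root j + \<mu>)" and "\<And>\<mu> j. P (simple_root j + \<mu>) \<Longrightarrow> P \<mu>"
  shows "P \<mu>"
proof -
  have s: "P \<mu> \<longrightarrow> P (Poly_Mapping.single u c + \<mu>)" for u c \<mu>
  proof (induct c arbitrary: \<mu> rule: int_induct[where k = 0])
    case (step1 c)
    have "Poly_Mapping.single u (c + 1) + \<mu> = simple_root u + (Poly_Mapping.single u c + \<mu>)"
      by (simp add: single_add simple_root_def add_ac)
    then show ?case using step1 assms(2) by metis
  next
    case (step2 c)
    have "simple_root u + (Poly_Mapping.single u (c - 1) + \<mu>) = Poly_Mapping.single u c + \<mu>"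
      by (simp add: single_diff simple_root_def)
    then show ?case using step2 assms(3) by metis
  qed simp
  have "Poly_Mapping.keys \<mu> \<subseteq> UNIV" by simp
  then have "\<forall>\<nu>. P \<nu> \<longrightarrow> P (\<mu> + \<nu>)"
    by (induct rule: poly_mapping_span_induct) (use s in \<open>auto simp: add.assoc\<close>)
  then show ?thesis using assms(1) by (metis add.right_neutral)
qed

subsection \<open>Homomorphisms out of the algebra\<close>

text \<open>The inverses of the group-like generators need no condition, since homomorphisms preserve
  inverses.\<close>

lemma hom_unique:
  assumes B: "k_algebra B" and h: "h \<in> algebra_hom U B" "h' \<in> algebra_hom U B"
    and eq: "\<And>i. h (\<omega> i) = h' (\<omega> i)" "\<And>i. h (\<omega>' i) = h' (\<omega>' i)" "\<And>i. h (e i) = h' (e i)" "\<And>i. h (f i) = h' (f i)"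
    and u: "u \<in> carrier U"
  shows "h u = h' u"
proof -
  interpret B: k_algebra B by fact
  have inv: "h y = h' y" if "x \<otimes>\<^bsub>U\<^esub> y = \<one>\<^bsub>U\<^esub>" "y \<otimes>\<^bsub>U\<^esub> x = \<one>\<^bsub>U\<^esub>" "h x = h' x" "x \<in> carrier U" "y \<in> carrier U" for x y
  proof -
    have c: "h x \<in> carrier B" "h y \<in> carrier B" "h' y \<in> carrier B"
      using that h by (auto intro: algebra_homD(1))
    have "h y \<otimes>\<^bsub>B\<^esub> h x = \<one>\<^bsub>B\<^esub>"
      using algebra_homD(2)[OF h(1) that(5,4)] that(2) algebra_homD(4)[OF h(1)] by simp
    moreover have "h x \<otimes>\<^bsub>B\<^esub> h' y = \<one>\<^bsub>B\<^esub>"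
      using algebra_homD(2)[OF h(2) that(4,5)] that(1,3) algebra_homD(4)[OF h(2)] by simp
    ultimately show ?thesis using B.inv_unique[OF _ _ c(2,1,3)] by (metis B.inv_unique c)
  qed
  have gen: "h (cl (free_gen q)) = h' (cl (free_gen q))" for q
  proof (cases q)
    case (Gen_om_inv i)
    show ?thesis unfolding Gen_om_inv by (rule inv[of "\<omega> i"]) (simp_all add: eq)
  next
    case (Gen_om_inv' i)
    show ?thesis unfolding Gen_om_inv' by (rule inv[of "\<omega>' i"]) (simp_all add: eq)
  qed (simp_all add: eq)
  obtain x where "u = cl x" using u by (rule U_cases)
  moreover have "h (cl x) = h' (cl x)"
    by (induct x rule: free_alg_induct)
      (simp_all add: algebra_homD[OF h(1)] algebra_homD[OF h(2)] gen)
  ultimately show ?thesis by simp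
qed

sublocale W: two_algebras "uq a d r s" "uq a d r s" ..

abbreviation "TT \<equiv> tensor_algebra U U"
abbreviation "pt \<equiv> pure_tensor U U"

fun comult_gen :: "'i generator \<Rightarrow> (('i generator, 'k) free_alg set \<times> ('i generator, 'k) free_alg set \<Rightarrow>\<^sub>0 'k) set" where
  "comult_gen (Gen_e i) = pt (e i) \<one>\<^bsub>U\<^esub> \<oplus>\<^bsub>TT\<^esub> pt (\<omega> i) (e i)"
| "comult_gen (Gen_f i) = pt \<one>\<^bsub>U\<^esub> (f i) \<oplus>\<^bsub>TT\<^esub> pt (f i) (\<omega>' i)"
| "comult_gen (Gen_om i) = pt (\<omega> i) (\<omega> i)"
| "comult_gen (Gen_om_inv i) = pt (\<omega>i i) (\<omega>i i)"
| "comult_gen (Gen_om' i) = pt (\<omega>' i) (\<omega>' i)"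
| "comult_gen (Gen_om_inv' i) = pt (\<omega>i' i) (\<omega>i' i)"

lemma comult_gen_closed: "comult_gen q \<in> carrier TT"
  by (cases q) simp_all

text \<open>The two summands \<open>e\<^sub>p \<otimes> 1\<close> and \<open>\<omega>\<^sub>p \<otimes> e\<^sub>p\<close> skew commute, so the Serre element splits; each part has the
  Serre element of \<open>U\<close> as a tensor factor.\<close>

lemma TT_qserre_e_zero:
  assumes ij: "i \<noteq> j"
  shows "W.TA.qserre (v i) (chi i j) (comult_gen (Gen_e i)) (comult_gen (Gen_e j)) (serre_len i j) = \<zero>\<^bsub>TT\<^esub>"
proof -
  let ?x = "\<lambda>p. pt (e p) \<one>\<^bsub>U\<^esub>" and ?x' = "\<lambda>p. pt (\<omega> p) (e p)"
  have c: "?x p \<in> carrier TT" "?x' p \<in> carrier TT" for p by simp_all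
  have comm: "?x' p \<otimes>\<^bsub>TT\<^esub> ?x q = chi p q \<odot>\<^bsub>TT\<^esub> (?x q \<otimes>\<^bsub>TT\<^esub> ?x' p)" for p q
    by (simp add: om_move)
  have hom: "(\<lambda>z. pt z \<one>\<^bsub>U\<^esub>) \<in> algebra_hom U TT"
    by (rule algebra_homI) (simp_all add: W.pt_add_left W.pt_one)
  have 1: "W.TA.qserre (v i) (chi i j) (?x i) (?x j) (serre_len i j) = \<zero>\<^bsub>TT\<^esub>"
    using U.hom_qserre[OF W.k_algebra_tensor hom, of "e i" "e j" "v i" "chi i j" "serre_len i j", symmetric]
      serre_zero(1)[OF ij] by simp
  have "\<exists>w\<in>carrier U. (\<forall>p. \<omega> p \<otimes>\<^bsub>U\<^esub> w = w \<otimes>\<^bsub>U\<^esub> \<omega> p) \<and>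
      W.TA.qserre (v i) (chi i j) (?x' i) (?x' j) m = pt w (U.qserre (v i) (chi i j) (e i) (e j) m)" for m
  proof (induct m)
    case 0
    then show ?case by (intro bexI[of _ "\<omega> j"]) (simp_all add: om_commute)
  next
    case (Suc m)
    let ?S = "U.qserre (v i) (chi i j) (e i) (e j) m"
    from Suc obtain w where w: "w \<in> carrier U" "\<And>p. \<omega> p \<otimes>\<^bsub>U\<^esub> w = w \<otimes>\<^bsub>U\<^esub> \<omega> p"
      "W.TA.qserre (v i) (chi i j) (?x' i) (?x' j) m = pt w ?S" by blast
    have "W.TA.qserre (v i) (chi i j) (?x' i) (?x' j) (Suc m) = pt (w \<otimes>\<^bsub>U\<^esub> \<omega> i) (U.qserre (v i) (chi i j) (e i) (e j) (Suc m))"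
      using w(1) by (simp add: W.TA.skew_comm_def U.skew_comm_def w W.pt_add_right)
    moreover have "\<omega> p \<otimes>\<^bsub>U\<^esub> (w \<otimes>\<^bsub>U\<^esub> \<omega> i) = (w \<otimes>\<^bsub>U\<^esub> \<omega> i) \<otimes>\<^bsub>U\<^esub> \<omega> p" for p
    proof -
      have "\<omega> p \<otimes>\<^bsub>U\<^esub> (w \<otimes>\<^bsub>U\<^esub> \<omega> i) = w \<otimes>\<^bsub>U\<^esub> (\<omega> p \<otimes>\<^bsub>U\<^esub> \<omega> i)" using w by (simp flip: U.m_assoc)
      then show ?thesis using w(1) by (simp add: om_commute(1)[of p i] U.m_assoc)
    qed
    ultimately show ?case using w(1) by (intro bexI[of _ "w \<otimes>\<^bsub>U\<^esub> \<omega> i"]) auto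
  qed
  then obtain w where "w \<in> carrier U"
    "W.TA.qserre (v i) (chi i j) (?x' i) (?x' j) (serre_len i j) = pt w (U.qserre (v i) (chi i j) (e i) (e j) (serre_len i j))"
    by blast
  then have 2: "W.TA.qserre (v i) (chi i j) (?x' i) (?x' j) (serre_len i j) = \<zero>\<^bsub>TT\<^esub>"
    by (simp add: serre_zero(1)[OF ij])
  show ?thesis
    using W.TA.qserre_add[OF c(1) c(1) c(2) c(2) comm[of i i, unfolded chi_diag] comm comm v_not_root serre_len_pos[OF ij] chi_zeta[OF ij]]
    by (simp add: 1 2)
qed

text \<open>The relation for the \<open>f\<^sub>i\<close> is a Serre relation in the opposite algebra, where the argument for the
  \<open>e\<^sub>i\<close> applies with \<open>f\<^sub>p \<otimes> \<omega>\<^sub>p'\<close> and \<open>1 \<otimes> f\<^sub>p\<close>.\<close>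

lemma TT_qserre_f_zero:
  assumes ij: "i \<noteq> j"
  shows "k_algebra.qserre W.TA.opp (v i) (chi i j) (comult_gen (Gen_f i)) (comult_gen (Gen_f j)) (serre_len i j) = \<zero>\<^bsub>TT\<^esub>"
proof -
  interpret TO: k_algebra W.TA.opp by (rule W.TA.k_algebra_opp)
  interpret UO: k_algebra U.opp by (rule U.k_algebra_opp)
  let ?x = "\<lambda>p. pt (f p) (\<omega>' p)" and ?x' = "\<lambda>p. pt \<one>\<^bsub>U\<^esub> (f p)"
  have c: "?x p \<in> carrier W.TA.opp" "?x' p \<in> carrier W.TA.opp" for p by simp_all
  have comm: "?x' p \<otimes>\<^bsub>W.TA.opp\<^esub> ?x q = chi p q \<odot>\<^bsub>W.TA.opp\<^esub> (?x q \<otimes>\<^bsub>W.TA.opp\<^esub> ?x' p)" for p q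
    by (simp add: om_move)
  have "(\<lambda>z. pt \<one>\<^bsub>U\<^esub> z) \<in> algebra_hom U TT"
    by (rule algebra_homI) (simp_all add: W.pt_add_right W.pt_one)
  from algebra_hom_opp[OF k_algebra_U W.k_algebra_tensor this]
  have 1: "TO.qserre (v i) (chi i j) (?x' i) (?x' j) (serre_len i j) = \<zero>\<^bsub>TT\<^esub>"
    using UO.hom_qserre[OF W.TA.k_algebra_opp, of "\<lambda>z. pt \<one>\<^bsub>U\<^esub> z" "f i" "f j" "v i" "chi i j" "serre_len i j", symmetric]
      serre_zero(2)[OF ij] by simp
  have "\<exists>w\<in>carrier U. (\<forall>p. \<omega>' p \<otimes>\<^bsub>U\<^esub> w = w \<otimes>\<^bsub>U\<^esub> \<omega>' p) \<and>
      TO.qserre (v i) (chi i j) (?x i) (?x j) m = pt (UO.qserre (v i) (chi i j) (f i) (f j) m) w" for m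
  proof (induct m)
    case 0
    then show ?case by (intro bexI[of _ "\<omega>' j"]) (simp_all add: om_commute)
  next
    case (Suc m)
    let ?S = "UO.qserre (v i) (chi i j) (f i) (f j) m"
    have S: "?S \<in> carrier U" using UO.qserre_closed[of "f i" "f j"] by simp
    from Suc obtain w where w: "w \<in> carrier U" "\<And>p. \<omega>' p \<otimes>\<^bsub>U\<^esub> w = w \<otimes>\<^bsub>U\<^esub> \<omega>' p"
      "TO.qserre (v i) (chi i j) (?x i) (?x j) m = pt ?S w" by blast
    have "TO.qserre (v i) (chi i j) (?x i) (?x j) (Suc m) = pt (UO.qserre (v i) (chi i j) (f i) (f j) (Suc m)) (w \<otimes>\<^bsub>U\<^esub> \<omega>' i)"
      using w(1) S by (simp add: TO.skew_comm_def UO.skew_comm_def w W.pt_add_left)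
    moreover have "\<omega>' p \<otimes>\<^bsub>U\<^esub> (w \<otimes>\<^bsub>U\<^esub> \<omega>' i) = (w \<otimes>\<^bsub>U\<^esub> \<omega>' i) \<otimes>\<^bsub>U\<^esub> \<omega>' p" for p
    proof -
      have "\<omega>' p \<otimes>\<^bsub>U\<^esub> (w \<otimes>\<^bsub>U\<^esub> \<omega>' i) = w \<otimes>\<^bsub>U\<^esub> (\<omega>' p \<otimes>\<^bsub>U\<^esub> \<omega>' i)" using w by (simp flip: U.m_assoc)
      then show ?thesis using w(1) by (simp add: om_commute(3)[of p i] U.m_assoc)
    qed
    ultimately show ?case using w(1) by (intro bexI[of _ "w \<otimes>\<^bsub>U\<^esub> \<omega>' i"]) auto
  qed
  then obtain w where "w \<in> carrier U"
    "TO.qserre (v i) (chi i j) (?x i) (?x j) (serre_len i j) = pt (UO.qserre (v i) (chi i j) (f i) (f j) (serre_len i j)) w"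
    by blast
  then have 2: "TO.qserre (v i) (chi i j) (?x i) (?x j) (serre_len i j) = \<zero>\<^bsub>TT\<^esub>"
    by (simp add: serre_zero(2)[OF ij])
  show ?thesis
    using TO.qserre_add[OF c(1) c(1) c(2) c(2) comm[of i i, unfolded chi_diag] comm comm v_not_root serre_len_pos[OF ij] chi_zeta[OF ij]]
    by (simp add: 1 2 W.TA.a_comm)
qed

text \<open>The mixed term \<open>\<omega>\<^sub>i f\<^sub>j \<otimes> e\<^sub>i \<omega>\<^sub>j'\<close> is the same in both orders, because \<open>\<omega>\<^sub>i\<close> passes \<open>f\<^sub>j\<close> with the scalar with
  which \<open>\<omega>\<^sub>j'\<close> passes \<open>e\<^sub>i\<close>; in the remaining Cartan terms \<open>\<omega>\<^sub>i \<otimes> \<omega>\<^sub>i'\<close> cancels.\<close>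

lemma comult_e_f:
  "comult_gen (Gen_e i) \<otimes>\<^bsub>TT\<^esub> comult_gen (Gen_f j) = comult_gen (Gen_f j) \<otimes>\<^bsub>TT\<^esub> comult_gen (Gen_e i) \<oplus>\<^bsub>TT\<^esub>
    (if i = j then kappa i \<odot>\<^bsub>TT\<^esub> (pt (\<omega> i) (\<omega> i) \<ominus>\<^bsub>TT\<^esub> pt (\<omega>' i) (\<omega>' i)) else \<zero>\<^bsub>TT\<^esub>)"
proof -
  define Z where "Z = (if i = j then kappa i \<odot>\<^bsub>U\<^esub> (\<omega> i \<ominus>\<^bsub>U\<^esub> \<omega>' i) else \<zero>\<^bsub>U\<^esub>)"
  have Z: "Z \<in> carrier U" by (simp add: Z_def)
  have ef: "e i \<otimes>\<^bsub>U\<^esub> f j = f j \<otimes>\<^bsub>U\<^esub> e i \<oplus>\<^bsub>U\<^esub> Z" by (simp add: e_f Z_def)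
  let ?a = "pt (e i) (f j)" and ?b = "pt (f j \<otimes>\<^bsub>U\<^esub> e i) (\<omega>' j)" and ?c = "pt (\<omega> i) (f j \<otimes>\<^bsub>U\<^esub> e i)"
    and ?g = "pt (f j \<otimes>\<^bsub>U\<^esub> \<omega> i) (e i \<otimes>\<^bsub>U\<^esub> \<omega>' j)"
  have L: "comult_gen (Gen_e i) \<otimes>\<^bsub>TT\<^esub> comult_gen (Gen_f j) =
      (?a \<oplus>\<^bsub>TT\<^esub> (1 / chi i j) \<odot>\<^bsub>TT\<^esub> ?g \<oplus>\<^bsub>TT\<^esub> (?b \<oplus>\<^bsub>TT\<^esub> ?c)) \<oplus>\<^bsub>TT\<^esub> (pt Z (\<omega>' j) \<oplus>\<^bsub>TT\<^esub> pt (\<omega> i) Z)"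
    using Z by (simp add: W.TA.l_distr W.TA.r_distr ef om_move W.pt_add_left W.pt_add_right W.TA.a_ac)
  have R: "comult_gen (Gen_f j) \<otimes>\<^bsub>TT\<^esub> comult_gen (Gen_e i) =
      ?a \<oplus>\<^bsub>TT\<^esub> (1 / chi i j) \<odot>\<^bsub>TT\<^esub> ?g \<oplus>\<^bsub>TT\<^esub> (?b \<oplus>\<^bsub>TT\<^esub> ?c)"
    by (simp add: W.TA.l_distr W.TA.r_distr om_move W.TA.a_ac)
  have "pt Z (\<omega>' j) \<oplus>\<^bsub>TT\<^esub> pt (\<omega> i) Z =
      (if i = j then kappa i \<odot>\<^bsub>TT\<^esub> (pt (\<omega> i) (\<omega> i) \<ominus>\<^bsub>TT\<^esub> pt (\<omega>' i) (\<omega>' i)) else \<zero>\<^bsub>TT\<^esub>)"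
  proof (cases "i = j")
    case True
    let ?p = "pt (\<omega> i) (\<omega> i)" and ?q = "pt (\<omega> i) (\<omega>' i)" and ?s = "pt (\<omega>' i) (\<omega>' i)"
    have "pt Z (\<omega>' j) \<oplus>\<^bsub>TT\<^esub> pt (\<omega> i) Z =
        kappa i \<odot>\<^bsub>TT\<^esub> ((?q \<oplus>\<^bsub>TT\<^esub> (- 1) \<odot>\<^bsub>TT\<^esub> ?s) \<oplus>\<^bsub>TT\<^esub> (?p \<oplus>\<^bsub>TT\<^esub> (- 1) \<odot>\<^bsub>TT\<^esub> ?q))"
      using True by (simp add: Z_def U.minus_eq_sm W.pt_add_left W.pt_add_right W.TA.sm_add_right)
    also have "(?q \<oplus>\<^bsub>TT\<^esub> (- 1) \<odot>\<^bsub>TT\<^esub> ?s) \<oplus>\<^bsub>TT\<^esub> (?p \<oplus>\<^bsub>TT\<^esub> (- 1) \<odot>\<^bsub>TT\<^esub> ?q) = (?p \<oplus>\<^bsub>TT\<^esub> (- 1) \<odot>\<^bsub>TT\<^esub> ?s) \<oplus>\<^bsub>TT\<^esub> (?q \<oplus>\<^bsub>TT\<^esub> (- 1) \<odot>\<^bsub>TT\<^esub> ?q)"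
      by (simp add: W.TA.a_ac)
    also have "?q \<oplus>\<^bsub>TT\<^esub> (- 1) \<odot>\<^bsub>TT\<^esub> ?q = \<zero>\<^bsub>TT\<^esub>"
      using W.TA.sm_add_left[of ?q 1 "- 1"] by simp
    finally show ?thesis using True by (simp add: W.TA.minus_eq_sm)
  qed (simp add: Z_def)
  then show ?thesis unfolding L R by simp
qed

lemma comult_exists:
  "\<exists>h. h \<in> algebra_hom U TT \<and> h \<in> extensional (carrier U) \<and> (\<forall>q. h (cl (free_gen q)) = comult_gen q)"
proof -
  define D where "D = W.TA.free_hom comult_gen"
  have D: "D \<in> algebra_hom free_algebra TT"
    unfolding D_def by (rule W.TA.free_hom_hom[OF comult_gen_closed])
  have Dc: "D x \<in> carrier TT" for x using algebra_homD(1)[OF D, of x] by (simp add: free_algebra_def)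
  have Ds: "D (x * y) = D x \<otimes>\<^bsub>TT\<^esub> D y" "D (free_scalar c * x) = c \<odot>\<^bsub>TT\<^esub> D x" "D 1 = \<one>\<^bsub>TT\<^esub>" for x y c
    using algebra_homD(2)[OF D, of x y] algebra_homD(4)[OF D] algebra_homD(5)[OF D, of x c] by (simp_all add: free_algebra_def)
  have Dd: "D (x - y) = D x \<ominus>\<^bsub>TT\<^esub> D y" for x y
  proof -
    have 1: "x - y = x + free_scalar (- 1) * y" by (simp add: free_scalar_minus)
    have "D (x - y) = D x \<oplus>\<^bsub>TT\<^esub> (- 1) \<odot>\<^bsub>TT\<^esub> D y"
      using algebra_homD(3)[OF D, of x "free_scalar (- 1) * y"] unfolding 1 by (simp add: free_algebra_def Ds(2))
    then show ?thesis using Dc by (simp add: W.TA.minus_eq_sm)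
  qed
  have Dg: "D (free_gen q) = comult_gen q" for q
    unfolding D_def by (rule W.TA.free_hom_gen[OF comult_gen_closed])
  have Dsc: "D (free_scalar c) = c \<odot>\<^bsub>TT\<^esub> \<one>\<^bsub>TT\<^esub>" for c
    using Ds(2)[of c 1] unfolding mult_1_right Ds(3) .
  have D0: "D 0 = \<zero>\<^bsub>TT\<^esub>" using algebra_hom_zero[OF k_algebra_free W.k_algebra_tensor D] by (simp add: free_algebra_def)
  have "D x = \<zero>\<^bsub>TT\<^esub>" if "x \<in> uq_relations a d r s" for x
    using that
  proof cases
    case (E_F i j)
    have "D x = comult_gen (Gen_e i) \<otimes>\<^bsub>TT\<^esub> comult_gen (Gen_f j) \<ominus>\<^bsub>TT\<^esub> comult_gen (Gen_f j) \<otimes>\<^bsub>TT\<^esub> comult_gen (Gen_e i) \<ominus>\<^bsub>TT\<^esub>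
        (if i = j then kappa i \<odot>\<^bsub>TT\<^esub> (pt (\<omega> i) (\<omega> i) \<ominus>\<^bsub>TT\<^esub> pt (\<omega>' i) (\<omega>' i)) else \<zero>\<^bsub>TT\<^esub>)"
      unfolding E_F by (simp add: Dd Ds Dg D0 Dsc kappa_def del: comult_gen.simps(1,2))
    moreover have "(y \<oplus>\<^bsub>TT\<^esub> z) \<ominus>\<^bsub>TT\<^esub> y \<ominus>\<^bsub>TT\<^esub> z = \<zero>\<^bsub>TT\<^esub>" if "y \<in> carrier TT" "z \<in> carrier TT" for y z
    proof -
      have "(y \<oplus>\<^bsub>TT\<^esub> z) \<ominus>\<^bsub>TT\<^esub> y = z"
        using that by (simp add: W.TA.minus_eq W.TA.a_comm[of y z] W.TA.a_assoc W.TA.r_neg)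
      then show ?thesis using that by simp
    qed
    ultimately show ?thesis
      unfolding comult_e_f using comult_gen_closed by simp
  next
    case (serre_E i j)
    then have "x = serre_e i j" by (simp add: serre_e_def)
    then show ?thesis
      using Free.hom_qserre[OF W.k_algebra_tensor D, of "gE i" "gE j"] TT_qserre_e_zero[OF serre_E(2)]
      by (simp add: serre_e_qserre Dg del: comult_gen.simps)
  next
    case (serre_F i j)
    then have "x = serre_f i j" by (simp add: serre_f_def)
    then show ?thesis
      using k_algebra.hom_qserre[OF Free.k_algebra_opp W.TA.k_algebra_opp
        algebra_hom_opp[OF k_algebra_free W.k_algebra_tensor D], of "gF i" "gF j"] TT_qserre_f_zero[OF serre_F(2)]
      by (simp add: serre_f_qserre Dg del: comult_gen.simps)
  next
    case (Om_E i j)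
    show ?thesis unfolding Om_E Dd Ds Dg chi_def[symmetric]
      by (simp add: Dsc W.TA.l_distr W.TA.r_distr W.TA.sm_add_right om_move om_commute)
  next
    case (Om'_E i j)
    show ?thesis unfolding Om'_E Dd Ds Dg chi_inverse[symmetric]
      by (simp add: Dsc W.TA.l_distr W.TA.r_distr W.TA.sm_add_right om_move om_commute)
  next
    case (Om_F i j)
    show ?thesis unfolding Om_F Dd Ds Dg chi_inverse[symmetric]
      by (simp add: Dsc W.TA.l_distr W.TA.r_distr W.TA.sm_add_right om_move om_commute)
  next
    case (Om'_F i j)
    show ?thesis unfolding Om'_F Dd Ds Dg chi_def[symmetric]
      by (simp add: Dsc W.TA.l_distr W.TA.r_distr W.TA.sm_add_right om_move om_commute)
  qed (simp_all add: Dd Ds Dg W.pt_one om_commute)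
  from presented_algebra_hom[of TT D "uq_relations a d r s", OF W.k_algebra_tensor D this]
  obtain h where "h \<in> algebra_hom U TT" "h \<in> extensional (carrier U)" "\<And>x. h (cl x) = D x"
    by (auto simp: uq_def uq_class_def)
  then show ?thesis using Dg by auto
qed

abbreviation "\<Delta> \<equiv> uq_comult a d r s"

lemma comult: "\<Delta> \<in> algebra_hom U TT" "\<Delta> (cl (free_gen q)) = comult_gen q"
proof -
  let ?P = "\<lambda>\<Delta>. \<Delta> \<in> algebra_hom U TT \<and> \<Delta> \<in> extensional (carrier U) \<and>
     (\<forall>i. \<Delta> (\<omega> i) = pt (\<omega> i) (\<omega> i) \<and> \<Delta> (\<omega>' i) = pt (\<omega>' i) (\<omega>' i) \<and>
          \<Delta> (e i) = pt (e i) \<one>\<^bsub>U\<^esub> \<oplus>\<^bsub>TT\<^esub> pt (\<omega> i) (e i) \<and> \<Delta> (f i) = pt \<one>\<^bsub>U\<^esub> (f i) \<oplus>\<^bsub>TT\<^esub> pt (f i) (\<omega>' i))"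
  obtain h where h: "h \<in> algebra_hom U TT" "h \<in> extensional (carrier U)" "\<And>q. h (cl (free_gen q)) = comult_gen q"
    using comult_exists by blast
  have "?P h" using h by simp
  moreover have "h' = h" if "?P h'" for h'
  proof (rule extensionalityI[of _ "carrier U"])
    show "h' u = h u" if "u \<in> carrier U" for u
      by (rule hom_unique[OF W.k_algebra_tensor _ h(1)]) (use \<open>?P h'\<close> h(3) that in simp_all)
  qed (use that h in auto)
  ultimately have "(THE \<Delta>. ?P \<Delta>) = h" by (rule the_equality)
  then have "\<Delta> = h" by (simp add: uq_comult_def)
  then show "\<Delta> \<in> algebra_hom U TT" "\<Delta> (cl (free_gen q)) = comult_gen q" using h by simp_all
qed

fun counit_gen :: "'i generator \<Rightarrow> 'k" where
  "counit_gen (Gen_e i) = 0"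
| "counit_gen (Gen_f i) = 0"
| "counit_gen _ = 1"

lemma qserre_zero:
  assumes "k_algebra B"
  shows "k_algebra.qserre B v' c \<zero>\<^bsub>B\<^esub> \<zero>\<^bsub>B\<^esub> m = \<zero>\<^bsub>B\<^esub>"
proof -
  interpret B: k_algebra B by fact
  show ?thesis by (induct m) (simp_all add: B.skew_comm_def)
qed

lemma counit_exists:
  "\<exists>h. h \<in> algebra_hom U ground_algebra \<and> h \<in> extensional (carrier U) \<and> (\<forall>q. h (cl (free_gen q)) = counit_gen q)"
proof -
  interpret G: k_algebra "ground_algebra :: ('k, 'k) module" by (rule k_algebra_ground)
  let ?G = "ground_algebra :: ('k, 'k) module"
  have gs: "carrier ?G = UNIV" "monoid.mult ?G = (*)" "one ?G = 1" "ring.zero ?G = 0" "add ?G = (+)" "module.smult ?G = (*)"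
    by (simp_all add: ground_algebra_def)
  define D where "D = G.free_hom counit_gen"
  have cg: "counit_gen q \<in> carrier ?G" for q by (simp add: gs)
  have D: "D \<in> algebra_hom free_algebra ?G"
    unfolding D_def by (rule G.free_hom_hom[OF cg])
  have Ds: "D (x * y) = D x * D y" "D (free_scalar c * x) = c * D x" "D 1 = 1" "D (x + y) = D x + D y" for x y c
    using algebra_homD(2,3)[OF D, of x y] algebra_homD(4)[OF D] algebra_homD(5)[OF D, of x c]
    by (simp_all add: free_algebra_def gs)
  have Dd: "D (x - y) = D x - D y" for x y
  proof -
    have 1: "x - y = x + free_scalar (- 1) * y" by (simp add: free_scalar_minus)
    show ?thesis unfolding 1 Ds(4,2) by simp
  qed
  have Dg: "D (free_gen q) = counit_gen q" for q
    unfolding D_def by (rule G.free_hom_gen[OF cg])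
  have D0: "D 0 = 0" using algebra_hom_zero[OF k_algebra_free k_algebra_ground D] by (simp add: free_algebra_def gs)
  have q0: "G.qserre w c 0 0 m = 0" "k_algebra.qserre G.opp w c 0 0 m = 0" for w c m
    using qserre_zero[OF k_algebra_ground, of w c m] qserre_zero[OF G.k_algebra_opp, of w c m] by (simp_all add: gs)
  have "D x = \<zero>\<^bsub>?G\<^esub>" if "x \<in> uq_relations a d r s" for x
    using that
  proof cases
    case (serre_E i j)
    then have "x = serre_e i j" by (simp add: serre_e_def)
    then show ?thesis
      using Free.hom_qserre[OF k_algebra_ground D, of "gE i" "gE j"] by (simp add: serre_e_qserre Dg gs q0)
  next
    case (serre_F i j)
    then have "x = serre_f i j" by (simp add: serre_f_def)
    then show ?thesis
      using k_algebra.hom_qserre[OF Free.k_algebra_opp G.k_algebra_opp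
        algebra_hom_opp[OF k_algebra_free k_algebra_ground D], of "gF i" "gF j"]
      by (simp add: serre_f_qserre Dg gs q0)
  qed (auto simp: Dd Ds Dg D0 gs)
  from presented_algebra_hom[of ground_algebra D "uq_relations a d r s", OF k_algebra_ground D this]
  obtain h where "h \<in> algebra_hom U ?G" "h \<in> extensional (carrier U)" "\<And>x. h (cl x) = D x"
    by (auto simp: uq_def uq_class_def)
  then show ?thesis using Dg by auto
qed

abbreviation "\<epsilon> \<equiv> uq_counit a d r s"

lemma counit: "\<epsilon> \<in> algebra_hom U ground_algebra" "\<epsilon> (cl (free_gen q)) = counit_gen q"
proof -
  let ?P = "\<lambda>\<epsilon>. \<epsilon> \<in> algebra_hom U ground_algebra \<and> \<epsilon> \<in> extensional (carrier U) \<and>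
     (\<forall>i. \<epsilon> (\<omega> i) = 1 \<and> \<epsilon> (\<omega>' i) = 1 \<and> \<epsilon> (e i) = 0 \<and> \<epsilon> (f i) = 0)"
  obtain h where h: "h \<in> algebra_hom U ground_algebra" "h \<in> extensional (carrier U)" "\<And>q. h (cl (free_gen q)) = counit_gen q"
    using counit_exists by blast
  have "?P h" using h by simp
  moreover have "h' = h" if "?P h'" for h'
  proof (rule extensionalityI[of _ "carrier U"])
    show "h' u = h u" if "u \<in> carrier U" for u
      by (rule hom_unique[OF k_algebra_ground _ h(1)]) (use \<open>?P h'\<close> h(3) that in simp_all)
  qed (use that h in auto)
  ultimately have "(THE \<epsilon>. ?P \<epsilon>) = h" by (rule the_equality)
  then have "\<epsilon> = h" by (simp add: uq_counit_def)
  then show "\<epsilon> \<in> algebra_hom U ground_algebra" "\<epsilon> (cl (free_gen q)) = counit_gen q" using h by simp_all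
qed

end


section \<open>Skew derivatives on the positive part\<close>

context k_algebra
begin

lemma linear_span_carrier: "\<lbrakk>S \<subseteq> carrier A; x \<in> linear_span A S\<rbrakk> \<Longrightarrow> x \<in> carrier A"
proof -
  assume S: "S \<subseteq> carrier A" and "x \<in> linear_span A S"
  from this(2) show ?thesis by induct (use S in auto)
qed

lemma linear_span_add:
  assumes S: "S \<subseteq> carrier A" and x: "x \<in> linear_span A S" and y: "y \<in> linear_span A S"
  shows "x \<oplus> y \<in> linear_span A S"
  using x
proof induct
  case zero
  then show ?case using linear_span_carrier[OF S y] y by simp
next
  case (step x v c)
  have "((c \<odot> x) \<oplus> v) \<oplus> y = (c \<odot> x) \<oplus> (v \<oplus> y)"
    using step S linear_span_carrier[OF S] y by (intro a_assoc) auto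
  then show ?case using step linear_span.step[of x S "v \<oplus> y" A c] by simp
qed

lemma linear_span_smult:
  assumes S: "S \<subseteq> carrier A" and x: "x \<in> linear_span A S"
  shows "k \<odot> x \<in> linear_span A S"
  using x
proof induct
  case zero
  then show ?case by (simp add: linear_span.zero)
next
  case (step x v c)
  have "k \<odot> ((c \<odot> x) \<oplus> v) = ((k * c) \<odot> x) \<oplus> k \<odot> v"
    using step S linear_span_carrier[OF S] by (subst sm_add_right) auto
  then show ?case using step linear_span.step[of x S "k \<odot> v" A "k * c"] by simp
qed

lemma linear_span_incl: assumes "S \<subseteq> carrier A" "x \<in> S" shows "x \<in> linear_span A S"
proof -
  have "x \<in> carrier A" using assms by auto
  then show ?thesis using linear_span.step[OF assms(2) linear_span.zero, of A 1] by simp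
qed

lemma linear_span_finsum:
  assumes S: "S \<subseteq> carrier A" and "finite I" "\<And>i. i \<in> I \<Longrightarrow> f i \<in> linear_span A S"
  shows "(\<Oplus>i\<in>I. f i) \<in> linear_span A S"
  using assms(2,3)
proof (induct I rule: finite_induct)
  case (insert i I)
  then have "(\<Oplus>j\<in>insert i I. f j) = f i \<oplus> (\<Oplus>j\<in>I. f j)"
    using linear_span_carrier[OF S] by (intro finsum_insert) auto
  then show ?case using insert linear_span_add[OF S] by simp
qed (simp add: linear_span.zero)

end

context two_parameter
begin

subsection \<open>Constant terms and lowering words\<close>

definition const_term :: "('i, 'k) free_alg \<Rightarrow> 'k" where
  "const_term = k_algebra.free_hom ground_algebra (\<lambda>_. 0)"

lemma const_term_simps [simp]:
  "const_term (x + y) = const_term x + const_term y" "const_term (x * y) = const_term x * const_term y" "const_term 1 = 1" "const_term (free_scalar c * x) = c * const_term x"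
  "const_term (free_gen l) = 0" "const_term 0 = 0"
proof -
  interpret G: k_algebra "ground_algebra :: ('k, 'k) module" by (rule k_algebra_ground)
  have c: "(\<lambda>_::'i. 0) l \<in> carrier (ground_algebra :: ('k, 'k) module)" for l by (simp add: ground_algebra_def)
  show "const_term (x + y) = const_term x + const_term y" "const_term (x * y) = const_term x * const_term y" "const_term 1 = 1" "const_term (free_scalar c * x) = c * const_term x"
    "const_term (free_gen l) = 0" "const_term 0 = 0"
    using G.free_hom_add[OF c, of x y] G.free_hom_mult[OF c, of x y] G.free_hom_one[OF c] G.free_hom_smult[OF c, of c x]
      G.free_hom_gen[OF c, of l] G.free_hom_zero[OF c]
    by (simp_all add: ground_algebra_def const_term_def)
qed

lemma const_term_scalar [simp]: "const_term (free_scalar c) = c"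
  using const_term_simps(4)[of c 1] unfolding mult_1_right const_term_simps(3) .

lemma const_term_diff [simp]: "const_term (x - y) = const_term x - const_term y" by (rule diff_by_add) simp

lemma const_term_diag [simp]: "const_term (diag g x) = const_term x"
  by (induct x rule: free_alg_induct) simp_all

lemma c0_E [simp]: "const_term (E i x) = 0"
  by (simp add: E_def)

text \<open>\<open>vanish n t\<close> says that fewer than \<open>n\<close> skew derivations never produce a constant term of \<open>t\<close>;
  it plays the role of a lower bound \<open>n\<close> for the degree of \<open>t\<close>, but only sees \<open>t\<close> modulo the
  largest stable subspace without constant terms.\<close>

definition vanish :: "nat \<Rightarrow> ('i, 'k) free_alg \<Rightarrow> bool" where
  "vanish n t \<longleftrightarrow> (\<forall>ws. length ws < n \<longrightarrow> const_term (foldr F ws t) = 0)"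

lemma foldr_F_linear:
  "foldr F ws (x + y) = foldr F ws x + foldr F ws y"
  "foldr F ws (free_scalar c * x) = free_scalar c * foldr F ws x" "foldr F ws 0 = 0"
  by (induct ws) simp_all

lemma foldr_F_diff: "foldr F ws (x - y) = foldr F ws x - foldr F ws y"
  by (rule diff_by_add) (rule foldr_F_linear)

lemma foldr_F_diag: "\<exists>k. \<forall>t. foldr F ws (diag g t) = free_scalar k * diag g (foldr F ws t)"
proof (induct ws)
  case Nil
  show ?case by (intro exI[of _ 1]) simp
next
  case (Cons l ws)
  then obtain k where "\<forall>t. foldr F ws (diag g t) = free_scalar k * diag g (foldr F ws t)" by blast
  then show ?case by (intro exI[of _ "k * g l"]) (simp add: F_diag)
qed

lemma const_term_foldr_diag: "const_term (foldr F ws t) = 0 \<Longrightarrow> const_term (foldr F ws (diag g t)) = 0"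
  using foldr_F_diag[of ws g] by auto

lemma vanish_add: "vanish n x \<Longrightarrow> vanish n y \<Longrightarrow> vanish n (x + y)"
  by (simp add: vanish_def foldr_F_linear)

lemma vanish_scalar: "vanish n x \<Longrightarrow> vanish n (free_scalar c * x)"
  by (simp add: vanish_def foldr_F_linear)

lemma vanish_zero: "vanish n 0"
  by (simp add: vanish_def foldr_F_linear)

lemma vanish_mono: "vanish n x \<Longrightarrow> m \<le> n \<Longrightarrow> vanish m x"
  by (auto simp: vanish_def)

lemma vanish_diag: "vanish n x \<Longrightarrow> vanish n (diag g x)"
  by (simp add: vanish_def const_term_foldr_diag)

lemma vanish_F: "vanish (Suc n) x \<Longrightarrow> vanish n (F l x)"
  unfolding vanish_def
proof (intro allI impI)
  fix ws :: "'i list" assume "\<forall>ws. length ws < Suc n \<longrightarrow> const_term (foldr F ws x) = 0" "length ws < n"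
  then have "const_term (foldr F (ws @ [l]) x) = 0" by (metis Suc_mono length_append_singleton)
  then show "const_term (foldr F ws (F l x)) = 0" by simp
qed

text \<open>Moving \<open>E i\<close> out through the skew derivations leaves terms with one derivation and one \<open>E i\<close> less,
  and \<open>E i\<close> itself produces no constant terms.\<close>

lemma vanish_E: "vanish n x \<Longrightarrow> vanish (Suc n) (E i x)"
proof -
  have "\<forall>x n. vanish n x \<longrightarrow> length ws < Suc n \<longrightarrow> const_term (foldr F ws (E i x)) = 0" for ws
  proof (induct ws rule: rev_induct)
    case (snoc l ws)
    show ?case
    proof (intro allI impI)
      fix x n assume x: "vanish n x" and n: "length (ws @ [l]) < Suc n"
      then obtain m where m: "n = Suc m" "length ws < Suc m" by (cases n) auto
      have "vanish m (F l x)" using x m vanish_F by simp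
      then have 1: "const_term (foldr F ws (E i (F l x))) = 0" using snoc m by simp
      have "const_term (foldr F ws x) = 0" using x n by (simp add: vanish_def)
      then have 2: "const_term (foldr F ws (diag g x)) = 0" for g by (rule const_term_foldr_diag)
      have "F l (E i x) = E i (F l x) - (if i = l then free_scalar (kappa i) * (Om i x - Om' i x) else 0)"
        using E_F[of i l x] by (simp add: algebra_simps)
      then show "const_term (foldr F (ws @ [l]) (E i x)) = 0"
        by (simp add: foldr_F_diff foldr_F_linear 1 2)
    qed
  qed simp
  then show "vanish n x \<Longrightarrow> vanish (Suc n) (E i x)" by (auto simp: vanish_def)
qed

lemma vanish_rho:
  assumes "\<And>n. vanish n t" shows "vanish n (rho x t)"
proof -
  have "\<forall>n. vanish n (rho x t)"
  proof (induct x rule: free_alg_induct)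
    case (gen q x)
    have "vanish n (E i (rho x t))" for i n by (rule vanish_mono[OF vanish_E[of n]]) (use gen in auto)
    then show ?case
      by (cases q) (use gen in \<open>auto intro: vanish_diag vanish_F\<close>)
  qed (use assms in \<open>auto intro: vanish_add vanish_scalar\<close>)
  then show ?thesis by simp
qed

text \<open>The vectors that satisfy \<open>vanish n\<close> for all \<open>n\<close> form the stable subspace by which the free algebra
  has to be divided to become a representation of \<open>U\<close>. The Serre operators in the \<open>E i\<close> map into it, since
  they commute with the skew derivations and produce no constant terms.\<close>

lemma vanish_relation:
  assumes "cl x = \<zero>\<^bsub>U\<^esub>" shows "vanish n (rho x t)"
proof -
  interpret endo: k_algebra endo by (rule k_algebra_endo)
  have "rho x t \<in> {t. \<forall>n. vanish n t}"
  proof (rule rho_relation_ideal)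
    fix i j :: 'i and t assume ij: "i \<noteq> j"
    have "const_term (endo.qserre (v i) (chi i j) (E i) (E j) m t) = 0" for m t
      by (induct m arbitrary: t) (simp_all add: endo.skew_comm_def endo_simps)
    then have 1: "const_term (rho (serre_e i j) t) = 0" for t by (simp add: rho_serre_e)
    have 2: "foldr F ws (rho (serre_e i j) t) = rho (serre_e i j) (foldr F ws t)" for ws
      by (induct ws) (simp_all add: rho_serre_e_F[OF ij])
    show "rho (serre_e i j) t \<in> {t. \<forall>n. vanish n t}"
      by (simp add: vanish_def 1 2)
  qed (use assms in \<open>auto intro: vanish_add vanish_zero vanish_rho\<close>)
  then show ?thesis by simp
qed

subsection \<open>Functionals detecting the generators\<close>

text \<open>A matrix coefficient of the action on the free algebra that is nonzero on \<open>e\<^sub>i \<omega>\<^sub>\<mu>\<close> and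
  vanishes on all other products of generators \<open>e\<^sub>j\<close> with some \<open>\<omega>\<^sub>\<mu>\<close>. The vector \<open>e\<^sub>i\<close> is used
  because the unit spans a trivial submodule.\<close>

definition phi :: "'i \<Rightarrow> ('i generator, 'k) free_alg set \<Rightarrow> 'k" where
  "phi i u = const_term (F i (F i (rho (SOME x. cl x = u) (free_gen i))))"

lemma phi_cl: "phi i (cl x) = const_term (F i (F i (rho x (free_gen i))))"
proof -
  have "cl (SOME x'. cl x' = cl x) = cl x" by (rule someI[of _ x]) simp
  then have "cl ((SOME x'. cl x' = cl x) - x) = \<zero>\<^bsub>U\<^esub>" by simp
  \<comment> \<open>The functional applies two skew derivations, fewer than three.\<close>
  from vanish_relation[OF this, of 3 "free_gen i"]
  have "const_term (foldr F [i, i] (rho ((SOME x'. cl x' = cl x) - x) (free_gen i))) = 0"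
    unfolding vanish_def by (metis One_nat_def Suc_1 length_Cons lessI list.size(3) numeral_3_eq_3)
  then show ?thesis by (simp add: phi_def)
qed

lemma phi_linear: "u \<in> carrier U \<Longrightarrow> u' \<in> carrier U \<Longrightarrow> phi i (u \<oplus>\<^bsub>U\<^esub> u') = phi i u + phi i u'"
  "u \<in> carrier U \<Longrightarrow> phi i (c \<odot>\<^bsub>U\<^esub> u) = c * phi i u"
  by (auto elim!: U_cases simp: phi_cl simp flip: cl_simps(2,4) simp del: cl_simps)

text \<open>The scalar by which \<open>\<omega>\<^sub>\<mu>\<close> acts in weight \<open>\<beta>\<close>; \<open>\<omega>\<^sub>\<mu>'\<close> acts by \<open>1 / pairing \<beta> \<mu>\<close>.\<close>

definition pairing :: "'i root_lattice \<Rightarrow> 'i root_lattice \<Rightarrow> 'k" where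
  "pairing \<mu> \<beta> = r powi euler_form a d \<beta> \<mu> * s powi (- euler_form a d \<mu> \<beta>)"

lemma euler_form_add:
  "euler_form a d (\<mu> + \<mu>') \<nu> = euler_form a d \<mu> \<nu> + euler_form a d \<mu>' \<nu>"
  "euler_form a d \<mu> (\<nu> + \<nu>') = euler_form a d \<mu> \<nu> + euler_form a d \<mu> \<nu>'"
  by (simp_all add: euler_form_def lookup_add algebra_simps sum.distrib)

lemma euler_form_simple_root: "euler_form a d (simple_root i) (simple_root j) = eul i j"
proof -
  have "euler_form a d (simple_root i) (simple_root j) =
      (\<Sum>k\<in>UNIV. \<Sum>l\<in>UNIV. if k = i then (if l = j then eul k l else 0) else 0)"
    unfolding euler_form_def simple_root_def lookup_single
    by (intro sum.cong refl) (auto simp: when_def)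
  also have "\<dots> = (\<Sum>k\<in>UNIV. if k = i then eul k j else 0)"
    by (intro sum.cong refl) simp
  finally show ?thesis by simp
qed

lemma pairing_add: "pairing (\<mu> + \<mu>') \<beta> = pairing \<mu> \<beta> * pairing \<mu>' \<beta>" "pairing \<mu> (\<beta> + \<beta>') = pairing \<mu> \<beta> * pairing \<mu> \<beta>'"
  using r_nonzero s_nonzero
  by (simp_all add: pairing_def euler_form_add power_int_add power_int_diff power_int_minus field_simps)

lemma pairing_simple_root: "pairing (simple_root i) (simple_root j) = chi i j"
  by (simp add: pairing_def chi_def euler_form_simple_root)

lemma pairing_nonzero [simp]: "pairing \<mu> \<beta> \<noteq> 0"
  using r_nonzero s_nonzero by (simp add: pairing_def power_int_not_zero)

lemma pairing_zero [simp]: "pairing 0 \<beta> = 1" "pairing \<mu> 0 = 1"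
  by (simp_all add: pairing_def euler_form_def)

lemma pairing_inverse: "1 / pairing \<beta> \<mu> = r powi (- euler_form a d \<mu> \<beta>) * s powi euler_form a d \<beta> \<mu>"
  by (simp add: pairing_def power_int_minus field_simps)

lemma Omega_lift: "\<exists>y. cl y = \<Omega> \<mu> \<and> (\<forall>t. rho y t = diag (\<lambda>l. pairing \<mu> (simple_root l)) t)"
proof (induct \<mu> rule: root_lattice_induct)
  case zero
  show ?case by (intro exI[of _ 1]) (simp add: diag_one)
next
  case (plus \<mu> j)
  then obtain y where "cl y = \<Omega> \<mu>" "\<And>t. rho y t = diag (\<lambda>l. pairing \<mu> (simple_root l)) t" by blast
  then show ?case
    by (intro exI[of _ "free_gen (Gen_om j) * y"]) (simp add: Omega_step diag_diag pairing_add pairing_simple_root)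
next
  case (minus \<mu> j)
  then obtain y where y: "cl y = \<Omega> (simple_root j + \<mu>)" "\<And>t. rho y t = diag (\<lambda>l. pairing (simple_root j + \<mu>) (simple_root l)) t" by blast
  have "cl (free_gen (Gen_om_inv j) * y) = \<Omega> \<mu>"
    using y(1) by (simp add: Omega_step flip: U.m_assoc)
  then show ?case
    using y(2) by (intro exI[of _ "free_gen (Gen_om_inv j) * y"]) (simp add: diag_diag pairing_add pairing_simple_root)
qed

lemma Omega'_lift: "\<exists>y. cl y = \<Omega>' \<mu> \<and> (\<forall>t. rho y t = diag (\<lambda>l. 1 / pairing (simple_root l) \<mu>) t)"
proof (induct \<mu> rule: root_lattice_induct)
  case zero
  show ?case by (intro exI[of _ 1]) (simp add: diag_one)
next
  case (plus \<mu> j)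
  then obtain y where "cl y = \<Omega>' \<mu>" "\<And>t. rho y t = diag (\<lambda>l. 1 / pairing (simple_root l) \<mu>) t" by blast
  then show ?case
    by (intro exI[of _ "free_gen (Gen_om' j) * y"]) (simp add: Omega_step diag_diag pairing_add pairing_simple_root)
next
  case (minus \<mu> j)
  then obtain y where y: "cl y = \<Omega>' (simple_root j + \<mu>)" "\<And>t. rho y t = diag (\<lambda>l. 1 / pairing (simple_root l) (simple_root j + \<mu>)) t" by blast
  have "cl (free_gen (Gen_om_inv' j) * y) = \<Omega>' \<mu>"
    using y(1) by (simp add: Omega_step flip: U.m_assoc)
  then show ?case
    using y(2) by (intro exI[of _ "free_gen (Gen_om_inv' j) * y"]) (simp add: diag_diag pairing_add pairing_simple_root)
qed

text \<open>The value of \<open>phi i\<close> at \<open>e\<^sub>i\<close>: the two derivations of \<open>E i (e\<^sub>i) = kappa i (1 - v i) e\<^sub>i e\<^sub>i\<close> give \<open>1 + 1 / v i\<close>.\<close>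

definition phi_const :: "'i \<Rightarrow> 'k" where
  "phi_const i = kappa i * (1 - v i) * (1 + 1 / v i)"

lemma phi_const_nonzero: "phi_const i \<noteq> 0"
proof -
  have "v i ^ 2 \<noteq> 1" "v i \<noteq> 1" using v_not_root[of 2 i] v_not_root[of 1 i] by auto
  then have "v i \<noteq> - 1" by auto
  then have "1 + 1 / v i \<noteq> 0" by (simp add: field_simps eq_neg_iff_add_eq_0)
  then show ?thesis using \<open>v i \<noteq> 1\<close> by (simp add: phi_const_def)
qed

lemma F_const [simp]: "F l (free_scalar c) = 0"
  using F_scalar[of l c 1] by simp

lemma phi_Omega: "phi i (\<Omega> \<mu>) = 0"
proof -
  obtain y where "cl y = \<Omega> \<mu>" "\<And>t. rho y t = diag (\<lambda>l. pairing \<mu> (simple_root l)) t"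
    using Omega_lift by blast
  then show ?thesis using phi_cl[of i y] by (simp add: F_gen)
qed

lemma phi_e_Omega: "phi i (e j \<otimes>\<^bsub>U\<^esub> \<Omega> \<mu>) = (if i = j then phi_const i * pairing \<mu> (simple_root i) else 0)"
proof -
  obtain y where y: "cl y = \<Omega> \<mu>" "\<And>t. rho y t = diag (\<lambda>l. pairing \<mu> (simple_root l)) t"
    using Omega_lift by blast
  have "phi i (e j \<otimes>\<^bsub>U\<^esub> \<Omega> \<mu>) = pairing \<mu> (simple_root i) * const_term (F i (F i (E j (free_gen i))))"
    using phi_cl[of i "gE j * y"] y by simp
  also have "const_term (F i (F i (E j (free_gen i)))) = (if i = j then phi_const i else 0)"
    by (simp add: E_def F_mult F_gen phi_const_def chi_diag free_scalar_left_commute[of 1] algebra_simps)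
  finally show ?thesis by simp
qed

lemma phi_monomial_Omega:
  assumes "length js \<ge> 2" shows "phi i (e_monomial a d r s js \<otimes>\<^bsub>U\<^esub> \<Omega> \<mu>) = 0"
proof -
  obtain y where y: "cl y = \<Omega> \<mu>" "\<And>t. rho y t = diag (\<lambda>l. pairing \<mu> (simple_root l)) t"
    using Omega_lift by blast
  \<comment> \<open>The word \<open>js\<close> raises the bound of \<open>e\<^sub>i\<close> from 1 to at least 3, beyond the two derivations in \<open>phi i\<close>.\<close>
  have "vanish 1 (free_gen i :: ('i, 'k) free_alg)" by (simp add: vanish_def)
  then have v1: "vanish 1 (rho y (free_gen i))" unfolding y(2) by (rule vanish_diag)
  have "vanish (Suc (length js)) (rho (\<Prod>j\<leftarrow>js. gE j) (rho y (free_gen i)))" for js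
    by (induct js) (use v1 vanish_E in auto)
  then have "vanish 3 (rho (\<Prod>j\<leftarrow>js. gE j) (rho y (free_gen i)))"
    by (rule vanish_mono) (use assms in simp)
  then have "const_term (foldr F [i, i] (rho (\<Prod>j\<leftarrow>js. gE j) (rho y (free_gen i)))) = 0"
    unfolding vanish_def by (metis One_nat_def Suc_1 length_Cons lessI list.size(3) numeral_3_eq_3)
  then show ?thesis
    using phi_cl[of i "(\<Prod>j\<leftarrow>js. gE j) * y"] y(1) by (simp add: e_monomial_def)
qed

text \<open>The map \<open>phi i \<otimes> id\<close> on \<open>U \<otimes> U\<close>.\<close>

definition phi_form :: "'i \<Rightarrow> ('i generator, 'k) free_alg set \<times> ('i generator, 'k) free_alg set \<Rightarrow> ('i generator, 'k) free_alg set" where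
  "phi_form i = (\<lambda>(u, z). phi i u \<odot>\<^bsub>U\<^esub> z)"

definition contract :: "'i \<Rightarrow> (('i generator, 'k) free_alg set \<times> ('i generator, 'k) free_alg set \<Rightarrow>\<^sub>0 'k) set \<Rightarrow> ('i generator, 'k) free_alg set" where
  "contract i = tensor_lift U (phi_form i)"

lemma phi_form_bilinear: "bilinear_form U U U (phi_form i)"
  by (simp add: bilinear_form_def phi_form_def phi_linear U.sm_add_left U.sm_add_right mult.commute)

lemma contract_simps:
  "x \<in> carrier U \<Longrightarrow> y \<in> carrier U \<Longrightarrow> contract i (pt x y) = phi i x \<odot>\<^bsub>U\<^esub> y"
  "t \<in> carrier TT \<Longrightarrow> contract i t \<in> carrier U"
  "t \<in> carrier TT \<Longrightarrow> t' \<in> carrier TT \<Longrightarrow> contract i (t \<oplus>\<^bsub>TT\<^esub> t') = contract i t \<oplus>\<^bsub>U\<^esub> contract i t'"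
  "t \<in> carrier TT \<Longrightarrow> contract i (c \<odot>\<^bsub>TT\<^esub> t) = c \<odot>\<^bsub>U\<^esub> contract i t"
  unfolding contract_def
  using W.tensor_lift_pure[OF k_algebra_U phi_form_bilinear] W.tensor_lift_closed[OF k_algebra_U phi_form_bilinear]
    W.tensor_lift_add[OF k_algebra_U phi_form_bilinear] W.tensor_lift_smult[OF k_algebra_U phi_form_bilinear]
  by (simp_all add: phi_form_def)

lemma contract_zero: "contract i \<zero>\<^bsub>TT\<^esub> = \<zero>\<^bsub>U\<^esub>"
  using contract_simps(4)[of "\<zero>\<^bsub>TT\<^esub>" i 0] by (simp add: contract_simps(2))

lemma contract_finsum: "finite S \<Longrightarrow> (\<And>j. j \<in> S \<Longrightarrow> g j \<in> carrier TT) \<Longrightarrow>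
    contract i (\<Oplus>\<^bsub>TT\<^esub>j\<in>S. g j) = (\<Oplus>\<^bsub>U\<^esub>j\<in>S. contract i (g j))"
  by (induct S rule: finite_induct) (simp_all add: contract_zero contract_simps Pi_def)

subsection \<open>Weight spaces\<close>

definition wd :: "'i list \<Rightarrow> ('i, 'k) free_alg" where "wd js = (\<Prod>j\<leftarrow>js. free_gen j)"
definition wt :: "'i list \<Rightarrow> 'i root_lattice" where "wt js = sum_list (map simple_root js)"

lemma wd_simps [simp]: "wd [] = 1" "wd (j # js) = free_gen j * wd js"
  by (simp_all add: wd_def)

lemma wt_simps [simp]: "wt [] = 0" "wt (j # js) = simple_root j + wt js"
  by (simp_all add: wt_def)

lemma eta_wd: "eta (wd js) = e_monomial a d r s js"
proof -
  have "incl (wd js) = (\<Prod>j\<leftarrow>js. gE j)" by (induct js) simp_all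
  then show ?thesis by (simp add: eta_def e_monomial_def)
qed

lemma e_monomial_closed [simp]: "e_monomial a d r s js \<in> carrier U"
  by (simp add: e_monomial_def)

lemma wd_single: "Poly_Mapping.single (Word js) c = free_scalar c * wd js"
proof -
  have "wd js = Poly_Mapping.single (Word js) 1"
    by (induct js) (simp_all add: free_gen_def mult_single plus_free_monoid_def zero_free_monoid_def[symmetric])
  then show ?thesis by (simp add: free_scalar_def mult_single)
qed

text \<open>A lift of the component of weight \<open>\<beta>\<close> to the free algebra.\<close>

inductive_set homog :: "'i root_lattice \<Rightarrow> ('i, 'k) free_alg set" for \<beta> where
  zero: "0 \<in> homog \<beta>"
| step: "wt js = \<beta> \<Longrightarrow> t \<in> homog \<beta> \<Longrightarrow> free_scalar c * wd js + t \<in> homog \<beta>"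

lemma homog_add: "x \<in> homog \<beta> \<Longrightarrow> y \<in> homog \<beta> \<Longrightarrow> x + y \<in> homog \<beta>"
  by (induct rule: homog.induct) (auto simp: add.assoc intro: homog.step)

lemma homog_scalar: "x \<in> homog \<beta> \<Longrightarrow> free_scalar k * x \<in> homog \<beta>"
proof (induct rule: homog.induct)
  case (step js t c)
  then show ?case using homog.step[of js \<beta> "free_scalar k * t" "k * c"] by (simp add: distrib_left)
qed (simp add: homog.zero)

lemma homog_gen: "x \<in> homog \<beta> \<Longrightarrow> free_gen j * x \<in> homog (simple_root j + \<beta>)"
proof (induct rule: homog.induct)
  case (step js t c)
  then show ?case using homog.step[of "j # js" "simple_root j + \<beta>" "free_gen j * t" c] by (simp add: distrib_left)
qed (simp add: homog.zero)

lemma homog_wd: "wt js = \<beta> \<Longrightarrow> wd js \<in> homog \<beta>"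
  using homog.step[OF _ homog.zero, of js \<beta> 1] by simp

lemma component_eq: "uq_plus_component a d r s \<beta> = eta ` homog \<beta>"
proof
  show "uq_plus_component a d r s \<beta> \<subseteq> eta ` homog \<beta>"
  proof
    fix x assume "x \<in> uq_plus_component a d r s \<beta>"
    then show "x \<in> eta ` homog \<beta>"
      unfolding uq_plus_component_def
    proof induct
      case zero
      show ?case by (rule image_eqI[of _ _ 0]) (simp_all add: homog.zero)
    next
      case (step x u c)
      then obtain js t where "x = e_monomial a d r s js" "wt js = \<beta>" "u = eta t" "t \<in> homog \<beta>"
        by (auto simp: wt_def)
      then show ?case
        by (intro image_eqI[of _ _ "free_scalar c * wd js + t"]) (simp_all add: eta_wd homog.step)
    qed
  qed
  show "eta ` homog \<beta> \<subseteq> uq_plus_component a d r s \<beta>"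
  proof clarify
    fix t assume "t \<in> homog \<beta>"
    then show "eta t \<in> uq_plus_component a d r s \<beta>"
      unfolding uq_plus_component_def
    proof induct
      case (step js t c)
      then show ?case
        using linear_span.step[of "e_monomial a d r s js" "{e_monomial a d r s js |js. sum_list (map simple_root js) = \<beta>}" "eta t" "uq a d r s" c]
        by (auto simp: eta_wd wt_def)
    qed (simp add: linear_span.zero)
  qed
qed

lemma diag_homog:
  assumes "t \<in> homog \<beta>"
  shows "diag (\<lambda>l. pairing \<mu> (simple_root l)) t = free_scalar (pairing \<mu> \<beta>) * t"
    and "diag (\<lambda>l. pairing (simple_root l) \<mu>) t = free_scalar (pairing \<beta> \<mu>) * t"
    and "diag (\<lambda>l. 1 / pairing (simple_root l) \<mu>) t = free_scalar (1 / pairing \<beta> \<mu>) * t"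
proof -
  have wd: "diag (\<lambda>l. pairing \<mu> (simple_root l)) (wd js) = free_scalar (pairing \<mu> (wt js)) * wd js"
    "diag (\<lambda>l. pairing (simple_root l) \<mu>) (wd js) = free_scalar (pairing (wt js) \<mu>) * wd js"
    "diag (\<lambda>l. 1 / pairing (simple_root l) \<mu>) (wd js) = free_scalar (1 / pairing (wt js) \<mu>) * wd js" for js
    by (induct js) (simp_all add: pairing_add mult.assoc)
  show "diag (\<lambda>l. pairing \<mu> (simple_root l)) t = free_scalar (pairing \<mu> \<beta>) * t"
    using assms by induct (auto simp: wd distrib_left mult.commute)
  show "diag (\<lambda>l. pairing (simple_root l) \<mu>) t = free_scalar (pairing \<beta> \<mu>) * t"
    using assms by induct (auto simp: wd distrib_left mult.commute)
  show "diag (\<lambda>l. 1 / pairing (simple_root l) \<mu>) t = free_scalar (1 / pairing \<beta> \<mu>) * t"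
    using assms by induct (auto simp: wd distrib_left mult.commute)
qed

text \<open>Undoing the twist by \<open>\<omega>\<^sub>i'\<close> in \<open>F i\<close> gives a lift of the skew derivative to the free algebra.\<close>

definition G :: "'i \<Rightarrow> ('i, 'k) free_alg \<Rightarrow> ('i, 'k) free_alg" where
  "G i t = diag (\<lambda>l. chi l i) (F i t)"

lemma G_simps [simp]:
  "G i (x + y) = G i x + G i y" "G i (free_scalar c * x) = free_scalar c * G i x" "G i 1 = 0" "G i 0 = 0"
  "G i (free_gen j * x) = free_scalar (chi j i) * (free_gen j * G i x) + (if j = i then x else 0)"
  by (simp_all add: G_def mult.assoc diag_diag diag_one)

lemma G_homog: "t \<in> homog \<beta> \<Longrightarrow> G i t \<in> homog (\<beta> - simple_root i)"
proof (induct rule: homog.induct)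
  case (step js t c)
  have "G i (wd js) \<in> homog (wt js - simple_root i)" for js
  proof (induct js)
    case (Cons j js)
    have "free_gen j * G i (wd js) \<in> homog (wt (j # js) - simple_root i)"
      using homog_gen[OF Cons, of j] by (simp add: add_diff_eq)
    moreover have "(if j = i then wd js else 0) \<in> homog (wt (j # js) - simple_root i)"
      by (simp add: homog_wd homog.zero)
    ultimately show ?case unfolding wd_simps G_simps by (intro homog_add homog_scalar)
  qed (simp add: homog.zero)
  from this[of js] show ?case using step by (auto intro!: homog_add homog_scalar)
qed (simp add: homog.zero)

lemma plus_carrier: "carrier (uq_plus a d r s) = range eta"
proof -
  have "subalgebra_generated U (range (uq_e a d r s)) = range eta"
  proof
    show "subalgebra_generated U (range (uq_e a d r s)) \<subseteq> range eta"
    proof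
      fix x assume "x \<in> subalgebra_generated U (range (uq_e a d r s))"
      then show "x \<in> range eta"
      proof induct
        case (incl x)
        then obtain l where "x = uq_e a d r s l" by auto
        then have "x = eta (free_gen l)" by (simp only: eta_simps(5))
        then show ?case by (rule range_eqI)
      next
        case one
        show ?case by (rule range_eqI[of _ _ 1]) simp
      next
        case (add x y)
        then obtain t t' where "x = eta t" "y = eta t'" by auto
        then show ?case by (intro range_eqI[of _ _ "t + t'"]) simp
      next
        case (smult x c)
        then obtain t where "x = eta t" by auto
        then show ?case by (intro range_eqI[of _ _ "free_scalar c * t"]) simp
      next
        case (mult x y)
        then obtain t t' where "x = eta t" "y = eta t'" by auto
        then show ?case by (intro range_eqI[of _ _ "t * t'"]) simp
      qed
    qed
    have "eta t \<in> subalgebra_generated U (range (uq_e a d r s))" for t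
    proof (induct t rule: free_alg_induct)
      case one
      show ?case unfolding eta_simps by (rule subalgebra_generated.one)
    next
      case (add x y)
      then show ?case unfolding eta_simps by (rule subalgebra_generated.add)
    next
      case (smult c x)
      then show ?case unfolding eta_simps(4) by (rule subalgebra_generated.smult)
    next
      case (gen l x)
      show ?case unfolding eta_simps(2,5)
        by (rule subalgebra_generated.mult[OF subalgebra_generated.incl[OF rangeI] gen])
    qed
    then show "range eta \<subseteq> subalgebra_generated U (range (uq_e a d r s))" by auto
  qed
  then show ?thesis by (simp add: uq_plus_def)
qed

end


context two_parameter
begin

subsection \<open>The comultiplication up to first order\<close>

abbreviation "S2 \<equiv> {pt (e_monomial a d r s js \<otimes>\<^bsub>U\<^esub> \<Omega> \<mu>) z | js \<mu> z. length js \<ge> 2 \<and> z \<in> carrier (uq_plus a d r s)}"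
abbreviation "higher \<equiv> linear_span TT S2"

lemma S2_carrier: "S2 \<subseteq> carrier TT"
  by (auto simp: plus_carrier)

lemmas higher_carrier = W.TA.linear_span_carrier[OF S2_carrier]
lemmas higher_add = W.TA.linear_span_add[OF S2_carrier]
lemmas higher_smult = W.TA.linear_span_smult[OF S2_carrier]

lemma S2_intro: assumes "length js \<ge> 2" shows "pt (e_monomial a d r s js \<otimes>\<^bsub>U\<^esub> \<Omega> \<mu>) (eta t) \<in> higher"
proof (rule W.TA.linear_span_incl[OF S2_carrier])
  show "pt (e_monomial a d r s js \<otimes>\<^bsub>U\<^esub> \<Omega> \<mu>) (eta t) \<in> S2"
    unfolding mem_Collect_eq
    by (intro exI[of _ js] exI[of _ \<mu>] exI[of _ "eta t"] conjI refl assms) (simp add: plus_carrier)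
qed

lemma om_eta: "\<omega> i \<otimes>\<^bsub>U\<^esub> eta t = eta (Om i t) \<otimes>\<^bsub>U\<^esub> \<omega> i" "\<omega>' i \<otimes>\<^bsub>U\<^esub> eta t = eta (Om' i t) \<otimes>\<^bsub>U\<^esub> \<omega>' i"
proof -
  have step: "w \<otimes>\<^bsub>U\<^esub> (e l \<otimes>\<^bsub>U\<^esub> x) = (c \<odot>\<^bsub>U\<^esub> e l \<otimes>\<^bsub>U\<^esub> y) \<otimes>\<^bsub>U\<^esub> w"
    if "w \<otimes>\<^bsub>U\<^esub> e l = c \<odot>\<^bsub>U\<^esub> (e l \<otimes>\<^bsub>U\<^esub> w)" "w \<otimes>\<^bsub>U\<^esub> x = y \<otimes>\<^bsub>U\<^esub> w" "w \<in> carrier U" "x \<in> carrier U" "y \<in> carrier U"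
    for w x y c l
  proof -
    have "w \<otimes>\<^bsub>U\<^esub> (e l \<otimes>\<^bsub>U\<^esub> x) = (w \<otimes>\<^bsub>U\<^esub> e l) \<otimes>\<^bsub>U\<^esub> x" using that(3-5) by (simp add: U.m_assoc)
    also have "\<dots> = c \<odot>\<^bsub>U\<^esub> (e l \<otimes>\<^bsub>U\<^esub> (w \<otimes>\<^bsub>U\<^esub> x))" using that(3-5) by (simp add: that(1) U.m_assoc)
    finally show ?thesis using that(3-5) by (simp add: that(2) U.m_assoc)
  qed
  show "\<omega> i \<otimes>\<^bsub>U\<^esub> eta t = eta (Om i t) \<otimes>\<^bsub>U\<^esub> \<omega> i"
  proof (induct t rule: free_alg_induct)
    case (gen l x)
    then show ?case using step[OF om_move(1)[of i l] gen] by simp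
  qed (simp_all add: U.l_distr U.r_distr)
  show "\<omega>' i \<otimes>\<^bsub>U\<^esub> eta t = eta (Om' i t) \<otimes>\<^bsub>U\<^esub> \<omega>' i"
  proof (induct t rule: free_alg_induct)
    case (gen l x)
    then show ?case using step[OF om_move(2)[of i l] gen] by simp
  qed (simp_all add: U.l_distr U.r_distr)
qed

lemma om_monomial: "\<omega> j \<otimes>\<^bsub>U\<^esub> e_monomial a d r s js = pairing (simple_root j) (wt js) \<odot>\<^bsub>U\<^esub> (e_monomial a d r s js \<otimes>\<^bsub>U\<^esub> \<omega> j)"
  using om_eta(1)[of j "wd js"] diag_homog(1)[OF homog_wd[OF refl], of "simple_root j" js]
  by (simp add: eta_wd pairing_simple_root)

lemma e_monomial_Cons: "e j \<otimes>\<^bsub>U\<^esub> e_monomial a d r s js = e_monomial a d r s (j # js)"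
  by (simp add: e_monomial_def)

lemma higher_left:
  assumes "t \<in> higher" shows "comult_gen (Gen_e j) \<otimes>\<^bsub>TT\<^esub> t \<in> higher"
  using assms
proof induct
  case zero
  show ?case using comult_gen_closed by (simp add: linear_span.zero del: comult_gen.simps)
next
  case (step x u c)
  then obtain js \<mu> t where x: "x = pt (e_monomial a d r s js \<otimes>\<^bsub>U\<^esub> \<Omega> \<mu>) (eta t)" "length js \<ge> 2"
    by (auto simp: plus_carrier)
  have xc: "x \<in> carrier TT" "u \<in> carrier TT" using x step higher_carrier by simp_all
  have "\<omega> j \<otimes>\<^bsub>U\<^esub> (e_monomial a d r s js \<otimes>\<^bsub>U\<^esub> \<Omega> \<mu>) =
      pairing (simple_root j) (wt js) \<odot>\<^bsub>U\<^esub> (e_monomial a d r s js \<otimes>\<^bsub>U\<^esub> \<Omega> (simple_root j + \<mu>))"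
    by (simp add: Omega_step om_monomial flip: U.m_assoc)
  then have "comult_gen (Gen_e j) \<otimes>\<^bsub>TT\<^esub> x = pt (e_monomial a d r s (j # js) \<otimes>\<^bsub>U\<^esub> \<Omega> \<mu>) (eta t) \<oplus>\<^bsub>TT\<^esub>
      pairing (simple_root j) (wt js) \<odot>\<^bsub>TT\<^esub> pt (e_monomial a d r s js \<otimes>\<^bsub>U\<^esub> \<Omega> (simple_root j + \<mu>)) (eta (free_gen j * t))"
    by (simp add: x W.TA.l_distr flip: e_monomial_Cons) (simp add: U.m_assoc)
  moreover have "\<dots> \<in> higher"
    using x(2) by (intro higher_add higher_smult S2_intro) auto
  ultimately have gx: "comult_gen (Gen_e j) \<otimes>\<^bsub>TT\<^esub> x \<in> higher" by simp
  have "comult_gen (Gen_e j) \<otimes>\<^bsub>TT\<^esub> (c \<odot>\<^bsub>TT\<^esub> x \<oplus>\<^bsub>TT\<^esub> u) =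
      c \<odot>\<^bsub>TT\<^esub> (comult_gen (Gen_e j) \<otimes>\<^bsub>TT\<^esub> x) \<oplus>\<^bsub>TT\<^esub> comult_gen (Gen_e j) \<otimes>\<^bsub>TT\<^esub> u"
    using xc comult_gen_closed[of "Gen_e j"] by (simp add: W.TA.r_distr del: comult_gen.simps)
  then show ?case using gx step by (simp add: higher_add higher_smult del: comult_gen.simps)
qed

definition first_order :: "'i root_lattice \<Rightarrow> ('i \<Rightarrow> ('i generator, 'k) free_alg set) \<Rightarrow> (('i generator, 'k) free_alg set \<times> ('i generator, 'k) free_alg set \<Rightarrow>\<^sub>0 'k) set" where
  "first_order \<beta> y = (\<Oplus>\<^bsub>TT\<^esub>i\<in>UNIV. pt (e i \<otimes>\<^bsub>U\<^esub> \<Omega> (\<beta> - simple_root i)) (y i))"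

lemma first_order_closed: "(\<And>i. y i \<in> carrier U) \<Longrightarrow> first_order \<beta> y \<in> carrier TT"
  unfolding first_order_def by (rule W.TA.finsum_closed) auto

lemma first_order_add: "\<lbrakk>\<And>i. y i \<in> carrier U; \<And>i. z i \<in> carrier U\<rbrakk> \<Longrightarrow>
    first_order \<beta> (\<lambda>i. y i \<oplus>\<^bsub>U\<^esub> z i) = first_order \<beta> y \<oplus>\<^bsub>TT\<^esub> first_order \<beta> z"
  unfolding first_order_def
  by (subst W.TA.finsum_addf[symmetric]) (auto simp: W.pt_add_right)

lemma first_order_smult: "(\<And>i. y i \<in> carrier U) \<Longrightarrow>
    first_order \<beta> (\<lambda>i. c \<odot>\<^bsub>U\<^esub> y i) = c \<odot>\<^bsub>TT\<^esub> first_order \<beta> y"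
  unfolding first_order_def
  by (subst W.TA.finsum_sm) auto

lemma first_order_zero: "first_order \<beta> (\<lambda>i. \<zero>\<^bsub>U\<^esub>) = \<zero>\<^bsub>TT\<^esub>"
  unfolding first_order_def by (simp add: W.TA.finsum_zero)

text \<open>In \<open>\<Delta> e\<^sub>j = e\<^sub>j \<otimes> 1 + \<omega>\<^sub>j \<otimes> e\<^sub>j\<close> the second summand acts on each first-order term, and the first
  summand turns \<open>\<omega>\<^sub>\<beta> \<otimes> x\<close> into the first-order term \<open>e\<^sub>j \<omega>\<^sub>\<beta> \<otimes> x\<close>; everything else has two letters on the left.\<close>

lemma comult_e_first_order:
  assumes y: "\<And>i. y i = eta (g i)" and x: "x \<in> carrier U"
  shows "\<exists>t\<in>higher. comult_gen (Gen_e j) \<otimes>\<^bsub>TT\<^esub> (pt (\<Omega> \<beta>) x \<oplus>\<^bsub>TT\<^esub> first_order \<beta> y) =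
    pt (\<Omega> (simple_root j + \<beta>)) (e j \<otimes>\<^bsub>U\<^esub> x) \<oplus>\<^bsub>TT\<^esub>
    first_order (simple_root j + \<beta>) (\<lambda>i. chi j i \<odot>\<^bsub>U\<^esub> (e j \<otimes>\<^bsub>U\<^esub> y i) \<oplus>\<^bsub>U\<^esub> (if j = i then x else \<zero>\<^bsub>U\<^esub>)) \<oplus>\<^bsub>TT\<^esub> t"
proof -
  let ?g = "comult_gen (Gen_e j)" and ?\<beta> = "simple_root j + \<beta>"
  have yc: "y i \<in> carrier U" for i by (simp add: y)
  have gc: "?g \<in> carrier TT" by (rule comult_gen_closed)
  define A where "A i = e i \<otimes>\<^bsub>U\<^esub> \<Omega> (\<beta> - simple_root i)" for i
  have Ac: "A i \<in> carrier U" for i by (simp add: A_def)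
  define t where "t = (\<Oplus>\<^bsub>TT\<^esub>i\<in>UNIV. pt (e j \<otimes>\<^bsub>U\<^esub> A i) (y i))"
  have th: "t \<in> higher"
    unfolding t_def
  proof (rule W.TA.linear_span_finsum[OF S2_carrier])
    show "pt (e j \<otimes>\<^bsub>U\<^esub> A i) (y i) \<in> higher" for i
    proof -
      have "e j \<otimes>\<^bsub>U\<^esub> A i = e_monomial a d r s [j, i] \<otimes>\<^bsub>U\<^esub> \<Omega> (\<beta> - simple_root i)"
        by (simp add: A_def e_monomial_def U.m_assoc)
      then show ?thesis unfolding y by (simp only:) (rule S2_intro, simp)
    qed
  qed simp
  have "\<omega> j \<otimes>\<^bsub>U\<^esub> A i = chi j i \<odot>\<^bsub>U\<^esub> (e i \<otimes>\<^bsub>U\<^esub> \<Omega> (?\<beta> - simple_root i))" for i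
  proof -
    have "\<omega> j \<otimes>\<^bsub>U\<^esub> A i = chi j i \<odot>\<^bsub>U\<^esub> (e i \<otimes>\<^bsub>U\<^esub> (\<omega> j \<otimes>\<^bsub>U\<^esub> \<Omega> (\<beta> - simple_root i)))"
      by (simp add: A_def om_move flip: U.m_assoc)
    then show ?thesis by (simp add: add_diff_eq flip: Omega_step)
  qed
  then have gA: "?g \<otimes>\<^bsub>TT\<^esub> pt (A i) (y i) = pt (e j \<otimes>\<^bsub>U\<^esub> A i) (y i) \<oplus>\<^bsub>TT\<^esub>
      pt (e i \<otimes>\<^bsub>U\<^esub> \<Omega> (?\<beta> - simple_root i)) (chi j i \<odot>\<^bsub>U\<^esub> (e j \<otimes>\<^bsub>U\<^esub> y i))" for i
    using yc Ac by (simp add: W.TA.l_distr)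
  let ?z = "\<lambda>i. chi j i \<odot>\<^bsub>U\<^esub> (e j \<otimes>\<^bsub>U\<^esub> y i)"
  have "?g \<otimes>\<^bsub>TT\<^esub> first_order \<beta> y = (\<Oplus>\<^bsub>TT\<^esub>i\<in>UNIV. ?g \<otimes>\<^bsub>TT\<^esub> pt (A i) (y i))"
    unfolding first_order_def A_def[symmetric]
    by (rule W.TA.finsum_rdistr) (use gc Ac yc in auto)
  also have "\<dots> = t \<oplus>\<^bsub>TT\<^esub> first_order ?\<beta> ?z"
    unfolding gA t_def first_order_def by (rule W.TA.finsum_addf) (use Ac yc in auto)
  finally have 1: "?g \<otimes>\<^bsub>TT\<^esub> first_order \<beta> y = t \<oplus>\<^bsub>TT\<^esub> first_order ?\<beta> ?z" .
  have 2: "?g \<otimes>\<^bsub>TT\<^esub> pt (\<Omega> \<beta>) x = pt (e j \<otimes>\<^bsub>U\<^esub> \<Omega> \<beta>) x \<oplus>\<^bsub>TT\<^esub> pt (\<Omega> ?\<beta>) (e j \<otimes>\<^bsub>U\<^esub> x)"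
    using x by (simp add: W.TA.l_distr Omega_step)
  have 3: "first_order ?\<beta> (\<lambda>i. if j = i then x else \<zero>\<^bsub>U\<^esub>) = pt (e j \<otimes>\<^bsub>U\<^esub> \<Omega> \<beta>) x"
  proof -
    have "first_order ?\<beta> (\<lambda>i. if j = i then x else \<zero>\<^bsub>U\<^esub>) =
        (\<Oplus>\<^bsub>TT\<^esub>i\<in>UNIV. if j = i then pt (e i \<otimes>\<^bsub>U\<^esub> \<Omega> (?\<beta> - simple_root i)) x else \<zero>\<^bsub>TT\<^esub>)"
      unfolding first_order_def using x by (intro W.TA.finsum_cong') auto
    also have "\<dots> = pt (e j \<otimes>\<^bsub>U\<^esub> \<Omega> (?\<beta> - simple_root j)) x"
      using x by (intro W.TA.finsum_singleton) auto
    finally show ?thesis by simp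
  qed
  have 4: "first_order ?\<beta> (\<lambda>i. ?z i \<oplus>\<^bsub>U\<^esub> (if j = i then x else \<zero>\<^bsub>U\<^esub>)) = first_order ?\<beta> ?z \<oplus>\<^bsub>TT\<^esub> pt (e j \<otimes>\<^bsub>U\<^esub> \<Omega> \<beta>) x"
    unfolding 3[symmetric] by (rule first_order_add) (use x yc in auto)
  have "first_order ?\<beta> ?z \<in> carrier TT" "first_order \<beta> y \<in> carrier TT"
    by (rule first_order_closed; simp add: yc)+
  then show ?thesis
    using gc x th higher_carrier[OF th] by (intro bexI[of _ t])
      (simp_all add: W.TA.r_distr 1 2 4 W.TA.a_ac del: comult_gen.simps)
qed

lemma comult_eta_wd:
  "\<exists>t\<in>higher. \<Delta> (eta (wd js)) = pt (\<Omega> (wt js)) (eta (wd js)) \<oplus>\<^bsub>TT\<^esub> first_order (wt js) (\<lambda>i. eta (G i (wd js))) \<oplus>\<^bsub>TT\<^esub> t"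
proof (induct js)
  case Nil
  show ?case
    by (intro bexI[of _ "\<zero>\<^bsub>TT\<^esub>"])
      (simp_all add: algebra_homD(4)[OF comult(1)] W.pt_one first_order_zero linear_span.zero)
next
  case (Cons j js)
  then obtain t where t: "t \<in> higher"
    "\<Delta> (eta (wd js)) = pt (\<Omega> (wt js)) (eta (wd js)) \<oplus>\<^bsub>TT\<^esub> first_order (wt js) (\<lambda>i. eta (G i (wd js))) \<oplus>\<^bsub>TT\<^esub> t" by blast
  let ?g = "comult_gen (Gen_e j)"
  obtain t' where t': "t' \<in> higher" "?g \<otimes>\<^bsub>TT\<^esub> (pt (\<Omega> (wt js)) (eta (wd js)) \<oplus>\<^bsub>TT\<^esub> first_order (wt js) (\<lambda>i. eta (G i (wd js)))) =
    pt (\<Omega> (simple_root j + wt js)) (e j \<otimes>\<^bsub>U\<^esub> eta (wd js)) \<oplus>\<^bsub>TT\<^esub>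
    first_order (simple_root j + wt js) (\<lambda>i. chi j i \<odot>\<^bsub>U\<^esub> (e j \<otimes>\<^bsub>U\<^esub> eta (G i (wd js))) \<oplus>\<^bsub>U\<^esub> (if j = i then eta (wd js) else \<zero>\<^bsub>U\<^esub>)) \<oplus>\<^bsub>TT\<^esub> t'"
    using comult_e_first_order[of "\<lambda>i. eta (G i (wd js))" "\<lambda>i. G i (wd js)" "eta (wd js)" j "wt js"] by auto
  have fc: "first_order \<beta> (\<lambda>i. eta (h i)) \<in> carrier TT" for \<beta> h by (rule first_order_closed) simp
  have G: "(\<lambda>i. chi j i \<odot>\<^bsub>U\<^esub> (e j \<otimes>\<^bsub>U\<^esub> eta (G i (wd js))) \<oplus>\<^bsub>U\<^esub> (if j = i then eta (wd js) else \<zero>\<^bsub>U\<^esub>)) = (\<lambda>i. eta (G i (wd (j # js))))"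
    by (auto simp: fun_eq_iff)
  have gc: "?g \<in> carrier TT" by (rule comult_gen_closed)
  have "\<Delta> (eta (wd (j # js))) = ?g \<otimes>\<^bsub>TT\<^esub> \<Delta> (eta (wd js))"
    using algebra_homD(2)[OF comult(1), of "e j" "eta (wd js)"] comult(2)[of "Gen_e j"] by simp
  also have "\<dots> = ?g \<otimes>\<^bsub>TT\<^esub> (pt (\<Omega> (wt js)) (eta (wd js)) \<oplus>\<^bsub>TT\<^esub> first_order (wt js) (\<lambda>i. eta (G i (wd js)))) \<oplus>\<^bsub>TT\<^esub> ?g \<otimes>\<^bsub>TT\<^esub> t"
    unfolding t(2) by (rule W.TA.r_distr) (use gc fc higher_carrier t in auto)
  also have "\<dots> = pt (\<Omega> (wt (j # js))) (eta (wd (j # js))) \<oplus>\<^bsub>TT\<^esub> first_order (wt (j # js)) (\<lambda>i. eta (G i (wd (j # js)))) \<oplus>\<^bsub>TT\<^esub> (t' \<oplus>\<^bsub>TT\<^esub> ?g \<otimes>\<^bsub>TT\<^esub> t)"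
    unfolding t'(2) G using fc[of _ "\<lambda>i. G i (wd (j # js))"] higher_carrier[OF t'(1)] higher_carrier[OF higher_left[OF t(1), of j]]
    by (simp add: W.TA.a_assoc del: comult_gen.simps G_simps)
  finally show ?case using higher_add[OF t'(1) higher_left[OF t(1)]] by blast
qed

lemma comult_eta:
  assumes "t \<in> homog \<beta>"
  shows "\<exists>z\<in>higher. \<Delta> (eta t) = pt (\<Omega> \<beta>) (eta t) \<oplus>\<^bsub>TT\<^esub> first_order \<beta> (\<lambda>i. eta (G i t)) \<oplus>\<^bsub>TT\<^esub> z"
  using assms
proof induct
  case zero
  show ?case
    by (intro bexI[of _ "\<zero>\<^bsub>TT\<^esub>"])
      (simp_all add: algebra_hom_zero[OF k_algebra_U W.k_algebra_tensor comult(1)] first_order_zero linear_span.zero)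
next
  case (step js t c)
  then obtain z where z: "z \<in> higher" "\<Delta> (eta t) = pt (\<Omega> \<beta>) (eta t) \<oplus>\<^bsub>TT\<^esub> first_order \<beta> (\<lambda>i. eta (G i t)) \<oplus>\<^bsub>TT\<^esub> z"
    by blast
  obtain z' where z': "z' \<in> higher" "\<Delta> (eta (wd js)) = pt (\<Omega> \<beta>) (eta (wd js)) \<oplus>\<^bsub>TT\<^esub> first_order \<beta> (\<lambda>i. eta (G i (wd js))) \<oplus>\<^bsub>TT\<^esub> z'"
    using comult_eta_wd[of js] step by auto
  have fc: "first_order \<beta> (\<lambda>i. eta (h i)) \<in> carrier TT" for h by (rule first_order_closed) simp
  have "first_order \<beta> (\<lambda>i. eta (G i (free_scalar c * wd js + t))) =
      c \<odot>\<^bsub>TT\<^esub> first_order \<beta> (\<lambda>i. eta (G i (wd js))) \<oplus>\<^bsub>TT\<^esub> first_order \<beta> (\<lambda>i. eta (G i t))"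
    unfolding G_simps eta_simps(1,4)
    by (subst first_order_add) (simp_all add: first_order_smult)
  moreover have "\<Delta> (eta (free_scalar c * wd js + t)) = c \<odot>\<^bsub>TT\<^esub> \<Delta> (eta (wd js)) \<oplus>\<^bsub>TT\<^esub> \<Delta> (eta t)"
    unfolding eta_simps(1,4) by (simp add: algebra_homD[OF comult(1)])
  moreover have "pt (\<Omega> \<beta>) (eta (free_scalar c * wd js + t)) = c \<odot>\<^bsub>TT\<^esub> pt (\<Omega> \<beta>) (eta (wd js)) \<oplus>\<^bsub>TT\<^esub> pt (\<Omega> \<beta>) (eta t)"
    unfolding eta_simps(1,4) by (simp add: W.pt_add_right)
  ultimately have "\<Delta> (eta (free_scalar c * wd js + t)) = pt (\<Omega> \<beta>) (eta (free_scalar c * wd js + t)) \<oplus>\<^bsub>TT\<^esub>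
      first_order \<beta> (\<lambda>i. eta (G i (free_scalar c * wd js + t))) \<oplus>\<^bsub>TT\<^esub> (c \<odot>\<^bsub>TT\<^esub> z' \<oplus>\<^bsub>TT\<^esub> z)"
    using fc[of "\<lambda>i. G i (wd js)"] fc[of "\<lambda>i. G i t"] higher_carrier[OF z(1)] higher_carrier[OF z'(1)]
    by (simp add: z(2) z'(2) W.TA.sm_add_right W.TA.a_ac del: G_simps)
  then show ?case using higher_add[OF higher_smult[OF z'(1)] z(1)] by blast
qed

lemma contract_first_order:
  assumes x: "x \<in> carrier U" and y: "\<And>i. y i \<in> carrier U" and t: "t \<in> higher"
  shows "contract i (pt (\<Omega> \<beta>) x \<oplus>\<^bsub>TT\<^esub> first_order \<beta> y \<oplus>\<^bsub>TT\<^esub> t) =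
    (phi_const i * pairing (\<beta> - simple_root i) (simple_root i)) \<odot>\<^bsub>U\<^esub> y i"
proof -
  have "contract i (first_order \<beta> y) = (\<Oplus>\<^bsub>U\<^esub>j\<in>UNIV. contract i (pt (e j \<otimes>\<^bsub>U\<^esub> \<Omega> (\<beta> - simple_root j)) (y j)))"
    unfolding first_order_def by (rule contract_finsum) (simp_all add: y)
  also have "\<dots> = (\<Oplus>\<^bsub>U\<^esub>j\<in>UNIV. if i = j then (phi_const i * pairing (\<beta> - simple_root j) (simple_root i)) \<odot>\<^bsub>U\<^esub> y j else \<zero>\<^bsub>U\<^esub>)"
    by (rule U.finsum_cong') (auto simp: contract_simps y phi_e_Omega)
  also have "\<dots> = (phi_const i * pairing (\<beta> - simple_root i) (simple_root i)) \<odot>\<^bsub>U\<^esub> y i"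
    by (rule U.finsum_singleton) (auto simp: y)
  finally have 1: "contract i (first_order \<beta> y) = \<dots>" .
  have 2: "contract i t = \<zero>\<^bsub>U\<^esub>"
    using t
  proof induct
    case (step x u c)
    have "x \<in> carrier TT" using step(1) by (auto simp: plus_carrier)
    moreover have "u \<in> carrier TT" by (rule higher_carrier[OF step(2)])
    moreover have "contract i x = \<zero>\<^bsub>U\<^esub>"
      using step(1) by (auto simp: contract_simps phi_monomial_Omega plus_carrier)
    ultimately show ?case using step by (simp add: contract_simps)
  qed (rule contract_zero)
  show ?thesis
    using x y first_order_closed[OF y] higher_carrier[OF t] by (simp add: contract_simps 1 2 phi_Omega)
qed

text \<open>The skew derivation on \<open>U\<^sup>+\<close> is a contraction of the comultiplication, so it is
  well defined although \<open>U\<^sup>+\<close> is only known as a quotient of the free algebra by an unknown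
  kernel.\<close>

lemma contract_comult_eta: "contract i (\<Delta> (eta t)) = phi_const i \<odot>\<^bsub>U\<^esub> eta (diag (\<lambda>l. chi l i) (G i t))"
proof -
  have hom: "contract i (\<Delta> (eta t)) = phi_const i \<odot>\<^bsub>U\<^esub> eta (diag (\<lambda>l. chi l i) (G i t))" if t: "t \<in> homog \<beta>" for t \<beta>
  proof -
    obtain z where z: "z \<in> higher" "\<Delta> (eta t) = pt (\<Omega> \<beta>) (eta t) \<oplus>\<^bsub>TT\<^esub> first_order \<beta> (\<lambda>i. eta (G i t)) \<oplus>\<^bsub>TT\<^esub> z"
      using comult_eta[OF t] by blast
    have "diag (\<lambda>l. chi l i) (G i t) = free_scalar (pairing (\<beta> - simple_root i) (simple_root i)) * G i t"
      using diag_homog(2)[OF G_homog[OF t], of "simple_root i" i] by (simp add: pairing_simple_root)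
    then show ?thesis unfolding z(2) by (subst contract_first_order[OF _ _ z(1)]) simp_all
  qed
  have "Poly_Mapping.keys t \<subseteq> UNIV" by simp
  then show ?thesis
  proof (induct t rule: poly_mapping_span_induct)
    case zero
    show ?case by (rule hom[OF homog.zero])
  next
    case (single u c)
    obtain js where "u = Word js" by (cases u)
    then show ?case using hom[OF homog_scalar[OF homog_wd[OF refl], of c js]] by (simp only: wd_single)
  next
    case (add p q)
    have "\<Delta> (eta p) \<in> carrier TT" "\<Delta> (eta q) \<in> carrier TT" by (simp_all add: algebra_homD(1)[OF comult(1)])
    then show ?case
      unfolding eta_simps(1) by (simp add: algebra_homD[OF comult(1)] contract_simps add U.sm_add_right)
  qed
qed

lemma ker_eta_diag:
  assumes "eta t = \<zero>\<^bsub>U\<^esub>"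
  shows "eta (Om i t) = \<zero>\<^bsub>U\<^esub>" "eta (Om' i t) = \<zero>\<^bsub>U\<^esub>" "eta (diag (\<lambda>l. 1 / chi i l) t) = \<zero>\<^bsub>U\<^esub>" "eta (diag (\<lambda>l. chi l i) t) = \<zero>\<^bsub>U\<^esub>"
proof -
  have R: "x = \<zero>\<^bsub>U\<^esub>" if "x \<otimes>\<^bsub>U\<^esub> w = \<zero>\<^bsub>U\<^esub>" "w \<otimes>\<^bsub>U\<^esub> w' = \<one>\<^bsub>U\<^esub>" "x \<in> carrier U" "w \<in> carrier U" "w' \<in> carrier U" for x w w'
  proof -
    have "x = (x \<otimes>\<^bsub>U\<^esub> w) \<otimes>\<^bsub>U\<^esub> w'" using that(2-) by (simp add: U.m_assoc)
    then show ?thesis using that(1,5) by simp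
  qed
  have L: "x = \<zero>\<^bsub>U\<^esub>" if "w \<otimes>\<^bsub>U\<^esub> x = \<zero>\<^bsub>U\<^esub>" "w' \<otimes>\<^bsub>U\<^esub> w = \<one>\<^bsub>U\<^esub>" "x \<in> carrier U" "w \<in> carrier U" "w' \<in> carrier U" for x w w'
  proof -
    have "x = w' \<otimes>\<^bsub>U\<^esub> (w \<otimes>\<^bsub>U\<^esub> x)" using that(2-) by (simp flip: U.m_assoc)
    then show ?thesis using that(1,5) by simp
  qed
  show "eta (Om i t) = \<zero>\<^bsub>U\<^esub>"
    by (rule R[of _ "\<omega> i" "\<omega>i i"]) (use om_eta(1)[of i t] assms in simp_all)
  show "eta (Om' i t) = \<zero>\<^bsub>U\<^esub>"
    by (rule R[of _ "\<omega>' i" "\<omega>i' i"]) (use om_eta(2)[of i t] assms in simp_all)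
  show "eta (diag (\<lambda>l. 1 / chi i l) t) = \<zero>\<^bsub>U\<^esub>"
    by (rule L[of "\<omega> i" _ "\<omega>i i"]) (use om_eta(1)[of i "diag (\<lambda>l. 1 / chi i l) t"] assms in \<open>simp_all add: diag_diag diag_one\<close>)
  show "eta (diag (\<lambda>l. chi l i) t) = \<zero>\<^bsub>U\<^esub>"
    by (rule L[of "\<omega>' i" _ "\<omega>i' i"]) (use om_eta(2)[of i "diag (\<lambda>l. chi l i) t"] assms in \<open>simp_all add: diag_diag diag_one\<close>)
qed

text \<open>Up to the nonzero scalar and an invertible diagonal operator, which preserves the kernel, the
  contraction of the comultiplication is \<open>F i\<close>.\<close>

lemma ker_eta_F:
  assumes "eta t = \<zero>\<^bsub>U\<^esub>" shows "eta (F i t) = \<zero>\<^bsub>U\<^esub>"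
proof -
  let ?y = "diag (\<lambda>l. chi l i) (G i t)"
  have "phi_const i \<odot>\<^bsub>U\<^esub> eta ?y = \<zero>\<^bsub>U\<^esub>"
    using contract_comult_eta[of i t] assms algebra_hom_zero[OF k_algebra_U W.k_algebra_tensor comult(1)] by (simp add: contract_zero)
  then have "(1 / phi_const i) \<odot>\<^bsub>U\<^esub> (phi_const i \<odot>\<^bsub>U\<^esub> eta ?y) = \<zero>\<^bsub>U\<^esub>" by simp
  then have "eta ?y = \<zero>\<^bsub>U\<^esub>" using phi_const_nonzero[of i] by (subst (asm) U.sm_sm) simp_all
  then have "eta (Om' i (Om' i ?y)) = \<zero>\<^bsub>U\<^esub>" by (intro ker_eta_diag(2))
  moreover have "Om' i (Om' i ?y) = F i t" by (simp add: G_def diag_diag diag_one)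
  ultimately show ?thesis by simp
qed

lemma ker_eta_rho:
  assumes "eta t = \<zero>\<^bsub>U\<^esub>" shows "eta (rho x t) = \<zero>\<^bsub>U\<^esub>"
proof (induct x rule: free_alg_induct)
  case (gen q x)
  then show ?case
    by (cases q) (simp_all add: ker_eta_diag ker_eta_F E_def U.minus_eq)
qed (use assms in simp_all)

lemma eta_rho_relation: "cl x = \<zero>\<^bsub>U\<^esub> \<Longrightarrow> eta (rho x t) = \<zero>\<^bsub>U\<^esub>"
proof -
  assume "cl x = \<zero>\<^bsub>U\<^esub>"
  then have "rho x t \<in> ker_eta"
    by (rule rho_relation_ideal[rotated -1]) (auto simp: eta_rho_serre_e ker_eta_rho)
  then show ?thesis by simp
qed

subsection \<open>Uniqueness of the skew derivatives\<close>

lemma skew_derivative_eta: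
  assumes t: "t \<in> homog \<beta>"
  shows "skew_derivative a d r s i \<beta> (eta t) = eta (G i t)"
proof -
  have "(THE y. skew_derivatives a d r s \<beta> (eta t) y) = (\<lambda>i. eta (G i t))"
  proof (rule the_equality)
    obtain z where z: "z \<in> higher" "\<Delta> (eta t) = pt (\<Omega> \<beta>) (eta t) \<oplus>\<^bsub>TT\<^esub> first_order \<beta> (\<lambda>i. eta (G i t)) \<oplus>\<^bsub>TT\<^esub> z"
      using comult_eta[OF t] by blast
    then show "skew_derivatives a d r s \<beta> (eta t) (\<lambda>i. eta (G i t))"
      unfolding skew_derivatives_def component_eq first_order_def using G_homog[OF t] by auto
    fix y assume y: "skew_derivatives a d r s \<beta> (eta t) y"
    then obtain z' where yc: "\<And>i. y i \<in> eta ` homog (\<beta> - simple_root i)"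
      and z': "z' \<in> higher" "\<Delta> (eta t) = pt (\<Omega> \<beta>) (eta t) \<oplus>\<^bsub>TT\<^esub> first_order \<beta> y \<oplus>\<^bsub>TT\<^esub> z'"
      unfolding skew_derivatives_def component_eq first_order_def by auto
    have yU: "y i \<in> carrier U" for i using yc[of i] by auto
    show "y = (\<lambda>i. eta (G i t))"
    proof
      fix i
      let ?c = "phi_const i * pairing (\<beta> - simple_root i) (simple_root i)"
      have c: "?c \<noteq> 0" using phi_const_nonzero by simp
      have "?c \<odot>\<^bsub>U\<^esub> y i = ?c \<odot>\<^bsub>U\<^esub> eta (G i t)"
        using contract_first_order[OF _ _ z'(1), of "eta t" y i \<beta>] yU contract_first_order[OF _ _ z(1), of "eta t" "\<lambda>i. eta (G i t)" i \<beta>]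
        by (simp add: z(2)[symmetric] z'(2)[symmetric])
      then have "(1 / ?c) \<odot>\<^bsub>U\<^esub> (?c \<odot>\<^bsub>U\<^esub> y i) = (1 / ?c) \<odot>\<^bsub>U\<^esub> (?c \<odot>\<^bsub>U\<^esub> eta (G i t))" by (rule arg_cong)
      then show "y i = eta (G i t)" using c yU by (subst (asm) (1 2) U.sm_sm) simp_all
    qed
  qed
  then show ?thesis by (simp add: skew_derivative_def)
qed

lemma twisted_derivative_eta:
  assumes t: "t \<in> homog \<beta>"
  shows "twisted_derivative a d r s i \<beta> (eta t) = eta (F i t)"
proof -
  have "F i t = Om' i (G i t)" by (simp add: G_def diag_diag diag_one)
  also have "\<dots> = free_scalar (1 / pairing (\<beta> - simple_root i) (simple_root i)) * G i t"
    using diag_homog(3)[OF G_homog[OF t], of "simple_root i" i] by (simp add: pairing_simple_root)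
  finally show ?thesis
    by (simp add: twisted_derivative_def skew_derivative_eta[OF t] flip: pairing_inverse)
qed

end


section \<open>The module algebra structure\<close>

context two_parameter
begin

abbreviation "Upos \<equiv> uq_plus a d r s"

lemma Upos_simps:
  "monoid.mult Upos = monoid.mult U" "one Upos = \<one>\<^bsub>U\<^esub>" "ring.zero Upos = \<zero>\<^bsub>U\<^esub>" "add Upos = add U"
  "module.smult Upos = module.smult U"
  by (simp_all add: uq_plus_def)

lemma k_algebra_Upos: "k_algebra Upos"
  by (rule k_algebra_image[OF k_algebra_free, where h = eta])
    (simp_all add: Upos_simps plus_carrier free_algebra_def)

sublocale Upos: k_algebra "uq_plus a d r s" by (rule k_algebra_Upos)

definition act :: "('i generator, 'k) free_alg set \<Rightarrow> ('i generator, 'k) free_alg set \<Rightarrow> ('i generator, 'k) free_alg set" where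
  "act = (\<lambda>u\<in>carrier U. \<lambda>x\<in>carrier Upos. eta (rho (SOME y. cl y = u) (SOME t. eta t = x)))"

lemma eta_rho_cong:
  assumes "cl y = cl y'" "eta t = eta t'" shows "eta (rho y t) = eta (rho y' t')"
proof -
  have "cl (y - y') = \<zero>\<^bsub>U\<^esub>" "eta (t - t') = \<zero>\<^bsub>U\<^esub>" using assms by simp_all
  from eta_rho_relation[OF this(1), of t] ker_eta_rho[OF this(2), of y']
  have "eta (rho (y - y') t) = \<zero>\<^bsub>U\<^esub>" "eta (rho y' (t - t')) = \<zero>\<^bsub>U\<^esub>" .
  then show ?thesis by simp
qed

lemma act_eq: "act (cl y) (eta t) = eta (rho y t)"
proof -
  have "cl (SOME y'. cl y' = cl y) = cl y" "eta (SOME t'. eta t' = eta t) = eta t"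
    by (rule someI[of _ y], simp) (rule someI[of _ t], simp)
  then have "eta (rho (SOME y'. cl y' = cl y) (SOME t'. eta t' = eta t)) = eta (rho y t)" by (rule eta_rho_cong)
  then show ?thesis by (simp add: act_def plus_carrier)
qed

lemma Upos_cases: assumes "x \<in> carrier Upos" obtains t where "x = eta t"
  using assms by (auto simp: plus_carrier)

lemma act_linear:
  assumes "h \<in> carrier U" "x \<in> carrier Upos"
  shows "act h x \<in> carrier Upos"
    and "y \<in> carrier Upos \<Longrightarrow> act h (x \<oplus>\<^bsub>U\<^esub> y) = act h x \<oplus>\<^bsub>U\<^esub> act h y"
    and "act h (c \<odot>\<^bsub>U\<^esub> x) = c \<odot>\<^bsub>U\<^esub> act h x"
    and "h' \<in> carrier U \<Longrightarrow> act (h \<oplus>\<^bsub>U\<^esub> h') x = act h x \<oplus>\<^bsub>U\<^esub> act h' x"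
    and "act (c \<odot>\<^bsub>U\<^esub> h) x = c \<odot>\<^bsub>U\<^esub> act h x"
    and "h' \<in> carrier U \<Longrightarrow> act (h \<otimes>\<^bsub>U\<^esub> h') x = act h (act h' x)"
proof -
  obtain z t where zt: "h = cl z" "x = eta t" using assms by (elim U_cases Upos_cases) auto
  show "act h x \<in> carrier Upos" by (simp add: zt act_eq plus_carrier)
  show "act h (x \<oplus>\<^bsub>U\<^esub> y) = act h x \<oplus>\<^bsub>U\<^esub> act h y" if "y \<in> carrier Upos"
  proof -
    obtain t' where "y = eta t'" using \<open>y \<in> carrier Upos\<close> by (rule Upos_cases)
    then show ?thesis using act_eq[of z "t + t'"] by (simp add: zt act_eq)
  qed
  show "act h (c \<odot>\<^bsub>U\<^esub> x) = c \<odot>\<^bsub>U\<^esub> act h x"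
    using act_eq[of z "free_scalar c * t"] by (simp add: zt act_eq)
  show "act (h \<oplus>\<^bsub>U\<^esub> h') x = act h x \<oplus>\<^bsub>U\<^esub> act h' x" if "h' \<in> carrier U"
  proof -
    obtain z' where "h' = cl z'" using \<open>h' \<in> carrier U\<close> by (rule U_cases)
    then show ?thesis using act_eq[of "z + z'" t] by (simp add: zt act_eq)
  qed
  show "act (c \<odot>\<^bsub>U\<^esub> h) x = c \<odot>\<^bsub>U\<^esub> act h x"
    using act_eq[of "free_scalar c * z" t] by (simp add: zt act_eq)
  show "act (h \<otimes>\<^bsub>U\<^esub> h') x = act h (act h' x)" if "h' \<in> carrier U"
  proof -
    obtain z' where "h' = cl z'" using \<open>h' \<in> carrier U\<close> by (rule U_cases)
    then show ?thesis using act_eq[of "z * z'" t] by (simp add: zt act_eq)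
  qed
qed

lemma act_one_eta: "act \<one>\<^bsub>U\<^esub> (eta t) = eta t"
  using act_eq[of 1 t] by simp

subsection \<open>Compatibility with the multiplication\<close>

definition act_form where
  "act_form x y = (\<lambda>(u, w). act u x \<otimes>\<^bsub>U\<^esub> act w y)"

lemma act_in_U: "\<lbrakk>h \<in> carrier U; x \<in> carrier Upos\<rbrakk> \<Longrightarrow> act h x \<in> carrier U"
  using act_linear(1)[of h x] by (auto simp: plus_carrier)

lemma act_form_bilinear: "\<lbrakk>x \<in> carrier Upos; y \<in> carrier Upos\<rbrakk> \<Longrightarrow> bilinear_form U U Upos (act_form x y)"
  unfolding bilinear_form_def act_form_def
  using Upos.m_closed
  by (simp add: Upos_simps act_linear act_in_U U.l_distr U.r_distr)

lemma lift_simps: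
  assumes "x \<in> carrier Upos" "y \<in> carrier Upos"
  shows "u \<in> carrier U \<Longrightarrow> w \<in> carrier U \<Longrightarrow> tensor_lift Upos (act_form x y) (pt u w) = act u x \<otimes>\<^bsub>U\<^esub> act w y"
    and "t \<in> carrier TT \<Longrightarrow> tensor_lift Upos (act_form x y) t \<in> carrier Upos"
    and "t \<in> carrier TT \<Longrightarrow> t' \<in> carrier TT \<Longrightarrow>
      tensor_lift Upos (act_form x y) (t \<oplus>\<^bsub>TT\<^esub> t') = tensor_lift Upos (act_form x y) t \<oplus>\<^bsub>U\<^esub> tensor_lift Upos (act_form x y) t'"
    and "t \<in> carrier TT \<Longrightarrow> tensor_lift Upos (act_form x y) (c \<odot>\<^bsub>TT\<^esub> t) = c \<odot>\<^bsub>U\<^esub> tensor_lift Upos (act_form x y) t"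
  using W.tensor_lift_pure[OF k_algebra_Upos act_form_bilinear[OF assms]]
    W.tensor_lift_closed[OF k_algebra_Upos act_form_bilinear[OF assms]]
    W.tensor_lift_add[OF k_algebra_Upos act_form_bilinear[OF assms]]
    W.tensor_lift_smult[OF k_algebra_Upos act_form_bilinear[OF assms]]
  by (simp_all add: Upos_simps act_form_def)

text \<open>The skew Leibniz rules of the operators are the product rules for the generators.\<close>

lemma lift_gen_pure:
  assumes x: "x \<in> carrier Upos" "y \<in> carrier Upos" and u: "u \<in> carrier U" "w \<in> carrier U"
  shows "tensor_lift Upos (act_form x y) (comult_gen q \<otimes>\<^bsub>TT\<^esub> pt u w) =
    act (cl (free_gen q)) (act u x \<otimes>\<^bsub>U\<^esub> act w y)"
proof -
  obtain t1 t2 where t: "act u x = eta t1" "act w y = eta t2"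
    using act_linear(1)[OF u(1) x(1)] act_linear(1)[OF u(2) x(2)] by (elim Upos_cases) auto
  have A: "act (cl z \<otimes>\<^bsub>U\<^esub> u) x = eta (rho z t1)" "act (cl z \<otimes>\<^bsub>U\<^esub> w) y = eta (rho z t2)" for z
    using act_linear(6)[of "cl z" x u] act_linear(6)[of "cl z" y w] x u by (simp_all add: t act_eq)
  have R: "act (cl (free_gen q)) (act u x \<otimes>\<^bsub>U\<^esub> act w y) = eta (gen_op q (t1 * t2))"
    using act_eq[of "free_gen q" "t1 * t2"] by (simp add: t)
  show ?thesis
    unfolding R using x u
    by (cases q) (simp_all add: W.TA.l_distr lift_simps A t E_mult F_mult)
qed

lemma lift_gen:
  assumes x: "x \<in> carrier Upos" "y \<in> carrier Upos" and T: "T \<in> carrier TT"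
  shows "tensor_lift Upos (act_form x y) (comult_gen q \<otimes>\<^bsub>TT\<^esub> T) =
    act (cl (free_gen q)) (tensor_lift Upos (act_form x y) T)"
  using T
proof (induct rule: W.tensor_induct)
  case (pure u w)
  then show ?case using lift_gen_pure[OF x pure] by (simp add: lift_simps x)
next
  case (add T T')
  have "comult_gen q \<otimes>\<^bsub>TT\<^esub> T \<in> carrier TT" "comult_gen q \<otimes>\<^bsub>TT\<^esub> T' \<in> carrier TT"
    using comult_gen_closed add by auto
  then show ?case
    using add comult_gen_closed[of q] x
    by (simp add: W.TA.r_distr lift_simps act_linear(2))
qed

lemma act_product:
  assumes h: "h \<in> carrier U" and x: "x \<in> carrier Upos" "y \<in> carrier Upos"
  shows "act h (x \<otimes>\<^bsub>U\<^esub> y) = tensor_lift Upos (act_form x y) (\<Delta> h)"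
proof -
  note D = algebra_homD[OF comult(1)]
  have xy: "x \<otimes>\<^bsub>U\<^esub> y \<in> carrier Upos" using Upos.m_closed[OF x] by (simp add: Upos_simps)
  obtain z where z: "h = cl z" using h by (rule U_cases)
  have "act (cl z) (x \<otimes>\<^bsub>U\<^esub> y) = tensor_lift Upos (act_form x y) (\<Delta> (cl z))"
  proof (induct z rule: free_alg_induct)
    case one
    obtain t1 t2 where "x = eta t1" "y = eta t2" using x by (elim Upos_cases) auto
    then show ?case
      using act_one_eta[of "t1 * t2"] x by (simp add: D W.pt_one lift_simps act_one_eta)
  next
    case (add z z')
    then show ?case using x xy by (simp add: D lift_simps act_linear)
  next
    case (smult c z)
    then show ?case unfolding cl_simps(4) using x xy by (simp add: D lift_simps act_linear)
  next
    case (gen q z)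
    have "act (cl (free_gen q * z)) (x \<otimes>\<^bsub>U\<^esub> y) = act (cl (free_gen q)) (act (cl z) (x \<otimes>\<^bsub>U\<^esub> y))"
      using xy by (simp add: act_linear)
    also have "\<dots> = tensor_lift Upos (act_form x y) (comult_gen q \<otimes>\<^bsub>TT\<^esub> \<Delta> (cl z))"
      unfolding gen using lift_gen[OF x, of "\<Delta> (cl z)" q] by (simp add: D)
    also have "comult_gen q \<otimes>\<^bsub>TT\<^esub> \<Delta> (cl z) = \<Delta> (cl (free_gen q * z))"
      using D(2)[of "cl (free_gen q)" "cl z"] by (simp add: comult(2))
    finally show ?case .
  qed
  then show ?thesis by (simp add: z)
qed

lemma act_unit: "act (cl z) \<one>\<^bsub>U\<^esub> = \<epsilon> (cl z) \<odot>\<^bsub>U\<^esub> \<one>\<^bsub>U\<^esub>"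
proof -
  note C = algebra_homD[OF counit(1)]
  have gs: "carrier (ground_algebra :: ('k, 'k) module) = UNIV" "monoid.mult (ground_algebra :: ('k, 'k) module) = (*)"
    "one (ground_algebra :: ('k, 'k) module) = 1" "add (ground_algebra :: ('k, 'k) module) = (+)"
    "module.smult (ground_algebra :: ('k, 'k) module) = (*)"
    by (simp_all add: ground_algebra_def)
  have Ec: "E i (free_scalar c) = 0" for i c using E_scalar[of i c 1] by simp
  have "rho z 1 = free_scalar (\<epsilon> (cl z))"
  proof (induct z rule: free_alg_induct)
    case (gen q z)
    have "gen_op q (free_scalar c) = free_scalar (counit_gen q * c)" for c
      by (cases q) (simp_all add: Ec)
    then show ?case using gen by (simp add: C counit(2) gs)
  next
    case (smult c z)
    then show ?case unfolding cl_simps(4) by (simp add: C gs)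
  qed (simp_all add: C gs free_scalar_add)
  then show ?thesis using act_eq[of z 1] by simp
qed

lemma module_algebra_act: "module_algebra U \<Delta> \<epsilon> Upos act"
proof (intro module_algebra.intro module_algebra_axioms.intro k_algebra_U k_algebra_Upos comult(1) counit(1))
  fix h assume h: "h \<in> carrier U"
  then obtain z where z: "h = cl z" by (rule U_cases)
  show "act h \<one>\<^bsub>Upos\<^esub> = \<epsilon> h \<odot>\<^bsub>Upos\<^esub> \<one>\<^bsub>Upos\<^esub>" by (simp add: Upos_simps z act_unit)
  fix x assume x: "x \<in> carrier Upos"
  show "act h x \<in> carrier Upos" using h x by (rule act_linear)
  show "act h (c \<odot>\<^bsub>Upos\<^esub> x) = c \<odot>\<^bsub>Upos\<^esub> act h x" and "act (c \<odot>\<^bsub>U\<^esub> h) x = c \<odot>\<^bsub>Upos\<^esub> act h x" for c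
    using h x by (simp_all add: Upos_simps act_linear)
  show "act (h \<oplus>\<^bsub>U\<^esub> h') x = act h x \<oplus>\<^bsub>Upos\<^esub> act h' x" and "act (h \<otimes>\<^bsub>U\<^esub> h') x = act h (act h' x)" if "h' \<in> carrier U" for h'
    using h x that by (simp_all add: Upos_simps act_linear)
  show "act h (x \<oplus>\<^bsub>Upos\<^esub> y) = act h x \<oplus>\<^bsub>Upos\<^esub> act h y" if "y \<in> carrier Upos" for y
    using h x that by (simp add: Upos_simps act_linear)
  show "act h (x \<otimes>\<^bsub>Upos\<^esub> y) = (\<Oplus>\<^bsub>Upos\<^esub>u\<in>Poly_Mapping.keys p. Poly_Mapping.lookup p u \<odot>\<^bsub>Upos\<^esub> (act (fst u) x \<otimes>\<^bsub>Upos\<^esub> act (snd u) y))"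
    if "p \<in> \<Delta> h" "y \<in> carrier Upos" for p y
  proof -
    have "tensor_lift Upos (act_form x y) (\<Delta> h) = lin_ext Upos (act_form x y) p"
      by (rule W.tensor_lift_rep(3)[OF k_algebra_Upos act_form_bilinear])
        (use x that algebra_homD(1)[OF comult(1) h] in auto)
    then show ?thesis
      using act_product[OF h x that(2)] by (simp add: lin_ext_def act_form_def Upos_simps case_prod_beta)
  qed
next
  fix x assume "x \<in> carrier Upos"
  then show "act \<one>\<^bsub>U\<^esub> x = x" by (elim Upos_cases) (simp add: act_one_eta)
qed

subsection \<open>Characterization of the action\<close>

definition prescribed_action ::
  "(('i generator, 'k) free_alg set \<Rightarrow> ('i generator, 'k) free_alg set \<Rightarrow> ('i generator, 'k) free_alg set) \<Rightarrow> bool" where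
  "prescribed_action Op \<longleftrightarrow> (\<forall>\<beta>\<in>positive_cone. \<forall>x\<in>uq_plus_component a d r s \<beta>.
        (\<forall>\<mu>. Op (\<Omega> \<mu>) x = pairing \<mu> \<beta> \<odot>\<^bsub>U\<^esub> x) \<and>
        (\<forall>\<mu>. Op (\<Omega>' \<mu>) x = (1 / pairing \<beta> \<mu>) \<odot>\<^bsub>U\<^esub> x) \<and>
        (\<forall>i. Op (e i) x = kappa i \<odot>\<^bsub>U\<^esub> (e i \<otimes>\<^bsub>U\<^esub> x \<ominus>\<^bsub>U\<^esub> pairing (simple_root i) \<beta> \<odot>\<^bsub>U\<^esub> (x \<otimes>\<^bsub>U\<^esub> e i))) \<and>
        (\<forall>i. Op (f i) x = twisted_derivative a d r s i \<beta> x))"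

lemma prescribed_action_act: "prescribed_action act"
  unfolding prescribed_action_def component_eq
proof (intro ballI conjI allI)
  fix \<beta> x assume "x \<in> eta ` homog \<beta>"
  then obtain t where t: "x = eta t" "t \<in> homog \<beta>" by auto
  show "act (\<Omega> \<mu>) x = pairing \<mu> \<beta> \<odot>\<^bsub>U\<^esub> x" for \<mu>
  proof -
    obtain y where y: "cl y = \<Omega> \<mu>" "\<And>t. rho y t = diag (\<lambda>l. pairing \<mu> (simple_root l)) t" using Omega_lift by blast
    show ?thesis using act_eq[of y t] by (simp add: y t diag_homog(1)[OF t(2)])
  qed
  show "act (\<Omega>' \<mu>) x = (1 / pairing \<beta> \<mu>) \<odot>\<^bsub>U\<^esub> x" for \<mu>
  proof -
    obtain y where y: "cl y = \<Omega>' \<mu>" "\<And>t. rho y t = diag (\<lambda>l. 1 / pairing (simple_root l) \<mu>) t" using Omega'_lift by blast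
    show ?thesis using act_eq[of y t] by (simp add: y t diag_homog(3)[OF t(2)])
  qed
  show "act (e i) x = kappa i \<odot>\<^bsub>U\<^esub> (e i \<otimes>\<^bsub>U\<^esub> x \<ominus>\<^bsub>U\<^esub> pairing (simple_root i) \<beta> \<odot>\<^bsub>U\<^esub> (x \<otimes>\<^bsub>U\<^esub> e i))" for i
    using act_eq[of "gE i" t] diag_homog(1)[OF t(2), of "simple_root i"]
    by (simp add: t E_def pairing_simple_root mult.assoc)
  show "act (f i) x = twisted_derivative a d r s i \<beta> x" for i
    using act_eq[of "gF i" t] by (simp add: t twisted_derivative_eta[OF t(2)])
qed

lemma act_extensional: "act \<in> carrier U \<rightarrow>\<^sub>E (carrier Upos \<rightarrow>\<^sub>E carrier Upos)"
proof (rule PiE_I)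
  show "act h \<in> carrier Upos \<rightarrow>\<^sub>E carrier Upos" if "h \<in> carrier U" for h
  proof (rule PiE_I)
    show "act h x \<in> carrier Upos" if "x \<in> carrier Upos" for x
      using \<open>h \<in> carrier U\<close> that by (rule act_linear)
    show "act h x = undefined" if "x \<notin> carrier Upos" for x
      using \<open>h \<in> carrier U\<close> that by (simp add: act_def)
  qed
qed (simp add: act_def)

lemma Omega_inverse: "\<Omega> (- simple_root i) = \<omega>i i" "\<Omega>' (- simple_root i) = \<omega>i' i"
proof -
  have "\<omega> i \<otimes>\<^bsub>U\<^esub> \<Omega> (- simple_root i) = \<one>\<^bsub>U\<^esub>" "\<omega>' i \<otimes>\<^bsub>U\<^esub> \<Omega>' (- simple_root i) = \<one>\<^bsub>U\<^esub>"
    using Omega_step[of i "- simple_root i"] by simp_all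
  then have "\<omega>i i \<otimes>\<^bsub>U\<^esub> (\<omega> i \<otimes>\<^bsub>U\<^esub> \<Omega> (- simple_root i)) = \<omega>i i" "\<omega>i' i \<otimes>\<^bsub>U\<^esub> (\<omega>' i \<otimes>\<^bsub>U\<^esub> \<Omega>' (- simple_root i)) = \<omega>i' i"
    by simp_all
  then show "\<Omega> (- simple_root i) = \<omega>i i" "\<Omega>' (- simple_root i) = \<omega>i' i"
    by (simp_all flip: U.m_assoc)
qed

lemma wt_positive: "wt js \<in> positive_cone"
  by (induct js) (auto simp: positive_cone_def lookup_simple_root)

text \<open>The prescribed values determine the action of all generators, since \<open>U\<^sup>+\<close> is the sum of its
  components and \<open>\<omega>\<^sub>i\<inverse> = \<omega>\<^sub>-\<^sub>\<alpha>\<close> is among the prescribed elements; the module axioms do the rest.\<close>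

lemma prescribed_action_unique:
  assumes M: "module_algebra U \<Delta> \<epsilon> Upos A" "module_algebra U \<Delta> \<epsilon> Upos B"
    and P: "prescribed_action A" "prescribed_action B"
    and h: "h \<in> carrier U" and x: "x \<in> carrier Upos"
  shows "A h x = B h x"
proof -
  interpret A: module_algebra U \<Delta> \<epsilon> Upos A by (rule M)
  interpret B: module_algebra U \<Delta> \<epsilon> Upos B by (rule M)
  have gen: "A (cl (free_gen q)) (eta t) = B (cl (free_gen q)) (eta t)" for q t
  proof -
    have "Poly_Mapping.keys t \<subseteq> UNIV" by simp
    then show ?thesis
    proof (induct t rule: poly_mapping_span_induct)
      case zero
      have z: "eta 0 = 0 \<odot>\<^bsub>Upos\<^esub> eta 0" "eta 0 \<in> carrier Upos"
        by (simp add: Upos_simps) (unfold plus_carrier, rule rangeI)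
      have "A (cl (free_gen q)) (eta 0) = 0 \<odot>\<^bsub>Upos\<^esub> A (cl (free_gen q)) (eta 0)"
        using A.act_smult[OF _ z(2), of "cl (free_gen q)" 0] z(1) by simp
      moreover have "B (cl (free_gen q)) (eta 0) = 0 \<odot>\<^bsub>Upos\<^esub> B (cl (free_gen q)) (eta 0)"
        using B.act_smult[OF _ z(2), of "cl (free_gen q)" 0] z(1) by simp
      ultimately show ?case
        using A.act_closed[OF _ z(2), of "cl (free_gen q)"] B.act_closed[OF _ z(2), of "cl (free_gen q)"]
        by (metis Upos.sm_zero_left cl_simps(5))
    next
      case (single u c)
      obtain js where js: "u = Word js" by (cases u)
      have c: "eta (Poly_Mapping.single u c) \<in> uq_plus_component a d r s (wt js)"
        unfolding component_eq js wd_single by (intro imageI homog_scalar homog_wd refl)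
      note a = P(1)[unfolded prescribed_action_def, rule_format, OF wt_positive c]
      note b = P(2)[unfolded prescribed_action_def, rule_format, OF wt_positive c]
      have om: "A (\<Omega> \<mu>) (eta (Poly_Mapping.single u c)) = B (\<Omega> \<mu>) (eta (Poly_Mapping.single u c))"
        "A (\<Omega>' \<mu>) (eta (Poly_Mapping.single u c)) = B (\<Omega>' \<mu>) (eta (Poly_Mapping.single u c))" for \<mu>
        using a b by simp_all
      show ?case
      proof (cases q)
        case (Gen_om i) then show ?thesis using om(1)[of "simple_root i"] by simp
      next
        case (Gen_om' i) then show ?thesis using om(2)[of "simple_root i"] by simp
      next
        case (Gen_om_inv i) then show ?thesis using om(1)[of "- simple_root i"] by (simp add: Omega_inverse)
      next
        case (Gen_om_inv' i) then show ?thesis using om(2)[of "- simple_root i"] by (simp add: Omega_inverse)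
      qed (use a b in simp_all)
    next
      case (add p q')
      have "eta p \<in> carrier Upos" "eta q' \<in> carrier Upos" by (simp_all add: plus_carrier)
      then show ?case
        using A.act_add[of "cl (free_gen q)" "eta p" "eta q'"] B.act_add[of "cl (free_gen q)" "eta p" "eta q'"] add
        by (simp add: Upos_simps)
    qed
  qed
  have "\<forall>x\<in>carrier Upos. A (cl z) x = B (cl z) x" for z
  proof (induct z rule: free_alg_induct)
    case one
    show ?case using A.one_act B.one_act by simp
  next
    case (add z z')
    then show ?case using A.add_act[of "cl z" "cl z'"] B.add_act[of "cl z" "cl z'"] by simp
  next
    case (smult c z)
    then show ?case unfolding cl_simps(4) using A.smult_act[of "cl z"] B.smult_act[of "cl z"] by simp
  next
    case (gen q z)
    show ?case
    proof
      fix x assume x: "x \<in> carrier Upos"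
      have "B (cl z) x \<in> carrier Upos" using x by (simp add: B.act_closed)
      then obtain t where "B (cl z) x = eta t" by (rule Upos_cases)
      then show "A (cl (free_gen q * z)) x = B (cl (free_gen q * z)) x"
        using gen x gen A.mult_act[of "cl (free_gen q)" "cl z" x] B.mult_act[of "cl (free_gen q)" "cl z" x]
          \<open>\<And>q t. A (cl (free_gen q)) (eta t) = B (cl (free_gen q)) (eta t)\<close>[of q t]
        by simp
    qed
  qed
  then show ?thesis using h x by (elim U_cases) auto
qed

lemma prescribed_action_iff:
  "prescribed_action Op \<longleftrightarrow> (\<forall>\<beta>\<in>positive_cone. \<forall>x\<in>uq_plus_component a d r s \<beta>.
        (\<forall>\<mu>. Op (uq_om a d r s \<mu>) x =
          (r powi euler_form a d \<beta> \<mu> * s powi (- euler_form a d \<mu> \<beta>)) \<odot>\<^bsub>uq a d r s\<^esub> x) \<and>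
        (\<forall>\<mu>. Op (uq_om' a d r s \<mu>) x =
          (r powi (- euler_form a d \<mu> \<beta>) * s powi euler_form a d \<beta> \<mu>) \<odot>\<^bsub>uq a d r s\<^esub> x) \<and>
        (\<forall>i. Op (uq_e a d r s i) x =
          (1 / (r ^ d i - s ^ d i)) \<odot>\<^bsub>uq a d r s\<^esub>
            (uq_e a d r s i \<otimes>\<^bsub>uq a d r s\<^esub> x \<ominus>\<^bsub>uq a d r s\<^esub>
              (r powi euler_form a d \<beta> (simple_root i) * s powi (- euler_form a d (simple_root i) \<beta>))
                \<odot>\<^bsub>uq a d r s\<^esub> (x \<otimes>\<^bsub>uq a d r s\<^esub> uq_e a d r s i))) \<and>
        (\<forall>i. Op (uq_f a d r s i) x = twisted_derivative a d r s i \<beta> x))"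
  unfolding prescribed_action_def pairing_inverse unfolding pairing_def kappa_def uq_e_f ..

lemma unique_module_algebra:
  "\<exists>!act. act \<in> carrier U \<rightarrow>\<^sub>E (carrier Upos \<rightarrow>\<^sub>E carrier Upos) \<and> module_algebra U \<Delta> \<epsilon> Upos act \<and> prescribed_action act"
proof (rule ex1I[of _ act])
  show "act \<in> carrier U \<rightarrow>\<^sub>E (carrier Upos \<rightarrow>\<^sub>E carrier Upos) \<and> module_algebra U \<Delta> \<epsilon> Upos act \<and> prescribed_action act"
    using act_extensional module_algebra_act prescribed_action_act by blast
  fix B assume B: "B \<in> carrier U \<rightarrow>\<^sub>E (carrier Upos \<rightarrow>\<^sub>E carrier Upos) \<and> module_algebra U \<Delta> \<epsilon> Upos B \<and> prescribed_action B"
  show "B = act"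
  proof (rule PiE_ext)
    show "B \<in> carrier U \<rightarrow>\<^sub>E (carrier Upos \<rightarrow>\<^sub>E carrier Upos)" "act \<in> carrier U \<rightarrow>\<^sub>E (carrier Upos \<rightarrow>\<^sub>E carrier Upos)"
      using B act_extensional by auto
    fix h assume h: "h \<in> carrier U"
    show "B h = act h"
    proof (rule PiE_ext)
      show "B h \<in> carrier Upos \<rightarrow>\<^sub>E carrier Upos" "act h \<in> carrier Upos \<rightarrow>\<^sub>E carrier Upos"
        using PiE_mem[OF _ h] B act_extensional by blast+
      show "B h x = act h x" if "x \<in> carrier Upos" for x
        using prescribed_action_unique[OF _ module_algebra_act _ prescribed_action_act h that] B by blast
    qed
  qed
qed

end

lemma alg_independent_pair_nonzero:
  assumes "alg_independent_pair r s" shows "r \<noteq> 0" "s \<noteq> 0"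
proof -
  have "(\<Sum>(k, l)\<in>Poly_Mapping.keys p. of_rat (Poly_Mapping.lookup p (k, l)) * r ^ k * s ^ l) \<noteq> 0"
    if "p = Poly_Mapping.single kl 1" for p :: "nat \<times> nat \<Rightarrow>\<^sub>0 rat" and kl
  proof -
    have "p \<noteq> 0" using that by (metis lookup_single_eq lookup_zero zero_neq_one)
    then show ?thesis using assms unfolding alg_independent_pair_def by blast
  qed
  from this[OF refl, of "(1, 0)"] this[OF refl, of "(0, 1)"] show "r \<noteq> 0" "s \<noteq> 0"
    by auto
qed

theorem theorem20:
  fixes a :: "'i::{finite,linorder} \<Rightarrow> 'i \<Rightarrow> int"
    and d :: "'i \<Rightarrow> nat"
    and r s :: "'k::field_char_0"
  assumes cartan: "simple_cartan_matrix a"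
    and d_pos: "\<And>i. d i > 0"
    and d_coprime: "Gcd (range d) = 1"
    and d_symm: "\<And>i j. int (d i) * a i j = int (d j) * a j i"
    and indeterminates: "alg_independent_pair r s"
    and root_exists: "\<exists>z. z ^ weight_exponent a = r / s"
    and not_root_of_unity: "\<And>n::nat. n > 0 \<Longrightarrow> (r / s) ^ n \<noteq> 1"
  shows "\<exists>!act.
      act \<in> carrier (uq a d r s) \<rightarrow>\<^sub>E
        (carrier (uq_plus a d r s) \<rightarrow>\<^sub>E carrier (uq_plus a d r s)) \<and>
      module_algebra (uq a d r s) (uq_comult a d r s) (uq_counit a d r s) (uq_plus a d r s) act \<and>
      (\<forall>\<beta>\<in>positive_cone. \<forall>x\<in>uq_plus_component a d r s \<beta>.
        (\<forall>\<mu>. act (uq_om a d r s \<mu>) x =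
          (r powi euler_form a d \<beta> \<mu> * s powi (- euler_form a d \<mu> \<beta>)) \<odot>\<^bsub>uq a d r s\<^esub> x) \<and>
        (\<forall>\<mu>. act (uq_om' a d r s \<mu>) x =
          (r powi (- euler_form a d \<mu> \<beta>) * s powi euler_form a d \<beta> \<mu>) \<odot>\<^bsub>uq a d r s\<^esub> x) \<and>
        (\<forall>i. act (uq_e a d r s i) x =
          (1 / (r ^ d i - s ^ d i)) \<odot>\<^bsub>uq a d r s\<^esub>
            (uq_e a d r s i \<otimes>\<^bsub>uq a d r s\<^esub> x \<ominus>\<^bsub>uq a d r s\<^esub>
              (r powi euler_form a d \<beta> (simple_root i) * s powi (- euler_form a d (simple_root i) \<beta>))
                \<odot>\<^bsub>uq a d r s\<^esub> (x \<otimes>\<^bsub>uq a d r s\<^esub> uq_e a d r s i))) \<and>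
        (\<forall>i. act (uq_f a d r s i) x = twisted_derivative a d r s i \<beta> x))"
proof -
  interpret two_parameter a d r s
    by unfold_locales
      (use cartan d_pos d_symm not_root_of_unity alg_independent_pair_nonzero[OF indeterminates]
        in \<open>auto simp: simple_cartan_matrix_def\<close>)
  show ?thesis
    using unique_module_algebra unfolding prescribed_action_iff .
qed

end
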